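(* There is an algorithm that, given any convex polygon $P$ in the plane with $n$ vertices, finds in time $O(n^3)$ a maximum-area rectangle contained in $P$, i.e. a rectangle $R\subseteq P$ (of arbitrary orientation) such that $\operatorname{area}(R)\ge \operatorname{area}(R')$ for every rectangle $R'\subseteq P$.
   Context: Rectangles may have arbitrary orientation (they need not be axis-parallel). Running times are in the real-number model of computation of computational geometry (unit-cost exact operations on real numbers), in which an optimization problem with a constant number of real variables, a constant number of polynomial constraints of bounded degree, and a polynomial objective of bounded degree is solved in constant time. *)

theory Defs
  imports "HOL-Analysis.Analysis" "HOL-Library.Landau_Symbols"
begin

section \<open>Rectangles and convex polygons in the plane\<close>

text \<open>The corners are listed in cyclic order.  Both sides have positive length.\<close>

definition rect_corners :: "real^2 \<Rightarrow> real^2 \<Rightarrow> real^2 \<Rightarrow> real^2 \<Rightarrow> bool" where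
  "rect_corners a b c d \<longleftrightarrow>
     a \<noteq> b \<and> a \<noteq> d \<and> orthogonal (b - a) (d - a) \<and> c - d = b - a"

definition rectangle :: "(real^2) set \<Rightarrow> bool" where
  "rectangle R \<longleftrightarrow> (\<exists>a b c d. rect_corners a b c d \<and> R = convex hull {a, b, c, d})"

definition area :: "(real^2) set \<Rightarrow> real" where
  "area R = measure lebesgue R"

definition max_area_rectangle_in :: "(real^2) set \<Rightarrow> (real^2) set \<Rightarrow> bool" where
  "max_area_rectangle_in P R \<longleftrightarrow>
     rectangle R \<and> R \<subseteq> P \<and> (\<forall>R'. rectangle R' \<and> R' \<subseteq> P \<longrightarrow> area R' \<le> area R)"

text \<open>The list enumerates the vertices of the polygon along its boundary, in either orientation.\<close>

definition convex_polygon :: "(real^2) set \<Rightarrow> (real^2) list \<Rightarrow> bool" where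
  "convex_polygon P vs \<longleftrightarrow>
     polytope P \<and> aff_dim P = 2 \<and> distinct vs \<and> set vs = {x. x extreme_point_of P} \<and>
     (\<forall>i<length vs. closed_segment (vs ! i) (vs ! (Suc i mod length vs)) edge_of P)"


section \<open>A real RAM\<close>

text \<open>
  A program works on two unbounded memories, one holding natural numbers (counters and
  addresses) and one holding real numbers, both with indirect addressing.  Naturals support
  only addition and truncated subtraction; reals support exact field operations and comparison.
  There is no conversion from reals to naturals (in particular no rounding), and the only
  constants in a program are integers.
\<close>

record store =
  nmem :: "nat \<Rightarrow> nat"
  rmem :: "nat \<Rightarrow> real"

datatype nexp = NConst nat | NRead nexp | NAdd nexp nexp | NSub nexp nexp

datatype rexp = RConst int | RRead nexp | RAdd rexp rexp | RSub rexp rexp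
  | RMul rexp rexp | RDiv rexp rexp

datatype bexp = NLess nexp nexp | RLess rexp rexp | BNot bexp | BAnd bexp bexp

text \<open>
  Polynomials in the variables \<open>PVar 0, PVar 1, \<dots>\<close> whose coefficients are computed from the
  current store.
\<close>

datatype pexp = PCoeff rexp | PVar nat | PAdd pexp pexp | PMul pexp pexp

text \<open>
  \<open>Maximize f a k obj cs\<close> solves: maximize \<open>obj\<close> subject to \<open>g \<ge> 0\<close> for all \<open>g\<close> in \<open>cs\<close>.  If the
  maximum is attained, 1 is stored in natural cell \<open>f\<close> and the values of the first \<open>k\<close> variables of
  a maximizer are stored in the real cells \<open>a, \<dots>, a + k - 1\<close>; otherwise 0 is stored in \<open>f\<close>.
  The number of variables and constraints and the degrees are fixed by the program text, so they
  do not depend on the input.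
\<close>

datatype com =
    Skip
  | NWrite nexp nexp
  | RWrite nexp rexp
  | Maximize nexp nexp nat pexp "pexp list"
  | Seq com com
  | Cond bexp com com
  | While bexp com

primrec nval :: "nexp \<Rightarrow> store \<Rightarrow> nat" where
  "nval (NConst m) s = m"
| "nval (NRead e) s = nmem s (nval e s)"
| "nval (NAdd e f) s = nval e s + nval f s"
| "nval (NSub e f) s = nval e s - nval f s"

primrec rval :: "rexp \<Rightarrow> store \<Rightarrow> real" where
  "rval (RConst z) s = of_int z"
| "rval (RRead e) s = rmem s (nval e s)"
| "rval (RAdd e f) s = rval e s + rval f s"
| "rval (RSub e f) s = rval e s - rval f s"
| "rval (RMul e f) s = rval e s * rval f s"
| "rval (RDiv e f) s = rval e s / rval f s"

primrec bval :: "bexp \<Rightarrow> store \<Rightarrow> bool" where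
  "bval (NLess e f) s \<longleftrightarrow> nval e s < nval f s"
| "bval (RLess e f) s \<longleftrightarrow> rval e s < rval f s"
| "bval (BNot b) s \<longleftrightarrow> \<not> bval b s"
| "bval (BAnd b c) s \<longleftrightarrow> bval b s \<and> bval c s"

primrec pval :: "pexp \<Rightarrow> store \<Rightarrow> (nat \<Rightarrow> real) \<Rightarrow> real" where
  "pval (PCoeff e) s x = rval e s"
| "pval (PVar i) s x = x i"
| "pval (PAdd p q) s x = pval p s x + pval q s x"
| "pval (PMul p q) s x = pval p s x * pval q s x"

text \<open>Every constant, memory access and operation has cost 1.\<close>

primrec ncost :: "nexp \<Rightarrow> nat" where
  "ncost (NConst m) = 1"
| "ncost (NRead e) = 1 + ncost e"
| "ncost (NAdd e f) = 1 + ncost e + ncost f"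
| "ncost (NSub e f) = 1 + ncost e + ncost f"

primrec rcost :: "rexp \<Rightarrow> nat" where
  "rcost (RConst z) = 1"
| "rcost (RRead e) = 1 + ncost e"
| "rcost (RAdd e f) = 1 + rcost e + rcost f"
| "rcost (RSub e f) = 1 + rcost e + rcost f"
| "rcost (RMul e f) = 1 + rcost e + rcost f"
| "rcost (RDiv e f) = 1 + rcost e + rcost f"

primrec bcost :: "bexp \<Rightarrow> nat" where
  "bcost (NLess e f) = 1 + ncost e + ncost f"
| "bcost (RLess e f) = 1 + rcost e + rcost f"
| "bcost (BNot b) = 1 + bcost b"
| "bcost (BAnd b c) = 1 + bcost b + bcost c"

primrec pcost :: "pexp \<Rightarrow> nat" where
  "pcost (PCoeff e) = rcost e"
| "pcost (PVar i) = 1"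
| "pcost (PAdd p q) = 1 + pcost p + pcost q"
| "pcost (PMul p q) = 1 + pcost p + pcost q"

text \<open>
  Maximizers need not be unique.  The choice among them is made by a solver, about which
  nothing is known except that it returns a maximizer whenever there is one.
\<close>

type_synonym solver =
  "((nat \<Rightarrow> real) \<Rightarrow> real) \<Rightarrow> (nat \<Rightarrow> real) set \<Rightarrow> (nat \<Rightarrow> real)"

definition exact_solver :: "solver \<Rightarrow> bool" where
  "exact_solver \<sigma> \<longleftrightarrow>
     (\<forall>f S. (\<exists>x. is_arg_max f (\<lambda>y. y \<in> S) x) \<longrightarrow> is_arg_max f (\<lambda>y. y \<in> S) (\<sigma> f S))"

definition feasible :: "pexp list \<Rightarrow> store \<Rightarrow> (nat \<Rightarrow> real) set" where
  "feasible cs s = {x. \<forall>g\<in>set cs. 0 \<le> pval g s x}"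

definition maximize ::
    "solver \<Rightarrow> nat \<Rightarrow> nat \<Rightarrow> nat \<Rightarrow> pexp \<Rightarrow> pexp list \<Rightarrow> store \<Rightarrow> store" where
  "maximize \<sigma> f a k obj cs s =
     (if \<exists>x. is_arg_max (pval obj s) (\<lambda>y. y \<in> feasible cs s) x
      then s\<lparr>nmem := (nmem s)(f := 1),
             rmem := (\<lambda>i. if a \<le> i \<and> i < a + k
                          then \<sigma> (pval obj s) (feasible cs s) (i - a) else rmem s i)\<rparr>
      else s\<lparr>nmem := (nmem s)(f := 0)\<rparr>)"

text \<open>
  \<open>exec \<sigma> c s t s'\<close>: with solver \<open>\<sigma>\<close>, program \<open>c\<close> started in store \<open>s\<close> halts in store \<open>s'\<close> at
  total cost \<open>t\<close>.
\<close>

inductive exec :: "solver \<Rightarrow> com \<Rightarrow> store \<Rightarrow> nat \<Rightarrow> store \<Rightarrow> bool" for \<sigma> where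
  Skip: "exec \<sigma> Skip s 1 s"
| NWrite: "exec \<sigma> (NWrite a e) s (1 + ncost a + ncost e)
     (s\<lparr>nmem := (nmem s)(nval a s := nval e s)\<rparr>)"
| RWrite: "exec \<sigma> (RWrite a e) s (1 + ncost a + rcost e)
     (s\<lparr>rmem := (rmem s)(nval a s := rval e s)\<rparr>)"
| Maximize: "exec \<sigma> (Maximize f a k obj cs) s
     (1 + ncost f + ncost a + k + pcost obj + sum_list (map pcost cs))
     (maximize \<sigma> (nval f s) (nval a s) k obj cs s)"
| Seq: "exec \<sigma> c s t s' \<Longrightarrow> exec \<sigma> d s' t' s'' \<Longrightarrow> exec \<sigma> (Seq c d) s (t + t') s''"
| CondTrue: "bval b s \<Longrightarrow> exec \<sigma> c s t s' \<Longrightarrow> exec \<sigma> (Cond b c d) s (1 + bcost b + t) s'"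
| CondFalse: "\<not> bval b s \<Longrightarrow> exec \<sigma> d s t s' \<Longrightarrow> exec \<sigma> (Cond b c d) s (1 + bcost b + t) s'"
| WhileFalse: "\<not> bval b s \<Longrightarrow> exec \<sigma> (While b c) s (1 + bcost b) s"
| WhileTrue: "bval b s \<Longrightarrow> exec \<sigma> c s t s' \<Longrightarrow> exec \<sigma> (While b c) s' t' s'' \<Longrightarrow>
     exec \<sigma> (While b c) s (1 + bcost b + t + t') s''"

text \<open>
  For a fixed solver execution is deterministic, so a halting run found for given \<open>\<sigma>\<close>, \<open>c\<close>, \<open>s\<close>
  is the only one.
\<close>

lemma exec_deterministic:
  assumes "exec \<sigma> c s t s'" "exec \<sigma> c s u s''"
  shows "t = u \<and> s' = s''"
  using assms
proof (induction arbitrary: u s'' rule: exec.induct)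
  case (Skip s)
  then show ?case by (cases rule: exec.cases) simp_all
next
  case (NWrite a e s)
  then show ?case by (cases rule: exec.cases) simp_all
next
  case (RWrite a e s)
  then show ?case by (cases rule: exec.cases) simp_all
next
  case (Maximize f a k obj cs s)
  then show ?case by (cases rule: exec.cases) simp_all
next
  case (Seq c s t s' d t' s3)
  from Seq.prems show ?case
  proof (cases rule: exec.cases)
    case (Seq t1 r t2)
    with Seq.IH(1)[of t1 r] Seq.IH(2)[of t2 s''] show ?thesis by simp
  qed
next
  case (CondTrue b s c t s' d)
  from CondTrue.prems show ?case
  proof (cases rule: exec.cases)
    case (CondTrue t1)
    with CondTrue.IH[of t1 s''] show ?thesis by simp
  next
    case CondFalse
    with CondTrue.hyps show ?thesis by simp
  qed
next
  case (CondFalse b s d t s' c)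
  from CondFalse.prems show ?case
  proof (cases rule: exec.cases)
    case CondTrue
    with CondFalse.hyps show ?thesis by simp
  next
    case (CondFalse t1)
    with CondFalse.IH[of t1 s''] show ?thesis by simp
  qed
next
  case (WhileFalse b s c)
  from WhileFalse.prems show ?case
  proof (cases rule: exec.cases)
    case WhileFalse
    then show ?thesis by simp
  next
    case WhileTrue
    with WhileFalse.hyps show ?thesis by simp
  qed
next
  case (WhileTrue b s c t s' t' s3)
  from WhileTrue.prems show ?case
  proof (cases rule: exec.cases)
    case WhileFalse
    with WhileTrue.hyps show ?thesis by simp
  next
    case (WhileTrue t1 r t2)
    with WhileTrue.IH(1)[of t1 r] WhileTrue.IH(2)[of t2 s''] show ?thesis by simp
  qed
qed

lemma exact_solver_exists: "\<exists>\<sigma>. exact_solver \<sigma>"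
  unfolding exact_solver_def
  by (rule exI[of _ "\<lambda>f S. Eps (is_arg_max f (\<lambda>y. y \<in> S))"]) (metis someI_ex)


section \<open>Input and output\<close>

text \<open>
  Input: natural cell 0 holds the number of vertices, real cells \<open>2 * i\<close> and \<open>2 * i + 1\<close> hold the
  coordinates of vertex \<open>i\<close>; all other cells are 0.  Output: real cells 0 to 7 hold the coordinates
  of four points in the same layout.
\<close>

definition input_store :: "(real^2) list \<Rightarrow> store" where
  "input_store vs =
     \<lparr>nmem = (\<lambda>i. if i = 0 then length vs else 0),
      rmem = (\<lambda>i. if i < 2 * length vs
                  then (if even i then vs ! (i div 2) $ 1 else vs ! (i div 2) $ 2) else 0)\<rparr>"

definition out_point :: "store \<Rightarrow> nat \<Rightarrow> real^2" where
  "out_point s i = vector [rmem s (2 * i), rmem s (2 * i + 1)]"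

text \<open>The last parameter bounds the running time.\<close>

definition finds_max_rectangle ::
    "solver \<Rightarrow> com \<Rightarrow> (real^2) set \<Rightarrow> (real^2) list \<Rightarrow> nat \<Rightarrow> bool" where
  "finds_max_rectangle \<sigma> prog P vs T \<longleftrightarrow>
     (\<exists>t s. exec \<sigma> prog (input_store vs) t s \<and> t \<le> T \<and>
        (let a = out_point s 0; b = out_point s 1; c = out_point s 2; d = out_point s 3
         in rect_corners a b c d \<and> max_area_rectangle_in P (convex hull {a, b, c, d})))"

end

theory Submission
  imports Defs
begin

text \<open>
  For a vertex \<open>v\<close>, the triangles spanned by \<open>v\<close> and an edge cover the polygon.  The algorithm considers
  all \<open>v\<close> and all pairs of edges \<open>i\<close>, \<open>j\<close> that can be seen from \<open>v\<close> at a right angle; since the angular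
  intervals of the edges are disjoint, there are only \<open>O(n)\<close> such pairs for each \<open>v\<close>.  For each of the
  \<open>O(n\<^sup>2)\<close> choices and each edge \<open>k\<close> it maximizes the squared area of a rectangle with one corner in the
  triangle of \<open>v\<close> and its two neighbours, the adjacent corners in the triangles of \<open>v\<close> with \<open>i\<close> and \<open>j\<close>,
  and the opposite corner in the triangle of \<open>v\<close> with \<open>k\<close>.

  A maximum-area rectangle is met in this way.  This is clear if a corner is a vertex, or if two adjacent
  corners lie on the same edge.  Otherwise no corner lies in the interior of the polygon, because
  the rectangle could then be enlarged, by moving a side or by rotating it about the opposite corner.  So the
  corners lie on four edges, with distinct ones for adjacent corners.  Turn the rectangle, keeping its corners
  on the lines of these edges, until a corner reaches an end point \<open>v\<close> of its edge.  In that
  position the edges of the two adjacent corners are seen from \<open>v\<close> at a right angle, and the original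
  rectangle is feasible for the problem of \<open>v\<close> and these edges.
\<close>


section \<open>Convex polygons and their fans\<close>

text \<open>Posing a problem for every vertex and every triple of edges would take n^4 problems, so
  the right-angle filter must save a factor n without losing the optimum. It looks only at signs: a
  pair of edges is dismissed when the four inner products of their end points, taken from v, are
  strictly of one sign. This takes constant time, is implied by seeing points at a right angle, and
  leaves at most 13n pairs per vertex: 5n in which the edges coincide or one of them contains v, and
  4n for each order of the others. Turning only certifies that a pair passes. The turned rectangle
  may have another area; the original one is feasible because the problem confines corners to
  triangles and fixes no direction. Turning cannot go on for a half turn, since the side leaving the
  first corner would then point out of the polygon. Squared area replaces area, so that the
  objective is a polynomial. The optimum is nondegenerate because the polygon has interior
  points.\<close>

definition cross2 :: "real^2 \<Rightarrow> real^2 \<Rightarrow> real" where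
  "cross2 x y = x $ 1 * y $ 2 - x $ 2 * y $ 1"

lemma inner_real2: "(x :: real^2) \<bullet> y = x $ 1 * y $ 1 + x $ 2 * y $ 2"
  by (simp add: inner_vec_def sum_2)

lemma vec2_eq_iff: "(x :: real^2) = y \<longleftrightarrow> x $ 1 = y $ 1 \<and> x $ 2 = y $ 2"
  by (simp add: vec_eq_iff forall_2)

lemma cross2_add [simp]:
  "cross2 (x + y) z = cross2 x z + cross2 y z" "cross2 z (x + y) = cross2 z x + cross2 z y"
  by (simp_all add: cross2_def algebra_simps)

lemma cross2_diff [simp]:
  "cross2 (x - y) z = cross2 x z - cross2 y z" "cross2 z (x - y) = cross2 z x - cross2 z y"
  by (simp_all add: cross2_def algebra_simps)

lemma cross2_scaleR [simp]:
  "cross2 (r *\<^sub>R x) y = r * cross2 x y" "cross2 x (r *\<^sub>R y) = r * cross2 x y"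
  by (simp_all add: cross2_def algebra_simps)

lemma cross2_zero [simp]: "cross2 0 x = 0" "cross2 x 0 = 0" "cross2 x x = 0"
  by (simp_all add: cross2_def)

lemma cross2_minus [simp]: "cross2 (- x) y = - cross2 x y" "cross2 x (- y) = - cross2 x y"
  by (simp_all add: cross2_def)

lemma cross2_swap: "cross2 x y = - cross2 y x"
  by (simp add: cross2_def)

lemma cross2_cramer: "cross2 x y *\<^sub>R z = cross2 z y *\<^sub>R x + cross2 x z *\<^sub>R y"
  by (simp add: vec2_eq_iff cross2_def algebra_simps)

lemma cross2_plucker: "cross2 w x * cross2 y z = cross2 w y * cross2 x z + cross2 w z * cross2 y x"
  by (simp add: cross2_def algebra_simps)

lemma cross2_rotate: "cross2 (z - y) (x - y) = cross2 (y - x) (z - x)"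
  by (simp add: cross2_def algebra_simps)

lemma cross2_reverse: "cross2 (x - y) (z - y) = - cross2 (y - x) (z - x)"
  by (simp add: cross2_def algebra_simps)

text \<open>Signed areas with respect to the base point \<open>a\<close>: the triangle
  \<open>b\<close>, \<open>c\<close>, \<open>x\<close> is split into the triangles at
  \<open>a\<close>. With \<open>a\<close> a vertex this turns the inequality of an edge into one
  about directions from that vertex.\<close>

lemma cross2_base_change:
  "cross2 (c - b) (x - b) = cross2 (b - a) (c - a) + cross2 (c - a) (x - a) - cross2 (b - a) (x - a)"
  by (simp add: cross2_def algebra_simps)

lemma continuous_cross2 [continuous_intros]:
  assumes "continuous_on S f" "continuous_on S g"
  shows "continuous_on S (\<lambda>x. cross2 (f x) (g x))"
  unfolding cross2_def by (intro continuous_intros assms)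

lemma tendsto_cross2 [tendsto_intros]:
  assumes "(f \<longlongrightarrow> l) F" "(g \<longlongrightarrow> m) F"
  shows "((\<lambda>x. cross2 (f x) (g x)) \<longlongrightarrow> cross2 l m) F"
  unfolding cross2_def by (intro tendsto_intros assms)

lemma mem_hull3_iff:
  "x \<in> convex hull {p, q, r :: 'a :: real_vector} \<longleftrightarrow>
     (\<exists>u v. 0 \<le> u \<and> 0 \<le> v \<and> u + v \<le> 1 \<and> x = p + u *\<^sub>R (q - p) + v *\<^sub>R (r - p))"
  unfolding convex_hull_3_alt by blast


lemma add_diff_swap: "k < m \<Longrightarrow> k + (i + (m - k)) = i + (m :: nat)"
  by simp


text \<open>\<open>V\<close> is periodic on all naturals, so neighbours and shifts need no modular
  arithmetic. \<open>turn\<close> is strict convexity: every vertex off an edge lies strictly on one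
  side of it. The factor \<open>orient\<close> absorbs the direction in which the boundary is
  traversed.\<close>

locale oriented_polygon =
  fixes V :: "nat \<Rightarrow> real^2" and n :: nat and orient :: real
  assumes n_ge_3: "3 \<le> n"
    and periodic: "\<And>i. V (i + n) = V i"
    and turn: "\<And>i m. 2 \<le> m \<Longrightarrow> m < n \<Longrightarrow> 0 < orient * cross2 (V (Suc i) - V i) (V (i + m) - V i)"
begin

definition g :: "nat \<Rightarrow> real^2 \<Rightarrow> real" where
  "g i x = orient * cross2 (V (Suc i) - V i) (x - V i)"

definition region :: "(real^2) set" where
  "region = {x. \<forall>i<n. 0 \<le> g i x}"

lemma V_add_mult: "V (i + k * n) = V i"
proof (induction k)
  case (Suc k)
  have "V (i + Suc k * n) = V ((i + k * n) + n)"
    by (simp add: algebra_simps)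
  then show ?case using Suc periodic by metis
qed simp

lemma V_mod [simp]: "V (i mod n) = V i"
  using V_add_mult[of "i mod n" "i div n"] by simp

lemma V_Suc_mod [simp]: "V (Suc (i mod n)) = V (Suc i)"
  by (metis V_mod mod_Suc_eq)

lemma g_mod [simp]: "g (i mod n) x = g i x"
  by (simp add: g_def)

lemma region_g: "x \<in> region \<Longrightarrow> 0 \<le> g i x"
  using n_ge_3 unfolding region_def by (metis (mono_tags, lifting) g_mod mem_Collect_eq mod_less_divisor
      not_numeral_le_zero zero_less_iff_neq_zero)

lemma g_affine: "g i (x + t *\<^sub>R (y - x)) = (1 - t) * g i x + t * g i y"
  by (simp add: g_def algebra_simps)

lemma closed_region: "closed region"
proof -
  have "region = (\<Inter>i<n. {x. 0 \<le> g i x})"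
    by (auto simp: region_def)
  moreover have "closed {x. 0 \<le> g i x}" for i
    unfolding g_def by (intro closed_Collect_le continuous_intros)
  ultimately show ?thesis by auto
qed

lemma convex_region: "convex region"
proof (rule convexI)
  fix x y :: "real^2" and u v :: real
  assume *: "x \<in> region" "y \<in> region" "0 \<le> u" "0 \<le> v" "u + v = 1"
  then have eq: "u *\<^sub>R x + v *\<^sub>R y = x + v *\<^sub>R (y - x)"
    by (simp add: algebra_simps flip: scaleR_add_left)
  have u: "u = 1 - v" using * by simp
  show "u *\<^sub>R x + v *\<^sub>R y \<in> region"
    unfolding eq region_def using * region_g unfolding u by (auto simp: g_affine)
qed

section \<open>Angular order of the vertices seen from a vertex\<close>

definition w :: "nat \<Rightarrow> nat \<Rightarrow> real^2" where
  "w p m = V (p + m) - V p"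

lemma turn_w_first: "2 \<le> m \<Longrightarrow> m < n \<Longrightarrow> 0 < orient * cross2 (w p (Suc 0)) (w p m)"
  using turn[of m p] by (simp add: w_def)

lemma turn_w_Suc:
  assumes "1 \<le> m" "Suc m < n"
  shows "0 < orient * cross2 (w p m) (w p (Suc m))"
proof -
  \<comment> \<open>Edge \<open>p + m\<close> is tested against \<open>V p\<close>, which by
    periodicity is reached \<open>n - m\<close> steps after its starting point.\<close>
  have "0 < orient * cross2 (V (Suc (p + m)) - V (p + m)) (V (p + m + (n - m)) - V (p + m))"
    using assms by (intro turn) auto
  moreover have "V (p + m + (n - m)) = V p"
    using assms periodic by simp
  ultimately show ?thesis
    by (simp add: w_def cross2_rotate del: cross2_diff)
qed

text \<open>Neighbouring directions, and the first direction with any later one, are covered by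
  \<open>turn\<close>. In the induction step the Plucker relation for the directions 1,
  \<open>k\<close>, \<open>m\<close>, \<open>Suc k\<close> expresses the wanted cross product
  through five positive ones.\<close>

lemma cross_w_pos:
  assumes "1 \<le> m" "m < k" "k < n"
  shows "0 < orient * cross2 (w p m) (w p k)"
  using assms
proof (induction k)
  case (Suc k)
  show ?case
  proof (cases "m = k \<or> m = Suc 0")
    case True
    then show ?thesis using Suc.prems turn_w_Suc turn_w_first by force
  next
    case False
    let ?c = "\<lambda>x y. orient * cross2 x y"
    have pos: "0 < ?c (w p (Suc 0)) (w p k)" "0 < ?c (w p (Suc 0)) (w p m)" "0 < ?c (w p k) (w p (Suc k))"
      "0 < ?c (w p (Suc 0)) (w p (Suc k))" "0 < ?c (w p m) (w p k)"
      using Suc False by (auto intro!: turn_w_first turn_w_Suc)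
    have "?c (w p (Suc 0)) (w p k) * ?c (w p m) (w p (Suc k)) =
       ?c (w p (Suc 0)) (w p m) * ?c (w p k) (w p (Suc k)) + ?c (w p (Suc 0)) (w p (Suc k)) * ?c (w p m) (w p k)"
      using cross2_plucker[of "w p (Suc 0)" "w p k" "w p m" "w p (Suc k)"] by algebra
    also have "\<dots> > 0" using pos by (simp only: add_pos_pos mult_pos_pos)
    finally show ?thesis using pos(1) zero_less_mult_pos by blast
  qed
qed simp

lemma V_in_region: "V k \<in> region"
proof -
  have "0 \<le> g i (V k)" if "i < n" for i
  proof -
    define m where "m = (k mod n + (n - i)) mod n"
    have "m < n" using n_ge_3 by (simp add: m_def)
    have "(i + m) mod n = k mod n"
      using that by (simp add: m_def mod_simps)
    then have Vk: "V k = V (i + m)" by (metis V_mod)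
    consider "m = 0" | "m = 1" | "2 \<le> m" by linarith
    then show ?thesis
      using turn[of m i] \<open>m < n\<close> by cases (auto simp: g_def Vk)
  qed
  then show ?thesis by (simp add: region_def)
qed

lemma discrete_sign_change:
  fixes f :: "nat \<Rightarrow> real"
  assumes "0 \<le> f 1" "f (Suc m) \<le> 0" "1 \<le> m"
  shows "\<exists>i\<ge>1. i \<le> m \<and> 0 \<le> f i \<and> f (Suc i) \<le> 0"
  using assms
proof (induction m)
  case (Suc m)
  show ?case
  proof (cases "0 \<le> f (Suc m)")
    case True
    then show ?thesis using Suc.prems by (intro exI[of _ "Suc m"]) auto
  next
    case False
    with Suc show ?thesis by (cases "m = 0") (auto intro: le_SucI)
  qed
qed simp

text \<open>The cross product with \<open>y\<close> is nonnegative for the first direction of the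
  fan and nonpositive for the last, so its sign changes between two consecutive directions. These
  bound a wedge containing \<open>x\<close>; Cramer's rule yields the coefficients, and the edge
  that closes the wedge bounds their sum by 1.\<close>

lemma fan_cover:
  assumes "x \<in> region"
  shows "\<exists>i<n. x \<in> convex hull {V p, V i, V (Suc i)}"
proof -
  define y where "y = x - V p"
  let ?c = "\<lambda>x y. orient * cross2 x y"
  have first: "0 \<le> ?c (w p (Suc 0)) y"
    using region_g[OF assms, of p] by (simp add: g_def w_def y_def)
  have "0 \<le> g (p + (n - 1)) x" using region_g[OF assms] .
  moreover have "Suc (p + (n - 1)) = p + n" using n_ge_3 by simp
  ultimately have "0 \<le> orient * cross2 (V p - V (p + (n - 1))) (x - V (p + (n - 1)))"
    by (simp add: g_def periodic del: cross2_diff)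
  then have last: "?c (w p (n - 1)) y \<le> 0"
    unfolding cross2_reverse[of "V p" "V (p + (n - 1))"] by (simp add: w_def y_def del: cross2_diff)
  have "Suc (n - 2) = n - 1" using n_ge_3 by simp
  then obtain m where m: "1 \<le> m" "m \<le> n - 2" "0 \<le> ?c (w p m) y" "?c (w p (Suc m)) y \<le> 0"
    using discrete_sign_change[of "\<lambda>i. ?c (w p i) y" "n - 2"] first last n_ge_3 by fastforce
  define D where "D = ?c (w p m) (w p (Suc m))"
  have D: "0 < D" unfolding D_def using m n_ge_3 by (intro cross_w_pos) auto
  define u v where "u = - ?c (w p (Suc m)) y / D" and "v = ?c (w p m) y / D"
  have "0 \<le> u" unfolding u_def using m(4) D by (intro divide_nonneg_pos) (auto simp del: mult_le_0_iff)
  moreover have "0 \<le> v" unfolding v_def using m(3) D by (intro divide_nonneg_pos) auto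
  ultimately have uv: "0 \<le> u" "0 \<le> v" .
  have "0 \<le> g (p + m) x" using region_g[OF assms] .
  then have "- ?c (w p (Suc m)) y + ?c (w p m) y \<le> D"
    unfolding g_def cross2_base_change[of "V (Suc (p + m))" "V (p + m)" x "V p"]
    by (simp add: w_def y_def D_def distrib_left right_diff_distrib del: cross2_diff)
  then have le1: "u + v \<le> 1" using D by (simp add: u_def v_def field_simps)
  have Duv: "D * u = orient * cross2 y (w p (Suc m))" "D * v = orient * cross2 (w p m) y"
    using D by (simp_all add: u_def v_def cross2_swap[of y "w p (Suc m)"])
  have "D *\<^sub>R y = orient *\<^sub>R (cross2 (w p m) (w p (Suc m)) *\<^sub>R y)"
    by (simp add: D_def)
  also have "\<dots> = (D * u) *\<^sub>R w p m + (D * v) *\<^sub>R w p (Suc m)"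
    unfolding cross2_cramer[of "w p m" "w p (Suc m)" y] Duv by (simp add: scaleR_add_right)
  finally have "D *\<^sub>R y = (D * u) *\<^sub>R w p m + (D * v) *\<^sub>R w p (Suc m)" .
  then have "D *\<^sub>R y = D *\<^sub>R (u *\<^sub>R w p m + v *\<^sub>R w p (Suc m))"
    by (simp add: scaleR_add_right)
  then have y: "y = u *\<^sub>R w p m + v *\<^sub>R w p (Suc m)" using D by simp
  have "x = V p + y" by (simp add: y_def)
  then have x: "x = V p + u *\<^sub>R (V (p + m) - V p) + v *\<^sub>R (V (Suc (p + m)) - V p)"
    unfolding y w_def by (simp add: add.assoc)
  have "x \<in> convex hull {V p, V (p + m), V (Suc (p + m))}"
    unfolding mem_hull3_iff using uv le1 x
    by (intro exI[of _ u] exI[of _ v]) simp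
  moreover have "(p + m) mod n < n" using n_ge_3 by simp
  ultimately show ?thesis by (intro exI[of _ "(p + m) mod n"]) simp
qed

lemma hull3_subset_region: "convex hull {V i, V j, V k} \<subseteq> region"
  by (intro hull_minimal convex_region) (auto intro: V_in_region)

lemma region_eq_hull: "region = convex hull (V ` {..<n})"
proof
  show "convex hull (V ` {..<n}) \<subseteq> region"
    by (intro hull_minimal convex_region) (auto intro: V_in_region)
  show "region \<subseteq> convex hull (V ` {..<n})"
  proof
    fix x assume "x \<in> region"
    then obtain i where "x \<in> convex hull {V 0, V i, V (Suc i)}" using fan_cover by blast
    moreover have "V k \<in> V ` {..<n}" for k
      using n_ge_3 by (intro image_eqI[of _ _ "k mod n"]) auto
    then have "{V 0, V i, V (Suc i)} \<subseteq> V ` {..<n}" by auto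
    ultimately show "x \<in> convex hull (V ` {..<n})" using hull_mono by blast
  qed
qed

lemma compact_region: "compact region"
  unfolding region_eq_hull by (intro compact_convex_hull finite_imp_compact) auto


text \<open>A necessary condition for the edges \<open>i\<close> and \<open>j\<close> to contain points that are seen from vertex \<open>p\<close> at a
  right angle.\<close>

definition pass :: "nat \<Rightarrow> nat \<Rightarrow> nat \<Rightarrow> bool" where
  "pass p i j \<longleftrightarrow>
     \<not> (\<forall>x\<in>{V i, V (Suc i)}. \<forall>y\<in>{V j, V (Suc j)}. 0 < (x - V p) \<bullet> (y - V p)) \<and>
     \<not> (\<forall>x\<in>{V i, V (Suc i)}. \<forall>y\<in>{V j, V (Suc j)}. (x - V p) \<bullet> (y - V p) < 0)"

text \<open>Directions between \<open>w p i\<close> and \<open>w p j\<close> are nonnegative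
  combinations of these two, so the inner product of two of them expands into nonnegative terms.
  Thus narrowing an angle that is not obtuse never makes it obtuse, and it becomes acute if it was
  acute or if both sides move inwards.\<close>

lemma nested_inner:
  assumes "1 \<le> i" "i \<le> i'" "i' \<le> j'" "j' \<le> j" "j < n" "i < j"
    and "0 \<le> w p i \<bullet> w p j"
  shows "0 \<le> w p i' \<bullet> w p j'"
    and "0 < w p i \<bullet> w p j \<or> i < i' \<and> j' < j \<Longrightarrow> 0 < w p i' \<bullet> w p j'"
proof -
  let ?c = "\<lambda>x y. orient * cross2 x y"
  define x y D where "x = w p i" and "y = w p j" and "D = ?c x y"
  have D: "0 < D" unfolding D_def x_def y_def using assms by (intro cross_w_pos) auto
  have ne: "0 < x \<bullet> x" "0 < y \<bullet> y" using D by (auto simp: D_def)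
  have comb: "\<exists>\<alpha> \<beta>. 0 \<le> \<alpha> \<and> 0 \<le> \<beta> \<and> 0 < \<alpha> + \<beta> \<and> (m < j \<longrightarrow> 0 < \<alpha>) \<and> (i < m \<longrightarrow> 0 < \<beta>) \<and>
      D *\<^sub>R w p m = \<alpha> *\<^sub>R x + \<beta> *\<^sub>R y" if "i \<le> m" "m \<le> j" for m
  proof -
    have a: "0 < ?c (w p m) y" if "m < j" unfolding y_def using \<open>i \<le> m\<close> that assms by (intro cross_w_pos) auto
    have b: "0 < ?c x (w p m)" if "i < m" unfolding x_def using \<open>m \<le> j\<close> that assms by (intro cross_w_pos) auto
    have 1: "0 \<le> ?c (w p m) y" "0 \<le> ?c x (w p m)"
      using that a b by (cases "m = j"; cases "m = i"; force simp: x_def y_def)+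
    have 2: "0 < ?c (w p m) y + ?c x (w p m)"
      using a b 1 that \<open>i < j\<close> by (cases "m < j"; fastforce)
    have "D *\<^sub>R w p m = orient *\<^sub>R (cross2 x y *\<^sub>R w p m)"
      by (simp add: D_def)
    then have "D *\<^sub>R w p m = ?c (w p m) y *\<^sub>R x + ?c x (w p m) *\<^sub>R y"
      unfolding cross2_cramer[of x y "w p m"] by (simp add: scaleR_add_right)
    with a b 1 2 show ?thesis by blast
  qed
  obtain \<alpha> \<beta> where 1: "0 \<le> \<alpha>" "0 \<le> \<beta>" "0 < \<alpha> + \<beta>" "i' < j \<longrightarrow> 0 < \<alpha>" "i < i' \<longrightarrow> 0 < \<beta>"
      "D *\<^sub>R w p i' = \<alpha> *\<^sub>R x + \<beta> *\<^sub>R y"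
    using comb[of i'] assms by auto
  obtain \<gamma> \<delta> where 2: "0 \<le> \<gamma>" "0 \<le> \<delta>" "0 < \<gamma> + \<delta>" "j' < j \<longrightarrow> 0 < \<gamma>" "i < j' \<longrightarrow> 0 < \<delta>"
      "D *\<^sub>R w p j' = \<gamma> *\<^sub>R x + \<delta> *\<^sub>R y"
    using comb[of j'] assms by auto
  have xy: "0 \<le> x \<bullet> y" using assms by (simp add: x_def y_def)
  have "D * D * (w p i' \<bullet> w p j') = (D *\<^sub>R w p i') \<bullet> (D *\<^sub>R w p j')" by simp
  also have "\<dots> = \<alpha> * \<gamma> * (x \<bullet> x) + \<beta> * \<delta> * (y \<bullet> y) + (\<alpha> * \<delta> + \<beta> * \<gamma>) * (x \<bullet> y)"
    unfolding 1 2 by (simp add: inner_add_left inner_add_right inner_commute[of y x] algebra_simps)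
  finally have eq: "D * D * (w p i' \<bullet> w p j') = \<dots>" .
  have DD: "0 < D * D" using D by simp
  have "0 \<le> D * D * (w p i' \<bullet> w p j')" unfolding eq using 1 2 ne xy by auto
  then show "0 \<le> w p i' \<bullet> w p j'" using DD by (metis mult_le_cancel_left_pos mult_zero_right)
  assume "0 < w p i \<bullet> w p j \<or> i < i' \<and> j' < j"
  then have "0 < D * D * (w p i' \<bullet> w p j')"
  proof
    assume *: "0 < w p i \<bullet> w p j"
    then have **: "0 < x \<bullet> y" by (simp add: x_def y_def)
    have "0 < \<alpha> * \<gamma> \<or> 0 < \<beta> * \<delta> \<or> 0 < \<alpha> * \<delta> + \<beta> * \<gamma>"
    proof -
      have "0 < (\<alpha> + \<beta>) * (\<gamma> + \<delta>)" using 1 2 by simp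
      then have "0 < \<alpha> * \<gamma> + \<beta> * \<delta> + (\<alpha> * \<delta> + \<beta> * \<gamma>)" by (simp add: algebra_simps)
      then show ?thesis by linarith
    qed
    moreover have "0 \<le> \<alpha> * \<gamma>" "0 \<le> \<beta> * \<delta>" "0 \<le> \<alpha> * \<delta> + \<beta> * \<gamma>" using 1 2 by auto
    ultimately show ?thesis unfolding eq using ne **
      by (smt (verit, best) mult_nonneg_nonneg mult_pos_pos)
  next
    assume "i < i' \<and> j' < j"
    then have "0 < \<alpha> * \<gamma> * (x \<bullet> x)" "0 \<le> \<beta> * \<delta> * (y \<bullet> y)" "0 \<le> (\<alpha> * \<delta> + \<beta> * \<gamma>) * (x \<bullet> y)"
      using 1 2 ne xy assms by auto
    then show ?thesis unfolding eq by linarith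
  qed
  then show "0 < w p i' \<bullet> w p j'" using DD zero_less_mult_pos by blast
qed

text \<open>Edges are numbered relative to \<open>p\<close>. For a passing pair \<open>m < l\<close>
  away from \<open>V p\<close>, the angle between the inner end points is at most right
  (\<open>close\<close>) and that between the outer ones at least right (\<open>far\<close>). Pairs
  with the same sum \<open>m + l\<close> are nested, so by \<open>nested_inner\<close> hardly two of
  them can satisfy both.\<close>

lemma card_pass: "card {(i, j). i < n \<and> j < n \<and> pass p i j} \<le> 13 * n"
proof -
  define Q where "Q = {(m, l). m < n \<and> l < n \<and> pass p (p + m) (p + l)}"
  define Z where "Z = {(m, l). 1 \<le> m \<and> m < l \<and> Suc l < n \<and> pass p (p + m) (p + l)}"
  have sym: "pass p i j \<longleftrightarrow> pass p j i" for i j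
    by (auto simp: pass_def inner_commute)
  have close: "0 \<le> w p (Suc m) \<bullet> w p l" and far: "w p m \<bullet> w p (Suc l) \<le> 0"
    if "(m, l) \<in> Z" for m l
  proof -
    have ml: "1 \<le> m" "m < l" "Suc l < n" and pass: "pass p (p + m) (p + l)" using that by (auto simp: Z_def)
    have *: "\<not> (\<forall>x\<in>{w p m, w p (Suc m)}. \<forall>y\<in>{w p l, w p (Suc l)}. 0 < x \<bullet> y)"
       "\<not> (\<forall>x\<in>{w p m, w p (Suc m)}. \<forall>y\<in>{w p l, w p (Suc l)}. x \<bullet> y < 0)"
      using pass by (auto simp: pass_def w_def)
    show "w p m \<bullet> w p (Suc l) \<le> 0"
    proof (rule ccontr)
      assume "\<not> ?thesis"
      then have "0 < w p m' \<bullet> w p l'" if "m' \<in> {m, Suc m}" "l' \<in> {l, Suc l}" for m' l'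
        using that ml by (intro nested_inner(2)[of m m' l' "Suc l"]) auto
      with *(1) show False by auto
    qed
    show "0 \<le> w p (Suc m) \<bullet> w p l"
    proof (rule ccontr)
      assume neg: "\<not> ?thesis"
      have "w p m' \<bullet> w p l' < 0" if "m' \<in> {m, Suc m}" "l' \<in> {l, Suc l}" for m' l'
      proof (rule ccontr)
        assume "\<not> ?thesis"
        then have "0 \<le> w p (Suc m) \<bullet> w p l"
          using that ml
          by (cases "m' = Suc m \<and> l' = l") (simp, intro nested_inner(1)[of m' "Suc m" l l'], auto)
        with neg show False by simp
      qed
      with *(2) show False by auto
    qed
  qed
  let ?f = "\<lambda>(m::nat, l). (m + l, even m)"
  text \<open>Two passing pairs on the same antidiagonal are at most one step apart.\<close>
  have apart: False if "(m, l) \<in> Z" "(m', l') \<in> Z" "m + l = m' + l'" "Suc m < m'" for m l m' l'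
  proof -
    have "0 < w p m' \<bullet> w p (Suc l')"
      using that by (intro nested_inner(2)[of "Suc m" m' "Suc l'" l] close) (auto simp: Z_def)
    with far[of m' l'] that show False by simp
  qed
  \<comment> \<open>At most two neighbouring values of \<open>m\<close> occur on an antidiagonal,
    and parity tells them apart. With fewer than 2n antidiagonals this gives 4n pairs.\<close>
  have "inj_on ?f Z"
  proof (rule inj_onI, clarify)
    fix m l m' l' assume *: "(m, l) \<in> Z" "(m', l') \<in> Z" "m + l = m' + l'" "even m = even m'"
    have "m = m'"
    proof (rule ccontr)
      assume "m \<noteq> m'"
      moreover have "Suc m \<noteq> m'" "Suc m' \<noteq> m" using * by auto
      ultimately have "Suc m < m' \<or> Suc m' < m" by linarith
      then show False using apart[of m l m' l'] apart[of m' l' m l] * by auto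
    qed
    then show "m = m' \<and> l = l'" using * by simp
  qed
  moreover have "?f ` Z \<subseteq> {..<2 * n} \<times> UNIV" by (auto simp: Z_def)
  ultimately have "card Z \<le> card ({..<2 * n} \<times> (UNIV :: bool set))"
    by (intro card_inj_on_le) auto
  then have Z: "card Z \<le> 4 * n" by (simp add: card_cartesian_product)
  have finZ: "finite Z"
    by (rule finite_subset[of _ "{..n} \<times> {..n}"]) (auto simp: Z_def)
  \<comment> \<open>The pairs to which the nesting argument does not apply: one of the edges
    contains \<open>V p\<close>, where a direction vanishes, or both edges coincide. There are at
    most 5n of them.\<close>
  define B where "B = {0} \<times> {..<n} \<union> {n - 1} \<times> {..<n} \<union> {..<n} \<times> {0} \<union> {..<n} \<times> {n - 1} \<union> (\<lambda>m. (m, m)) ` {..<n}"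
  have "card (A1 \<union> A2 \<union> A3 \<union> A4 \<union> A5) \<le> card A1 + card A2 + card A3 + card A4 + card A5"
    for A1 A2 A3 A4 A5 :: "(nat \<times> nat) set"
    by (meson add_le_mono1 card_Un_le order.trans)
  then have "card B \<le> card ({0::nat} \<times> {..<n}) + card ({n - 1} \<times> {..<n}) + card ({..<n} \<times> {0::nat})
      + card ({..<n} \<times> {n - 1}) + card ((\<lambda>m. (m, m)) ` {..<n})"
    unfolding B_def .
  also have "\<dots> = 5 * n"
    by (simp add: card_cartesian_product card_image inj_on_def)
  finally have "card B \<le> 5 * n" .
  moreover have "Q \<subseteq> B \<union> Z \<union> prod.swap ` Z"
  proof
    fix x assume "x \<in> Q"
    then obtain m l where x: "x = (m, l)" "m < n" "l < n" "pass p (p + m) (p + l)" by (auto simp: Q_def)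
    show "x \<in> B \<union> Z \<union> prod.swap ` Z"
    proof (cases "m = 0 \<or> m = n - 1 \<or> l = 0 \<or> l = n - 1 \<or> m = l")
      case True
      then show ?thesis using x by (auto simp: B_def)
    next
      case False
      then have "(m, l) \<in> Z \<or> (l, m) \<in> Z" using x sym by (auto simp: Z_def)
      then show ?thesis using x by force
    qed
  qed
  then have "card Q \<le> card (B \<union> Z \<union> prod.swap ` Z)"
    using finZ by (intro card_mono) (auto simp: B_def)
  moreover have "card (B \<union> Z \<union> prod.swap ` Z) \<le> card B + card Z + card (prod.swap ` Z)"
    by (intro order.trans[OF card_Un_le] add_mono card_Un_le order.refl)
  moreover have "card (prod.swap ` Z) = card Z" by (simp add: card_image)
  ultimately have Q: "card Q \<le> 13 * n" using Z by linarith
  have "{(i, j). i < n \<and> j < n \<and> pass p i j} \<subseteq> (\<lambda>(m, l). ((p + m) mod n, (p + l) mod n)) ` Q"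
  proof clarify
    fix i j assume *: "i < n" "j < n" "pass p i j"
    define r where "r i = (i + (n - p mod n)) mod n" for i
    have n0: "0 < n" using n_ge_3 by simp
    have r: "(p + r i) mod n = i" if "i < n" for i
    proof -
      have "(p + r i) mod n = (p mod n + (i + (n - p mod n))) mod n"
        unfolding r_def by (simp add: mod_simps)
      also have "p mod n + (i + (n - p mod n)) = i + n"
        using n0 by (intro add_diff_swap) simp
      finally show ?thesis using that by simp
    qed
    have Vr: "V (p + r i) = V i" "V (Suc (p + r i)) = V (Suc i)" if "i < n" for i
      using V_mod[of "p + r i"] V_Suc_mod[of "p + r i"] r[OF that] by simp_all
    have "r i < n" for i using n0 by (simp add: r_def)
    then have "(r i, r j) \<in> Q" using *(3) Vr[OF *(1)] Vr[OF *(2)] by (simp add: Q_def pass_def)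
    then show "(i, j) \<in> (\<lambda>(m, l). ((p + m) mod n, (p + l) mod n)) ` Q"
      using r[OF *(1)] r[OF *(2)] by (intro image_eqI[of _ _ "(r i, r j)"]) simp_all
  qed
  moreover have "finite Q" by (rule finite_subset[of _ "{..n} \<times> {..n}"]) (auto simp: Q_def)
  ultimately show ?thesis using Q by (meson order.trans surj_card_le)
qed

end

section \<open>Enlarging a rectangle\<close>

text \<open>Sides of length zero are allowed: the condition is closed, so the rectangles in a
  compact set form a compact set of quadruples.\<close>

definition rect_in :: "(real^2) set \<Rightarrow> real^2 \<Rightarrow> real^2 \<Rightarrow> real^2 \<Rightarrow> real^2 \<Rightarrow> bool" where
  "rect_in S a b c d \<longleftrightarrow>
     a \<in> S \<and> b \<in> S \<and> c \<in> S \<and> d \<in> S \<and> c - d = b - a \<and> (b - a) \<bullet> (d - a) = 0"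

definition sqarea :: "real^2 \<Rightarrow> real^2 \<Rightarrow> real^2 \<Rightarrow> real" where
  "sqarea a b d = (cross2 (b - a) (d - a))\<^sup>2"

lemma rect_in_rotate:
  assumes "rect_in S a b c d"
  shows "rect_in S b c d a" "sqarea b c a = sqarea a b d"
proof -
  have c: "c = b + d - a" using assms by (simp add: rect_in_def algebra_simps)
  show "rect_in S b c d a"
    using assms unfolding rect_in_def c by (auto simp: inner_diff algebra_simps inner_commute)
  have "cross2 (c - b) (a - b) = cross2 (b - a) (d - a)"
    unfolding c by (simp add: cross2_def algebra_simps del: cross2_diff cross2_add)
  then show "sqarea b c a = sqarea a b d" unfolding sqarea_def by (simp only:)
qed

lemma rect_in_reflect: "rect_in S a b c d \<Longrightarrow> rect_in S a d c b"
  by (auto simp: rect_in_def inner_commute algebra_simps)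

lemma sqarea_reflect: "sqarea a d b = sqarea a b d"
  unfolding sqarea_def by (simp only: cross2_swap[of "d - a" "b - a"] power2_minus)

definition rot :: "real^2 \<Rightarrow> real^2" where
  "rot x = vector [- x $ 2, x $ 1]"

lemma rot_nth [simp]: "rot x $ 1 = - x $ 2" "rot x $ 2 = x $ 1"
  by (simp_all add: rot_def)

section \<open>Edges, vertices and small motions inside the polygon\<close>

context oriented_polygon
begin

definition G :: "nat \<Rightarrow> real^2 \<Rightarrow> real" where
  "G i y = orient * cross2 (V (Suc i) - V i) y"

lemma g_plus: "g i (x + y) = g i x + G i y"
  by (simp add: g_def G_def algebra_simps)

lemma G_linear [simp]: "G i (x + y) = G i x + G i y" "G i (t *\<^sub>R x) = t * G i x" "G i (- x) = - G i x"
  by (simp_all add: G_def algebra_simps)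

lemma tendsto_g [tendsto_intros]:
  assumes "(f \<longlongrightarrow> l) F" shows "((\<lambda>x. g i (f x)) \<longlongrightarrow> g i l) F"
  unfolding g_def by (intro tendsto_intros assms)

lemma continuous_g [continuous_intros]:
  assumes "continuous_on S f" shows "continuous_on S (\<lambda>x. g i (f x))"
  unfolding g_def by (intro continuous_intros assms)

lemma V_Suc_neq: "V (Suc i) \<noteq> V i" and V_Suc_Suc_neq: "V (Suc (Suc i)) \<noteq> V i"
  using turn[of 2 i] n_ge_3 by auto

lemma V_shift_eq_iff: "m < n \<Longrightarrow> V (i + m) = V i \<longleftrightarrow> m = 0"
proof (cases "2 \<le> m")
  case True
  assume "m < n"
  then show ?thesis using turn[of m i] True by auto
next
  case False
  then have "m = 0 \<or> m = 1" by linarith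
  then show ?thesis using V_Suc_neq[of i] by auto
qed

lemma V_eq_iff: "V i = V j \<longleftrightarrow> i mod n = j mod n"
proof
  assume eq: "V i = V j"
  have *: "i mod n = j mod n" if "V i = V j" "i mod n \<le> j mod n" for i j
  proof -
    have "V (i mod n + (j mod n - i mod n)) = V (i mod n)" using that by simp
    moreover have "j mod n - i mod n < n" using n_ge_3 by (simp add: less_imp_diff_less)
    ultimately show ?thesis using V_shift_eq_iff that by fastforce
  qed
  show "i mod n = j mod n" using *[of i j] *[of j i] eq by (metis nat_le_linear)
qed (metis V_mod)

lemma V_inj: "V i = V j \<Longrightarrow> i < n \<Longrightarrow> j < n \<Longrightarrow> i = j"
  by (simp add: V_eq_iff)

lemma V_Suc_cong: "V i = V j \<Longrightarrow> V (Suc i) = V (Suc j)"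
  unfolding V_eq_iff by (metis mod_Suc_eq)

lemma obtain_shift:
  obtains m where "m < n" "V k = V (i + m)"
proof
  show "(k mod n + (n - i mod n)) mod n < n" using n_ge_3 by simp
  have "(i + (k mod n + (n - i mod n)) mod n) mod n = (i mod n + (k mod n + (n - i mod n))) mod n"
    by (metis mod_add_left_eq mod_add_right_eq)
  also have "i mod n + (k mod n + (n - i mod n)) = k mod n + n"
    using n_ge_3 by (intro add_diff_swap) simp
  finally show "V k = V (i + (k mod n + (n - i mod n)) mod n)"
    by (simp add: V_eq_iff)
qed

lemma g_V_zero: "g i (V k) = 0 \<longleftrightarrow> V k = V i \<or> V k = V (Suc i)"
proof
  obtain m where m: "m < n" "V k = V (i + m)" by (rule obtain_shift)
  consider "m = 0" | "m = 1" | "2 \<le> m" by linarith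
  then show "V k = V i \<or> V k = V (Suc i)" if "g i (V k) = 0"
    using that m turn[of m i] by cases (auto simp: g_def)
qed (auto simp: g_def simp del: cross2_diff)

text \<open>In the fan at \<open>V i\<close>, the value \<open>g i x\<close> is a combination of the
  nonnegative values at \<open>V m\<close> and \<open>V (Suc m)\<close> with weights
  \<open>u\<close> and \<open>v\<close>. If it vanishes, positive weight sits only on end points of
  edge \<open>i\<close>.\<close>

lemma on_edge:
  assumes "x \<in> region" "g i x = 0"
  obtains \<tau> where "0 \<le> \<tau>" "\<tau> \<le> 1" "x = V i + \<tau> *\<^sub>R (V (Suc i) - V i)"
proof -
  obtain m where "x \<in> convex hull {V i, V m, V (Suc m)}" using fan_cover assms by blast
  then obtain u v where uv: "0 \<le> u" "0 \<le> v" "u + v \<le> 1"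
      and x: "x = V i + u *\<^sub>R (V m - V i) + v *\<^sub>R (V (Suc m) - V i)"
    unfolding mem_hull3_iff by blast
  have G: "G i (V k - V i) = g i (V k)" for k by (simp add: g_def G_def)
  have "g i (V i) = 0" by (simp add: g_V_zero)
  then have "g i x = u * g i (V m) + v * g i (V (Suc m))" unfolding x g_plus by (simp add: G)
  moreover have "0 \<le> g i (V m)" "0 \<le> g i (V (Suc m))" using V_in_region region_g by auto
  ultimately have 0: "u * g i (V m) = 0" "v * g i (V (Suc m)) = 0"
    using uv assms by (smt (verit) mult_nonneg_nonneg)+
  have *: "\<exists>t. 0 \<le> t \<and> t \<le> u \<and> u *\<^sub>R (V m - V i) = t *\<^sub>R (V (Suc i) - V i)"
    if "u * g i (V m) = 0" "0 \<le> u" for u m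
    using that g_V_zero[of i m] by (cases "u = 0") (auto intro: exI[of _ u] exI[of _ 0])
  obtain t1 t2 where "0 \<le> t1" "t1 \<le> u" "u *\<^sub>R (V m - V i) = t1 *\<^sub>R (V (Suc i) - V i)"
      "0 \<le> t2" "t2 \<le> v" "v *\<^sub>R (V (Suc m) - V i) = t2 *\<^sub>R (V (Suc i) - V i)"
    using *[OF 0(1)] *[OF 0(2)] uv by metis
  then show thesis
    using that[of "t1 + t2"] uv x by (simp add: scaleR_add_left)
qed

lemma on_edge_hull:
  assumes "x \<in> region" "g i x = 0"
  shows "x \<in> convex hull {z, V i, V (Suc i)}"
proof -
  obtain \<tau> where "0 \<le> \<tau>" "\<tau> \<le> 1" "x = V i + \<tau> *\<^sub>R (V (Suc i) - V i)" using on_edge assms by blast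
  then have "x \<in> convex hull {V i, V (Suc i), z}"
    unfolding mem_hull3_iff by (intro exI[of _ \<tau>] exI[of _ 0]) auto
  then show ?thesis by (simp add: insert_commute)
qed

text \<open>A zero of \<open>g j\<close> in the interior of edge \<open>i\<close> forces both end
  points of edge \<open>i\<close> onto edge \<open>j\<close>. The two edges would then be the same
  segment traversed in opposite directions, impossible with at least three vertices.\<close>

lemma vertex_if_two_zeros:
  assumes "x \<in> region" "i < n" "j < n" "i \<noteq> j" "g i x = 0" "g j x = 0"
  shows "x \<in> range V"
proof -
  obtain \<tau> where \<tau>: "0 \<le> \<tau>" "\<tau> \<le> 1" "x = V i + \<tau> *\<^sub>R (V (Suc i) - V i)" using on_edge assms by blast
  show ?thesis
  proof (cases "\<tau> = 0 \<or> \<tau> = 1")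
    case True
    then show ?thesis using \<tau> by auto
  next
    case False
    have "(1 - \<tau>) * g j (V i) + \<tau> * g j (V (Suc i)) = 0"
      using assms \<tau>(3) g_affine by metis
    moreover have "0 \<le> g j (V i)" "0 \<le> g j (V (Suc i))" using V_in_region region_g by auto
    ultimately have "g j (V i) = 0" "g j (V (Suc i)) = 0"
      using False \<tau> by (smt (verit) mult_nonneg_nonneg mult_pos_pos)+
    then have "V i = V j \<or> V i = V (Suc j)" "V (Suc i) = V j \<or> V (Suc i) = V (Suc j)"
      by (simp_all add: g_V_zero)
    moreover have "V i \<noteq> V j" using V_inj assms by blast
    moreover have "V i \<noteq> V (Suc i)" using V_Suc_neq by metis
    ultimately have "V i = V (Suc j)" "V (Suc i) = V j" by auto
    then show ?thesis using V_Suc_Suc_neq V_Suc_cong by metis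
  qed
qed

text \<open>Inequalities that are strict at the limit survive by continuity, so only the edges
  through the limit point have to be controlled.\<close>

lemma eventually_region:
  assumes "(f \<longlongrightarrow> x) F" "x \<in> region"
    and "\<And>j. j < n \<Longrightarrow> g j x = 0 \<Longrightarrow> eventually (\<lambda>t. g j (f t) = 0) F"
  shows "eventually (\<lambda>t. f t \<in> region) F"
proof -
  have "eventually (\<lambda>t. 0 \<le> g j (f t)) F" if "j < n" for j
  proof (cases "g j x = 0")
    case True
    then show ?thesis using assms(3)[OF that] by (auto elim: eventually_mono)
  next
    case False
    then have "0 < g j x" using region_g[OF assms(2), of j] by simp
    moreover have "((\<lambda>t. g j (f t)) \<longlongrightarrow> g j x) F" by (intro tendsto_intros assms)
    ultimately have "eventually (\<lambda>t. 0 < g j (f t)) F" using order_tendstoD(1) by blast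
    then show ?thesis by (rule eventually_mono) simp
  qed
  then have "eventually (\<lambda>t. \<forall>j\<in>{..<n}. 0 \<le> g j (f t)) F"
    by (intro eventually_ball_finite) auto
  then show ?thesis by (simp add: region_def Ball_def)
qed

text \<open>The inner product is a nonnegative, nontrivial combination of the four products of end
  points; being zero, it rules out a common strict sign. The weights need no normalization, so
  points of fan triangles and points on edges are treated alike.\<close>

lemma pass_if_perp:
  assumes "x - V p = u *\<^sub>R (V i - V p) + v *\<^sub>R (V (Suc i) - V p)" "0 \<le> u" "0 \<le> v" "0 < u + v"
    and "y - V p = u' *\<^sub>R (V j - V p) + v' *\<^sub>R (V (Suc j) - V p)" "0 \<le> u'" "0 \<le> v'" "0 < u' + v'"
    and perp: "(x - V p) \<bullet> (y - V p) = 0"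
  shows "pass p i j"
proof -
  have weights: "0 < u * u' \<or> 0 < u * v' \<or> 0 < v * u' \<or> 0 < v * v'"
  proof -
    have "0 < (u + v) * (u' + v')" using assms by simp
    then have "0 < u * u' + u * v' + v * u' + v * v'" by (simp add: algebra_simps)
    then show ?thesis by linarith
  qed
  have nn: "0 \<le> u * u'" "0 \<le> u * v'" "0 \<le> v * u'" "0 \<le> v * v'" using assms by auto
  have pos: "0 < (u * u') * A + (u * v') * B + (v * u') * C + (v * v') * D"
    if "0 < A" "0 < B" "0 < C" "0 < D" for A B C D :: real
  proof -
    have "0 \<le> (u * u') * A" "0 \<le> (u * v') * B" "0 \<le> (v * u') * C" "0 \<le> (v * v') * D"
      using nn that by simp_all
    moreover have "0 < (u * u') * A \<or> 0 < (u * v') * B \<or> 0 < (v * u') * C \<or> 0 < (v * v') * D"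
      using weights that by (metis mult_pos_pos)
    ultimately show ?thesis by linarith
  qed
  define A B C D where "A = (V i - V p) \<bullet> (V j - V p)" and "B = (V i - V p) \<bullet> (V (Suc j) - V p)"
    and "C = (V (Suc i) - V p) \<bullet> (V j - V p)" and "D = (V (Suc i) - V p) \<bullet> (V (Suc j) - V p)"
  have "(u * u') * A + (u * v') * B + (v * u') * C + (v * v') * D = 0"
    using perp unfolding assms A_def B_def C_def D_def by (simp add: inner_add algebra_simps)
  then show ?thesis
    using pos[of A B C D] pos[of "- A" "- B" "- C" "- D"]
    unfolding pass_def A_def B_def C_def D_def by auto
qed

lemma extend_rect:
  assumes "rect_in region a b c d" "0 < sqarea a b d"
    and "\<forall>j<n. 0 < g j b" "\<forall>j<n. 0 < g j c"
  shows "\<exists>a' b' c' d'. rect_in region a' b' c' d' \<and> sqarea a b d < sqarea a' b' d'"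
proof -
  let ?F = "at_right (0::real)"
  have "eventually (\<lambda>t. b + t *\<^sub>R (b - a) \<in> region) ?F"
  proof (rule eventually_region)
    show "((\<lambda>t. b + t *\<^sub>R (b - a)) \<longlongrightarrow> b) ?F" by (rule tendsto_eq_intros refl | simp)+
  qed (use assms in \<open>auto simp: rect_in_def\<close>)
  moreover have "eventually (\<lambda>t. c + t *\<^sub>R (b - a) \<in> region) ?F"
  proof (rule eventually_region)
    show "((\<lambda>t. c + t *\<^sub>R (b - a)) \<longlongrightarrow> c) ?F" by (rule tendsto_eq_intros refl | simp)+
  qed (use assms in \<open>auto simp: rect_in_def\<close>)
  moreover have "eventually (\<lambda>t::real. 0 < t) ?F" by (simp add: eventually_at_right_less)
  ultimately have "eventually (\<lambda>t. b + t *\<^sub>R (b - a) \<in> region \<and> c + t *\<^sub>R (b - a) \<in> region \<and> 0 < t) ?F"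
    by (intro eventually_conj)
  then obtain t where t: "b + t *\<^sub>R (b - a) \<in> region" "c + t *\<^sub>R (b - a) \<in> region" "0 < t"
    using eventually_happens[of _ ?F] trivial_limit_at_right_real by blast
  have eq: "b + t *\<^sub>R (b - a) - a = (1 + t) *\<^sub>R (b - a)" by (simp add: algebra_simps)
  have "c = b + d - a" using assms(1) by (simp add: rect_in_def algebra_simps)
  then have "c + t *\<^sub>R (b - a) - d = (1 + t) *\<^sub>R (b - a)" by (simp add: algebra_simps)
  then have "rect_in region a (b + t *\<^sub>R (b - a)) (c + t *\<^sub>R (b - a)) d"
    using t assms(1) unfolding rect_in_def eq by auto
  moreover have "sqarea a (b + t *\<^sub>R (b - a)) d = (1 + t)\<^sup>2 * sqarea a b d"
    unfolding sqarea_def eq by (simp add: power_mult_distrib del: cross2_diff)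
  moreover have "1 < (1 + t)\<^sup>2" using t by (intro one_less_power) simp_all
  then have "sqarea a b d < (1 + t)\<^sup>2 * sqarea a b d" using assms(2) by simp
  ultimately show ?thesis by metis
qed

text \<open>
  Rotating about the corner \<open>a\<close> while \<open>b\<close> and \<open>d\<close> stay on their lines scales the area by
  \<open>(1 + \<epsilon>\<^sup>2) / ((1 - \<beta> \<epsilon>) (1 - \<delta> \<epsilon>))\<close>, where \<open>\<epsilon>\<close> is the tangent of the angle; for one
  choice of the sign of \<open>\<epsilon>\<close> the denominator is at most 1.
\<close>

lemma rotate_rect:
  assumes rect: "rect_in region a b c d" and pos: "0 < sqarea a b d"
    and c: "\<forall>j<n. 0 < g j c"
    and b: "g jb b = 0" "\<forall>j<n. j \<noteq> jb \<longrightarrow> 0 < g j b" and ab: "0 < g jb a"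
    and d: "g jd d = 0" "\<forall>j<n. j \<noteq> jd \<longrightarrow> 0 < g j d" and ad: "0 < g jd a"
  shows "\<exists>a' b' c' d'. rect_in region a' b' c' d' \<and> sqarea a b d < sqarea a' b' d'"
proof -
  define p q where "p = b - a" and "q = d - a"
  define \<beta> \<delta> where "\<beta> = G jb (rot p) / g jb a" and "\<delta> = G jd (rot q) / g jd a"
  define \<sigma> :: real where "\<sigma> = (if 0 \<le> \<beta> + \<delta> then 1 else - 1)"
  have \<sigma>: "0 \<le> \<sigma> * (\<beta> + \<delta>)" by (auto simp: \<sigma>_def)
  let ?F = "at_right (0::real)"
  \<comment> \<open>The factor \<open>1 / (1 - \<sigma> * t * \<beta>)\<close> is where the turned
    ray from \<open>a\<close> meets the line of edge \<open>jb\<close>; it results from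
    \<open>G jb p = - g jb a\<close>. The same holds for \<open>dd\<close> with
    \<open>jd\<close>.\<close>
  define bb where "bb t = a + (1 / (1 - \<sigma> * t * \<beta>)) *\<^sub>R (p + (\<sigma> * t) *\<^sub>R rot p)" for t
  define dd where "dd t = a + (1 / (1 - \<sigma> * t * \<delta>)) *\<^sub>R (q + (\<sigma> * t) *\<^sub>R rot q)" for t
  have bb: "(bb \<longlongrightarrow> b) ?F" unfolding bb_def by (rule tendsto_eq_intros refl | simp add: p_def)+
  have dd: "(dd \<longlongrightarrow> d) ?F" unfolding dd_def by (rule tendsto_eq_intros refl | simp add: q_def)+
  have ev\<beta>: "eventually (\<lambda>t. 0 < 1 - \<sigma> * t * \<beta>) ?F"
    by (rule order_tendstoD(1)[of _ 1]) (rule tendsto_eq_intros refl | simp)+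
  have ev\<delta>: "eventually (\<lambda>t. 0 < 1 - \<sigma> * t * \<delta>) ?F"
    by (rule order_tendstoD(1)[of _ 1]) (rule tendsto_eq_intros refl | simp)+
  have "G jb p = - g jb a" using g_plus[of jb a p] b by (simp add: p_def)
  then have gb: "g jb (bb t) = 0" if "0 < 1 - \<sigma> * t * \<beta>" for t
  proof -
    have "G jb (p + (\<sigma> * t) *\<^sub>R rot p) = - g jb a * (1 - \<sigma> * t * \<beta>)"
      using \<open>G jb p = - g jb a\<close> ab by (simp add: \<beta>_def field_simps)
    then show ?thesis unfolding bb_def g_plus G_linear(2) using that by simp
  qed
  have "G jd q = - g jd a" using g_plus[of jd a q] d by (simp add: q_def)
  then have gd: "g jd (dd t) = 0" if "0 < 1 - \<sigma> * t * \<delta>" for t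
  proof -
    have "G jd (q + (\<sigma> * t) *\<^sub>R rot q) = - g jd a * (1 - \<sigma> * t * \<delta>)"
      using \<open>G jd q = - g jd a\<close> ad by (simp add: \<delta>_def field_simps)
    then show ?thesis unfolding dd_def g_plus G_linear(2) using that by simp
  qed
  have "eventually (\<lambda>t. bb t \<in> region) ?F"
  proof (rule eventually_region[OF bb])
    fix j assume "j < n" "g j b = 0"
    then have "j = jb" using b by force
    then show "eventually (\<lambda>t. g j (bb t) = 0) ?F" using ev\<beta> gb by (auto elim: eventually_mono)
  qed (use rect in \<open>auto simp: rect_in_def\<close>)
  moreover have "eventually (\<lambda>t. dd t \<in> region) ?F"
  proof (rule eventually_region[OF dd])
    fix j assume "j < n" "g j d = 0"
    then have "j = jd" using d by force
    then show "eventually (\<lambda>t. g j (dd t) = 0) ?F" using ev\<delta> gd by (auto elim: eventually_mono)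
  qed (use rect in \<open>auto simp: rect_in_def\<close>)
  moreover have "eventually (\<lambda>t. bb t + dd t - a \<in> region) ?F"
  proof (rule eventually_region)
    have "c = b + d - a" using rect by (simp add: rect_in_def algebra_simps)
    then show "((\<lambda>t. bb t + dd t - a) \<longlongrightarrow> c) ?F" by (auto intro!: tendsto_intros bb dd)
  qed (use rect c in \<open>auto simp: rect_in_def\<close>)
  moreover have "eventually (\<lambda>t. 0 < 1 - \<sigma> * t * (\<beta> + \<delta>) / 2) ?F"
    by (rule order_tendstoD(1)[of _ 1]) (rule tendsto_eq_intros refl | simp)+
  moreover have "eventually (\<lambda>t::real. 0 < t) ?F" by (simp add: eventually_at_right_less)
  ultimately have "eventually (\<lambda>t. bb t \<in> region \<and> dd t \<in> region \<and> bb t + dd t - a \<in> region \<and>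
      0 < 1 - \<sigma> * t * (\<beta> + \<delta>) / 2 \<and> 0 < t \<and> 0 < 1 - \<sigma> * t * \<beta> \<and> 0 < 1 - \<sigma> * t * \<delta>) ?F"
    using ev\<beta> ev\<delta> by (intro eventually_conj)
  then obtain t where t: "bb t \<in> region" "dd t \<in> region" "bb t + dd t - a \<in> region"
      "0 < 1 - \<sigma> * t * (\<beta> + \<delta>) / 2" "0 < t" "0 < 1 - \<sigma> * t * \<beta>" "0 < 1 - \<sigma> * t * \<delta>"
    using eventually_happens[of _ ?F] trivial_limit_at_right_real by blast
  define \<epsilon> where "\<epsilon> = \<sigma> * t"
  define D where "D = (1 - \<epsilon> * \<beta>) * (1 - \<epsilon> * \<delta>)"
  have \<epsilon>2: "0 < \<epsilon>\<^sup>2" using t by (simp add: \<epsilon>_def \<sigma>_def)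
  have D0: "0 < D" using t by (simp add: D_def \<epsilon>_def)
  have "0 \<le> \<epsilon> * (\<beta> + \<delta>)" unfolding \<epsilon>_def using \<sigma> t(5)
    by (metis (no_types, lifting) less_eq_real_def mult.assoc mult.commute mult_nonneg_nonneg)
  then have h: "0 \<le> 1 - \<epsilon> * (\<beta> + \<delta>) / 2" "1 - \<epsilon> * (\<beta> + \<delta>) / 2 \<le> 1"
    using t(4) by (auto simp: \<epsilon>_def)
  \<comment> \<open>Difference of squares around the mean of the two factors. The sign of \<epsilon>
    makes this mean at most 1, hence also \<open>D\<close>.\<close>
  have "D = (1 - \<epsilon> * (\<beta> + \<delta>) / 2)\<^sup>2 - (\<epsilon> * (\<beta> - \<delta>) / 2)\<^sup>2"
    unfolding D_def by (simp add: power2_eq_square field_simps)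
  also have "\<dots> \<le> 1" using power_le_one[OF h, of 2] by (smt (verit) zero_le_power2)
  finally have D1: "D \<le> 1" .
  have "D < 1 + \<epsilon>\<^sup>2" using D1 \<epsilon>2 by linarith
  then have ratio: "1 < (1 + \<epsilon>\<^sup>2) / D" using D0 by simp
  have ba: "bb t - a = (1 / (1 - \<epsilon> * \<beta>)) *\<^sub>R (p + \<epsilon> *\<^sub>R rot p)"
    and da: "dd t - a = (1 / (1 - \<epsilon> * \<delta>)) *\<^sub>R (q + \<epsilon> *\<^sub>R rot q)"
    by (simp_all add: bb_def dd_def \<epsilon>_def)
  have pq: "p \<bullet> q = 0" using rect by (simp add: rect_in_def p_def q_def)
  have "(p + \<epsilon> *\<^sub>R rot p) \<bullet> (q + \<epsilon> *\<^sub>R rot q) = (1 + \<epsilon>\<^sup>2) * (p \<bullet> q)"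
    by (simp add: inner_real2 power2_eq_square algebra_simps)
  then have "(bb t - a) \<bullet> (dd t - a) = 0" unfolding ba da using pq by simp
  then have "rect_in region a (bb t) (bb t + dd t - a) (dd t)"
    using t rect by (auto simp: rect_in_def algebra_simps)
  moreover have "cross2 (p + \<epsilon> *\<^sub>R rot p) (q + \<epsilon> *\<^sub>R rot q) = (1 + \<epsilon>\<^sup>2) * cross2 p q"
    by (simp add: cross2_def power2_eq_square algebra_simps del: cross2_add)
  then have "cross2 (bb t - a) (dd t - a) = (1 + \<epsilon>\<^sup>2) / D * cross2 p q"
    unfolding ba da D_def by (simp del: cross2_add)
  then have "sqarea a (bb t) (dd t) = ((1 + \<epsilon>\<^sup>2) / D)\<^sup>2 * sqarea a b d"
    by (simp add: sqarea_def p_def q_def power_mult_distrib power_divide del: cross2_diff)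
  moreover have "1 < ((1 + \<epsilon>\<^sup>2) / D)\<^sup>2" using ratio by (simp add: one_less_power)
  then have "sqarea a b d < ((1 + \<epsilon>\<^sup>2) / D)\<^sup>2 * sqarea a b d" using pos by simp
  ultimately show ?thesis by metis
qed

end

section \<open>Turning an inscribed rectangle\<close>

definition turned :: "real \<Rightarrow> real^2 \<Rightarrow> real^2" where
  "turned \<theta> x = cos \<theta> *\<^sub>R x + sin \<theta> *\<^sub>R rot x"

lemma turned_0 [simp]: "turned 0 x = x" and turned_pi [simp]: "turned pi x = - x"
  by (simp_all add: turned_def)

lemma inner_turned: "turned \<theta> x \<bullet> turned \<theta> y = x \<bullet> y"
proof -
  have "turned \<theta> x \<bullet> turned \<theta> y = ((cos \<theta>)\<^sup>2 + (sin \<theta>)\<^sup>2) * (x \<bullet> y)"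
    by (simp only: turned_def inner_real2 vector_add_component vector_scaleR_component rot_nth
        real_scaleR_def power2_eq_square) algebra
  then show ?thesis by simp
qed

lemma norm_turned [simp]: "norm (turned \<theta> x) = norm x"
  by (simp add: norm_eq_sqrt_inner inner_turned)

lemma tendsto_turned [tendsto_intros]:
  assumes "(f \<longlongrightarrow> \<theta>) F"
  shows "((\<lambda>t. turned (f t) x) \<longlongrightarrow> turned \<theta> x) F"
proof -
  have "isCont (\<lambda>\<theta>. turned \<theta> x) \<theta>" unfolding turned_def by (intro continuous_intros)
  then show ?thesis using assms by (rule isCont_tendsto_compose)
qed

lemma continuous_on_turned [continuous_intros]:
  fixes f :: "'a :: t2_space \<Rightarrow> real"
  assumes "continuous_on S f"
  shows "continuous_on S (\<lambda>z. turned (f z) x)"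
  unfolding turned_def by (intro continuous_intros assms)

section \<open>Continuous dependence of the solution of a linear system on its matrix\<close>

lemma tendsto_det:
  fixes A :: "'a \<Rightarrow> real^'n^'n"
  assumes "\<And>i j. ((\<lambda>t. A t $ i $ j) \<longlongrightarrow> B $ i $ j) F"
  shows "((\<lambda>t. det (A t)) \<longlongrightarrow> det B) F"
  unfolding det_def by (intro tendsto_intros assms)

text \<open>By Cramer's rule the solution is a quotient of determinants, hence continuous in the
  matrix as long as the denominator is nonzero, which persists near \<open>B\<close>.\<close>

lemma tendsto_solution:
  fixes A :: "'a \<Rightarrow> real^'n^'n" and x r :: "real^'n"
  assumes A: "\<And>i j. ((\<lambda>t. A t $ i $ j) \<longlongrightarrow> B $ i $ j) F"
    and det: "det B \<noteq> 0" and x: "B *v x = r"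
  obtains y where "(y \<longlongrightarrow> x) F" "eventually (\<lambda>t. A t *v y t = r) F"
proof
  define sol where "sol M = (\<chi> k. det (\<chi> i j. if j = k then r $ i else M $ i $ j) / det M)"
    for M :: "real^'n^'n"
  have "((\<lambda>t. sol (A t)) \<longlongrightarrow> sol B) F"
  proof (rule vec_tendstoI)
    fix k
    have "((\<lambda>t. det (\<chi> i j. if j = k then r $ i else A t $ i $ j)) \<longlongrightarrow>
           det (\<chi> i j. if j = k then r $ i else B $ i $ j)) F"
      by (rule tendsto_det) (simp add: A)
    then show "((\<lambda>t. sol (A t) $ k) \<longlongrightarrow> sol B $ k) F"
      unfolding sol_def by (simp add: tendsto_divide tendsto_det[OF A] det)
  qed
  moreover have "sol B = x" using iffD1[OF cramer[OF det] x] by (simp add: sol_def)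
  ultimately show "((\<lambda>t. sol (A t)) \<longlongrightarrow> x) F" by simp
  have "eventually (\<lambda>t. det (A t) \<noteq> 0) F"
    using tendsto_imp_eventually_ne[OF tendsto_det[OF A] det] by simp
  then show "eventually (\<lambda>t. A t *v sol (A t) = r) F"
    by (rule eventually_mono) (simp add: sol_def cramer)
qed

lemma vector_4 [simp]:
  "(vector [x1, x2, x3, x4] :: 'a :: zero^4) $ 1 = x1"
  "(vector [x1, x2, x3, x4] :: 'a :: zero^4) $ 2 = x2"
  "(vector [x1, x2, x3, x4] :: 'a :: zero^4) $ 3 = x3"
  "(vector [x1, x2, x3, x4] :: 'a :: zero^4) $ 4 = x4"
  unfolding vector_def by simp_all

locale rect_on_edges = oriented_polygon +
  fixes ja jb jc jd :: nat and a0 b0 c0 d0 :: "real^2"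
  assumes j_less: "ja < n" "jb < n" "jc < n" "jd < n"
    and j_neq: "ja \<noteq> jb" "ja \<noteq> jd"
    and rect0: "rect_in region a0 b0 c0 d0"
    and on0: "g ja a0 = 0" "g jb b0 = 0" "g jc c0 = 0" "g jd d0 = 0"
begin

definition p where "p = b0 - a0"
definition q where "q = d0 - a0"

text \<open>
  The vector \<open>z\<close> encodes the corner \<open>a\<close> and the side lengths, relative to \<open>p\<close> and \<open>q\<close>, of a
  rectangle that is turned by \<open>\<theta>\<close> against the given one.
\<close>

definition cA :: "real^4 \<Rightarrow> real^2" where "cA z = vector [z $ 1, z $ 2]"
definition cB where "cB \<theta> z = cA z + z $ 3 *\<^sub>R turned \<theta> p"
definition cD where "cD \<theta> z = cA z + z $ 4 *\<^sub>R turned \<theta> q"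
definition cC where "cC \<theta> z = cA z + z $ 3 *\<^sub>R turned \<theta> p + z $ 4 *\<^sub>R turned \<theta> q"

definition on_lines :: "real \<Rightarrow> real^4 \<Rightarrow> bool" where
  "on_lines \<theta> z \<longleftrightarrow> g ja (cA z) = 0 \<and> g jb (cB \<theta> z) = 0 \<and> g jc (cC \<theta> z) = 0 \<and> g jd (cD \<theta> z) = 0"

definition inscribed :: "real \<Rightarrow> real^4 \<Rightarrow> bool" where
  "inscribed \<theta> z \<longleftrightarrow> on_lines \<theta> z \<and> cA z \<in> region \<and> cB \<theta> z \<in> region \<and> cC \<theta> z \<in> region \<and> cD \<theta> z \<in> region \<and>
     0 \<le> z $ 3 \<and> 0 \<le> z $ 4"

text \<open>For a fixed angle the corners depend affinely on \<open>z\<close>, so lying on the four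
  lines is a square linear system. The rows belong to the corners a, b, c, d, and the right-hand
  side \<open>rhs\<close> is independent of the angle.\<close>

definition rows :: "real \<Rightarrow> real^4^4" where
  "rows \<theta> = vector
     [vector [G ja (axis 1 1), G ja (axis 2 1), 0, 0],
      vector [G jb (axis 1 1), G jb (axis 2 1), G jb (turned \<theta> p), 0],
      vector [G jc (axis 1 1), G jc (axis 2 1), G jc (turned \<theta> p), G jc (turned \<theta> q)],
      vector [G jd (axis 1 1), G jd (axis 2 1), 0, G jd (turned \<theta> q)]]"

definition rhs :: "real^4" where
  "rhs = vector [- g ja 0, - g jb 0, - g jc 0, - g jd 0]"

lemma cA_nth [simp]: "cA z $ 1 = z $ 1" "cA z $ 2 = z $ 2"
  by (simp_all add: cA_def)

lemma g_cA: "g i (cA z) = g i 0 + z $ 1 * G i (axis 1 1) + z $ 2 * G i (axis 2 1)"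
proof -
  have "cA z = z $ 1 *\<^sub>R axis 1 1 + z $ 2 *\<^sub>R axis 2 1"
    by (simp add: vec2_eq_iff axis_def)
  then show ?thesis using g_plus[of i 0 "cA z"] by simp
qed

lemma rows_eq: "rows \<theta> *v z = rhs \<longleftrightarrow> on_lines \<theta> z"
  unfolding vec_eq_iff forall_4 rows_def rhs_def on_lines_def cB_def cC_def cD_def g_plus g_cA
  by (simp add: matrix_vector_mult_def sum_4 algebra_simps) (auto simp: algebra_simps)

lemma tendsto_rows:
  assumes "(f \<longlongrightarrow> \<theta>) F"
  shows "((\<lambda>t. rows (f t) $ i $ j) \<longlongrightarrow> rows \<theta> $ i $ j) F"
proof -
  have G: "((\<lambda>t. G i (turned (f t) x)) \<longlongrightarrow> G i (turned \<theta> x)) F" for i x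
    unfolding G_def by (intro tendsto_intros assms)
  have "\<forall>i j. ((\<lambda>t. rows (f t) $ i $ j) \<longlongrightarrow> rows \<theta> $ i $ j) F"
    unfolding forall_4 rows_def by (simp add: G)
  then show ?thesis by blast
qed

lemma tendsto_cA [tendsto_intros]:
  assumes "(y \<longlongrightarrow> z) F"
  shows "((\<lambda>t. cA (y t)) \<longlongrightarrow> cA z) F"
proof (rule vec_tendstoI)
  fix i :: 2
  have "i = 1 \<or> i = 2" by (rule exhaust_2)
  then show "((\<lambda>t. cA (y t) $ i) \<longlongrightarrow> cA z $ i) F" using tendsto_vec_nth[OF assms] by auto
qed

lemma tendsto_corners:
  assumes "(f \<longlongrightarrow> \<theta>) F" "(y \<longlongrightarrow> z) F"
  shows "((\<lambda>t. cB (f t) (y t)) \<longlongrightarrow> cB \<theta> z) F"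
    "((\<lambda>t. cC (f t) (y t)) \<longlongrightarrow> cC \<theta> z) F" "((\<lambda>t. cD (f t) (y t)) \<longlongrightarrow> cD \<theta> z) F"
  unfolding cB_def cC_def cD_def by (intro tendsto_intros assms)+

lemma inscribed_rect_in: "inscribed \<theta> z \<Longrightarrow> rect_in region (cA z) (cB \<theta> z) (cC \<theta> z) (cD \<theta> z)"
  using rect0 by (auto simp: inscribed_def rect_in_def cB_def cC_def cD_def inner_turned p_def q_def)

text \<open>All inscribed rectangles turned by at most a half turn. Compactness of this set provides
  the largest angle that is attained.\<close>

definition K :: "(real \<times> (real^4)) set" where
  "K = {(\<theta>, z). 0 \<le> \<theta> \<and> \<theta> \<le> pi \<and> inscribed \<theta> z}"

lemma closed_K: "closed K"
proof -
  have cA: "continuous_on UNIV (\<lambda>x :: real \<times> (real^4). cA (snd x))"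
    unfolding continuous_on_def by (intro ballI tendsto_intros)
  have cB: "continuous_on UNIV (\<lambda>x :: real \<times> (real^4). cB (fst x) (snd x))"
    unfolding cB_def by (intro continuous_intros cA)
  have cC: "continuous_on UNIV (\<lambda>x :: real \<times> (real^4). cC (fst x) (snd x))"
    unfolding cC_def by (intro continuous_intros cA)
  have cD: "continuous_on UNIV (\<lambda>x :: real \<times> (real^4). cD (fst x) (snd x))"
    unfolding cD_def by (intro continuous_intros cA)
  have reg: "closed {x. f x \<in> region}" if "continuous_on UNIV f" for f :: "real \<times> (real^4) \<Rightarrow> real^2"
    using closed_vimage[OF closed_region that] by (simp add: vimage_def)
  have "K = {x. 0 \<le> fst x} \<inter> {x. fst x \<le> pi} \<inter> {x. 0 \<le> snd x $ 3} \<inter> {x. 0 \<le> snd x $ 4} \<inter>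
     {x. cA (snd x) \<in> region} \<inter> {x. cB (fst x) (snd x) \<in> region} \<inter> {x. cC (fst x) (snd x) \<in> region} \<inter>
     {x. cD (fst x) (snd x) \<in> region} \<inter>
     {x. g ja (cA (snd x)) = 0} \<inter> {x. g jb (cB (fst x) (snd x)) = 0} \<inter>
     {x. g jc (cC (fst x) (snd x)) = 0} \<inter> {x. g jd (cD (fst x) (snd x)) = 0}"
    by (auto simp: K_def inscribed_def on_lines_def)
  also have "closed \<dots>"
    by (intro closed_Int reg closed_Collect_le closed_Collect_eq continuous_intros cA cB cC cD)
  finally show ?thesis .
qed

lemma bounded_K:
  assumes "p \<noteq> 0" "q \<noteq> 0"
  shows "bounded K"
proof -
  obtain B where B: "\<And>x. x \<in> region \<Longrightarrow> norm x \<le> B"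
    using compact_region compact_imp_bounded bounded_iff by metis
  have len: "w \<le> 2 * B / norm x"
    if "a \<in> region" "a + w *\<^sub>R turned \<theta> x \<in> region" "0 \<le> w" "x \<noteq> 0" for a w \<theta> x
  proof -
    have "w * norm x = norm ((a + w *\<^sub>R turned \<theta> x) - a)" using that by simp
    also have "\<dots> \<le> B + B" using B that norm_triangle_ineq4 by (meson add_mono order.trans)
    finally show ?thesis using that by (simp add: field_simps)
  qed
  have "norm x \<le> pi + (B + B + 2 * B / norm p + 2 * B / norm q)" if in_K: "x \<in> K" for x
  proof -
    obtain \<theta> z where x: "x = (\<theta>, z)" "0 \<le> \<theta>" "\<theta> \<le> pi" "inscribed \<theta> z" using in_K by (cases x) (auto simp: K_def)
    have "\<bar>z $ 3\<bar> \<le> 2 * B / norm p"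
      using len[of "cA z" "z $ 3" \<theta> p] x assms by (simp add: inscribed_def cB_def)
    moreover have "\<bar>z $ 4\<bar> \<le> 2 * B / norm q"
      using len[of "cA z" "z $ 4" \<theta> q] x assms by (simp add: inscribed_def cD_def)
    moreover have "\<bar>z $ 1\<bar> \<le> B" "\<bar>z $ 2\<bar> \<le> B"
      using B[of "cA z"] x component_le_norm_cart[of "cA z"] by (metis cA_nth inscribed_def order.trans)+
    moreover have "norm z \<le> \<bar>z $ 1\<bar> + \<bar>z $ 2\<bar> + \<bar>z $ 3\<bar> + \<bar>z $ 4\<bar>"
      using norm_le_l1_cart[of z] by (simp add: sum_4)
    moreover have "norm x \<le> norm \<theta> + norm z" unfolding x by (rule norm_Pair_le)
    ultimately show ?thesis using x by simp
  qed
  then show ?thesis unfolding bounded_iff by blast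
qed

text \<open>
  Among the inscribed rectangles take one that is turned as far as possible.  If the linear
  system for the corners is regular there, then it can be turned further; if it is singular,
  then the rectangle can be translated and resized along the kernel until a corner reaches a vertex.
\<close>

lemma vertex_reached:
  assumes "p \<noteq> 0" "q \<noteq> 0"
  shows "\<exists>a b c d. rect_in region a b c d \<and> g ja a = 0 \<and> g jb b = 0 \<and> g jc c = 0 \<and> g jd d = 0 \<and>
           (a \<in> range V \<or> b \<in> range V \<or> c \<in> range V \<or> d \<in> range V)"
proof (rule ccontr)
  assume contra: "\<not> ?thesis"
  have novertex: "cA z \<notin> range V" "cB \<theta> z \<notin> range V" "cC \<theta> z \<notin> range V" "cD \<theta> z \<notin> range V"
    if "inscribed \<theta> z" for \<theta> z
    using contra inscribed_rect_in[OF that] that unfolding inscribed_def on_lines_def by blast+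
  \<comment> \<open>A side of length zero would put the corner a on two different edges, hence on a
    vertex.\<close>
  have pos: "0 < z $ 3" "0 < z $ 4" if ins: "inscribed \<theta> z" for \<theta> z
  proof -
    have "z $ 3 \<noteq> 0"
    proof
      assume "z $ 3 = 0"
      then have "cB \<theta> z = cA z" by (simp add: cB_def)
      then show False
        using vertex_if_two_zeros[of "cA z" ja jb] j_less j_neq novertex(1)[OF ins] ins
        by (auto simp: inscribed_def on_lines_def)
    qed
    then show "0 < z $ 3" using ins by (simp add: inscribed_def)
    have "z $ 4 \<noteq> 0"
    proof
      assume "z $ 4 = 0"
      then have "cD \<theta> z = cA z" by (simp add: cD_def)
      then show False
        using vertex_if_two_zeros[of "cA z" ja jd] j_less j_neq novertex(1)[OF ins] ins
        by (auto simp: inscribed_def on_lines_def)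
    qed
    then show "0 < z $ 4" using ins by (simp add: inscribed_def)
  qed
  \<comment> \<open>As no corner is a vertex, each lies on exactly one edge. Staying on the four
    lines therefore suffices to stay in the polygon under a small change.\<close>
  have persist: "eventually (\<lambda>t. inscribed (f t) (y t)) F"
    if ins: "inscribed \<theta> z" and lim: "(f \<longlongrightarrow> \<theta>) F" "(y \<longlongrightarrow> z) F"
      and lines: "eventually (\<lambda>t. on_lines (f t) (y t)) F" for \<theta> z f y and F :: "real filter"
  proof -
    have reg: "eventually (\<lambda>t. h t \<in> region) F"
      if "(h \<longlongrightarrow> x) F" "x \<in> region" "i < n" "g i x = 0" "x \<notin> range V"
        "\<And>t. on_lines (f t) (y t) \<Longrightarrow> g i (h t) = 0" for h x i
    proof (rule eventually_region)
      fix j assume "j < n" "g j x = 0"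
      then have "j = i" using that vertex_if_two_zeros by blast
      then show "eventually (\<lambda>t. g j (h t) = 0) F"
        using lines that(6) by (auto elim: eventually_mono)
    qed (use that in auto)
    note T = tendsto_corners[OF lim]
    have "eventually (\<lambda>t. cA (y t) \<in> region) F"
      by (rule reg[OF tendsto_cA[OF lim(2)], of ja]) (use ins novertex[OF ins] j_less in \<open>auto simp: inscribed_def on_lines_def\<close>)
    moreover have "eventually (\<lambda>t. cB (f t) (y t) \<in> region) F"
      by (rule reg[OF T(1), of jb]) (use ins novertex[OF ins] j_less in \<open>auto simp: inscribed_def on_lines_def\<close>)
    moreover have "eventually (\<lambda>t. cC (f t) (y t) \<in> region) F"
      by (rule reg[OF T(2), of jc]) (use ins novertex[OF ins] j_less in \<open>auto simp: inscribed_def on_lines_def\<close>)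
    moreover have "eventually (\<lambda>t. cD (f t) (y t) \<in> region) F"
      by (rule reg[OF T(3), of jd]) (use ins novertex[OF ins] j_less in \<open>auto simp: inscribed_def on_lines_def\<close>)
    moreover have "eventually (\<lambda>t. 0 < y t $ 3) F" "eventually (\<lambda>t. 0 < y t $ 4) F"
      using pos[OF ins] by (auto intro!: order_tendstoD(1) tendsto_vec_nth lim)
    ultimately show ?thesis using lines
      by eventually_elim (simp add: inscribed_def)
  qed
  have "inscribed 0 (vector [a0 $ 1, a0 $ 2, 1, 1])"
  proof -
    let ?z = "vector [a0 $ 1, a0 $ 2, 1, 1] :: real^4"
    have "cA ?z = a0" by (simp add: vec2_eq_iff)
    moreover have "c0 = b0 + d0 - a0" using rect0 by (simp add: rect_in_def algebra_simps)
    ultimately have "cA ?z = a0" "cB 0 ?z = b0" "cC 0 ?z = c0" "cD 0 ?z = d0"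
      by (simp_all add: cB_def cC_def cD_def p_def q_def)
    then show ?thesis using on0 rect0 by (simp add: inscribed_def on_lines_def rect_in_def)
  qed
  then have "(0, vector [a0 $ 1, a0 $ 2, 1, 1]) \<in> K" by (simp add: K_def)
  then have K_ne: "K \<noteq> {}" by blast
  have compact_K: "compact K" using closed_K bounded_K[OF assms] by (simp add: compact_eq_bounded_closed)
  obtain x where x: "x \<in> K" "\<And>y. y \<in> K \<Longrightarrow> fst y \<le> fst x"
    using continuous_attains_sup[OF compact_K K_ne continuous_on_fst[OF continuous_on_id]] by blast
  define \<theta> where "\<theta> = fst x"
  have ins: "inscribed \<theta> (snd x)" and \<theta>: "0 \<le> \<theta>" "\<theta> \<le> pi" using x(1) by (auto simp: K_def \<theta>_def)
  \<comment> \<open>After a half turn the side from a to b has the direction \<open>- p\<close>,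
    while \<open>b0\<close> lies strictly on the inner side of edge \<open>ja\<close>. The turned b
    would be outside.\<close>
  have "\<theta> \<noteq> pi"
  proof
    assume "\<theta> = pi"
    have gb: "0 \<le> g ja (cB \<theta> (snd x))" "g ja (cA (snd x)) = 0"
      using ins region_g by (auto simp: inscribed_def on_lines_def)
    have "b0 \<notin> range V" using contra rect0 on0 by blast
    then have "g ja b0 \<noteq> 0"
      using vertex_if_two_zeros[of b0 ja jb] j_less j_neq on0 rect0 by (auto simp: rect_in_def)
    moreover have "0 \<le> g ja b0" using rect0 region_g by (auto simp: rect_in_def)
    moreover have "g ja b0 = G ja p" using g_plus[of ja a0 p] on0 by (simp add: p_def)
    ultimately have "0 < G ja p" by simp
    moreover have "g ja (cB \<theta> (snd x)) = - (snd x $ 3) * G ja p"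
      unfolding cB_def g_plus using gb \<open>\<theta> = pi\<close> by simp
    ultimately have "snd x $ 3 \<le> 0" using gb by (simp add: mult_le_0_iff zero_le_mult_iff)
    then show False using pos[OF ins] by simp
  qed
  then have "\<theta> < pi" using \<theta> by simp
  show False
  proof (cases "det (rows \<theta>) = 0")
    case False
    let ?F = "at_right \<theta>"
    have lim: "((\<lambda>t. t) \<longlongrightarrow> \<theta>) ?F" by (rule tendsto_ident_at)
    have "rows \<theta> *v snd x = rhs" using ins by (simp add: rows_eq inscribed_def)
    then obtain y where y: "(y \<longlongrightarrow> snd x) ?F" "eventually (\<lambda>t. rows t *v y t = rhs) ?F"
      using tendsto_solution[of "\<lambda>t. rows t" "rows \<theta>" ?F "snd x" rhs] tendsto_rows[OF lim] False by blast
    have "eventually (\<lambda>t. inscribed t (y t)) ?F"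
      by (rule persist[OF ins lim y(1)]) (use y(2) in \<open>simp add: rows_eq\<close>)
    moreover have "eventually (\<lambda>t. t \<in> {\<theta><..<pi}) ?F"
      using \<open>\<theta> < pi\<close> by (rule eventually_at_right_real)
    ultimately have "eventually (\<lambda>t. inscribed t (y t) \<and> t \<in> {\<theta><..<pi}) ?F" by (rule eventually_conj)
    then obtain t where "inscribed t (y t)" "\<theta> < t" "t < pi"
      using eventually_happens[of _ ?F] trivial_limit_at_right_real by fastforce
    then have "(t, y t) \<in> K" using \<theta> by (simp add: K_def)
    then show False using x(2)[of "(t, y t)"] \<open>\<theta> < t\<close> by (simp add: \<theta>_def)
  next
    case True
    then obtain k where k: "k \<noteq> 0" "rows \<theta> *v k = 0"
      using invertible_det_nz invertible_left_inverse matrix_left_invertible_ker by metis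
    let ?K = "snd ` (K \<inter> {y. fst y = \<theta>})"
    have "closed {y :: real \<times> (real^4). fst y = \<theta>}" by (intro closed_Collect_eq continuous_intros)
    then have "compact ?K"
      by (intro compact_continuous_image compact_Int_closed compact_K continuous_intros)
    moreover have "?K \<noteq> {}" using x(1) by (auto simp: \<theta>_def)
    moreover have "continuous_on ?K (\<lambda>y. y \<bullet> k)" by (intro continuous_intros)
    ultimately have "\<exists>z\<in>?K. \<forall>y\<in>?K. y \<bullet> k \<le> z \<bullet> k" by (rule continuous_attains_sup)
    \<comment> \<open>Among the rectangles of this angle, \<open>z\<close> is extremal in the
      direction of the kernel vector \<open>k\<close>. A further step along \<open>k\<close> would
      stay inscribed and increase the inner product with \<open>k\<close>.\<close>
    then obtain z where z: "z \<in> ?K" "\<And>y. y \<in> ?K \<Longrightarrow> y \<bullet> k \<le> z \<bullet> k" by blast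
    let ?F = "at_right (0::real)"
    have insz: "inscribed \<theta> z" using z(1) by (auto simp: K_def)
    have lim: "((\<lambda>t. z + t *\<^sub>R k) \<longlongrightarrow> z) ?F" by (rule tendsto_eq_intros refl | simp)+
    have "rows \<theta> *v (z + t *\<^sub>R k) = rhs" for t
      using insz k by (simp add: matrix_vector_right_distrib matrix_vector_mult_scaleR inscribed_def rows_eq)
    then have "eventually (\<lambda>t. inscribed \<theta> (z + t *\<^sub>R k)) ?F"
      by (intro persist[OF insz tendsto_const lim]) (simp add: rows_eq)
    moreover have "eventually (\<lambda>t::real. 0 < t) ?F" by (simp add: eventually_at_right_less)
    ultimately have "eventually (\<lambda>t. inscribed \<theta> (z + t *\<^sub>R k) \<and> 0 < t) ?F" by (rule eventually_conj)
    then obtain t where t: "inscribed \<theta> (z + t *\<^sub>R k)" "0 < t"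
      using eventually_happens[of _ ?F] trivial_limit_at_right_real by fastforce
    then have "z + t *\<^sub>R k \<in> ?K" using \<theta> by (force simp: K_def)
    then have "t * (k \<bullet> k) \<le> 0" using z(2) by (fastforce simp: inner_add_left)
    moreover have "0 < k \<bullet> k" using k by simp
    ultimately show False using t(2) by (simp add: mult_le_0_iff del: inner_gt_zero_iff)
  qed
qed

end

section \<open>From rectangles to feasible optimization problems\<close>

context oriented_polygon
begin

text \<open>A rectangle of squared area \<open>A\<close> is feasible for one of the \<open>O(n\<^sup>3)\<close> optimization problems
  that are posed to the solver.\<close>

definition covered :: "real \<Rightarrow> bool" where
  "covered A \<longleftrightarrow> (\<exists>p<n. \<exists>i<n. \<exists>j<n. \<exists>k<n. \<exists>a b c d. pass (Suc p) i j \<and>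
     a \<in> convex hull {V (Suc p), V p, V (Suc (Suc p))} \<and>
     b \<in> convex hull {V (Suc p), V i, V (Suc i)} \<and>
     c \<in> convex hull {V (Suc p), V k, V (Suc k)} \<and>
     d \<in> convex hull {V (Suc p), V j, V (Suc j)} \<and>
     c - d = b - a \<and> (b - a) \<bullet> (d - a) = 0 \<and> sqarea a b d = A)"

lemma coveredI:
  assumes "rect_in region a b c d" "i < n" "j < n" "pass q i j"
    and "a \<in> convex hull {V q, V (q + n - 1), V (Suc q)}"
    and "b \<in> convex hull {V q, V i, V (Suc i)}" "d \<in> convex hull {V q, V j, V (Suc j)}"
  shows "covered (sqarea a b d)"
proof -
  define m where "m = (q + n - 1) mod n"
  have m: "m < n" using n_ge_3 by (simp add: m_def)
  have Vm: "V m = V (q + n - 1)" by (simp add: m_def)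
  have "V (Suc m) = V (q + n)" unfolding m_def V_Suc_mod using n_ge_3 by simp
  then have Vm1: "V (Suc m) = V q" by (simp add: periodic)
  then have Vm2: "V (Suc (Suc m)) = V (Suc q)" by (rule V_Suc_cong)
  obtain k where "k < n" "c \<in> convex hull {V q, V k, V (Suc k)}"
    using fan_cover assms(1) unfolding rect_in_def by blast
  moreover have "pass (Suc m) i j" using assms(4) by (simp add: pass_def Vm1)
  ultimately have "pass (Suc m) i j \<and> a \<in> convex hull {V (Suc m), V m, V (Suc (Suc m))} \<and>
      b \<in> convex hull {V (Suc m), V i, V (Suc i)} \<and> c \<in> convex hull {V (Suc m), V k, V (Suc k)} \<and>
      d \<in> convex hull {V (Suc m), V j, V (Suc j)} \<and> c - d = b - a \<and> (b - a) \<bullet> (d - a) = 0 \<and>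
      sqarea a b d = sqarea a b d"
    using assms unfolding Vm Vm1 Vm2 by (simp add: rect_in_def)
  then show ?thesis
    unfolding covered_def using m assms(2,3) \<open>k < n\<close> by blast
qed

lemma fan_combination:
  assumes "x \<in> convex hull {V q, V i, V (Suc i)}" "x \<noteq> V q"
  obtains u v where "0 \<le> u" "0 \<le> v" "0 < u + v"
    "x - V q = u *\<^sub>R (V i - V q) + v *\<^sub>R (V (Suc i) - V q)"
proof -
  obtain u v where "0 \<le> u" "0 \<le> v" and x: "x = V q + u *\<^sub>R (V i - V q) + v *\<^sub>R (V (Suc i) - V q)"
    using assms(1) unfolding mem_hull3_iff by blast
  moreover from this have "0 < u + v" using assms(2) by (cases "u = 0 \<and> v = 0") auto
  ultimately show thesis using that[of u v] by simp
qed

lemma edge_combination: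
  assumes "x \<in> region" "g i x = 0"
  obtains u v where "0 \<le> u" "0 \<le> v" "0 < u + v"
    "x - V q = u *\<^sub>R (V i - V q) + v *\<^sub>R (V (Suc i) - V q)"
proof -
  obtain \<tau> where "0 \<le> \<tau>" "\<tau> \<le> 1" "x = V i + \<tau> *\<^sub>R (V (Suc i) - V i)" using on_edge assms by blast
  then show thesis using that[of "1 - \<tau>" \<tau>] by (simp add: algebra_simps)
qed

lemma covered_if_vertex:
  assumes rect: "rect_in region a b c d" and "0 < sqarea a b d" and "a \<in> range V"
  shows "covered (sqarea a b d)"
proof -
  obtain q where q: "a = V q" using assms by blast
  obtain i j where ij: "i < n" "b \<in> convex hull {V q, V i, V (Suc i)}" "j < n" "d \<in> convex hull {V q, V j, V (Suc j)}"
    using rect fan_cover unfolding rect_in_def by metis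
  have "b \<noteq> V q" "d \<noteq> V q" using assms(2) q by (auto simp: sqarea_def)
  then obtain u v u' v' where uv: "0 \<le> u" "0 \<le> v" "0 < u + v"
      "b - V q = u *\<^sub>R (V i - V q) + v *\<^sub>R (V (Suc i) - V q)" "0 \<le> u'" "0 \<le> v'" "0 < u' + v'"
      "d - V q = u' *\<^sub>R (V j - V q) + v' *\<^sub>R (V (Suc j) - V q)"
    using fan_combination ij by metis
  then have "pass q i j"
    using pass_if_perp[OF uv(4,1-3) uv(8,5-7)] rect q by (simp add: rect_in_def)
  then show ?thesis
    using rect ij by (intro coveredI[of a b c d i j q]) (auto simp: q hull_inc)
qed

text \<open>Take \<open>m\<close> as vertex and as edge of \<open>b\<close>. The pair passes
  trivially, because the difference \<open>V m - V m\<close> makes some inner products zero.\<close>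

lemma covered_if_flush:
  assumes "rect_in region a b c d" "m < n" "g m a = 0" "g m b = 0"
  shows "covered (sqarea a b d)"
proof -
  obtain j where "j < n" "d \<in> convex hull {V m, V j, V (Suc j)}"
    using assms(1) fan_cover unfolding rect_in_def by metis
  moreover have "pass m m j" by (auto simp: pass_def)
  moreover have "a \<in> region" "b \<in> region" using assms(1) by (auto simp: rect_in_def)
  then have "a \<in> convex hull {V (m + n - 1), V m, V (Suc m)}" "b \<in> convex hull {V m, V m, V (Suc m)}"
    using on_edge_hull assms by blast+
  ultimately show ?thesis
    using assms by (intro coveredI[of a b c d m j m]) (auto simp: insert_commute)
qed

text \<open>The deformed rectangle has a right angle at the vertex \<open>a'\<close> between points
  of edges \<open>i\<close> and \<open>j\<close>, so this pair passes there. Since \<open>a'\<close>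
  is an end point of edge \<open>m\<close>, the original corner \<open>a\<close> lies on an edge at
  this vertex and hence in its corner triangle.\<close>

lemma covered_if_deformable:
  assumes rect: "rect_in region a b c d" and ij: "m < n" "i < n" "j < n"
    and on: "g m a = 0" "g i b = 0" "g j d = 0"
    and rect': "rect_in region a' b' c' d'" and on': "g m a' = 0" "g i b' = 0" "g j d' = 0" "a' \<in> range V"
  shows "covered (sqarea a b d)"
proof -
  obtain q where q: "a' = V q" using on' by blast
  have reg: "a \<in> region" "b \<in> region" "d \<in> region" "b' \<in> region" "d' \<in> region"
    using rect rect' by (auto simp: rect_in_def)
  obtain u v u' v' where uv: "0 \<le> u" "0 \<le> v" "0 < u + v"
      "b' - V q = u *\<^sub>R (V i - V q) + v *\<^sub>R (V (Suc i) - V q)" "0 \<le> u'" "0 \<le> v'" "0 < u' + v'"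
      "d' - V q = u' *\<^sub>R (V j - V q) + v' *\<^sub>R (V (Suc j) - V q)"
    using edge_combination[of b' i] edge_combination[of d' j] reg on' by metis
  then have "pass q i j"
    using pass_if_perp[OF uv(4,1-3) uv(8,5-7)] rect' q by (simp add: rect_in_def)
  moreover have "a \<in> convex hull {V q, V (q + n - 1), V (Suc q)}"
  proof -
    have "V q = V m \<or> V q = V (Suc m)" using on' q g_V_zero by metis
    then show ?thesis
    proof
      assume "V q = V m"
      then have "V (Suc q) = V (Suc m)" by (rule V_Suc_cong)
      then show ?thesis using on_edge_hull[OF reg(1) on(1), of "V (q + n - 1)"] \<open>V q = V m\<close>
        by (simp add: insert_commute)
    next
      assume eq: "V q = V (Suc m)"
      have "q mod n = Suc m mod n" using eq by (simp add: V_eq_iff)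
      then have "(q + (n - 1)) mod n = (Suc m + (n - 1)) mod n" by (metis mod_add_left_eq)
      then have "V (q + n - 1) = V (m + n)" using n_ge_3 by (simp add: V_eq_iff)
      then show ?thesis using on_edge_hull[OF reg(1) on(1), of "V (Suc q)"] eq
        by (simp add: insert_commute periodic)
    qed
  qed
  ultimately show ?thesis
    using rect ij on_edge_hull reg on by (intro coveredI[of a b c d i j q]) auto
qed

theorem optimal_covered:
  assumes rect: "rect_in region a b c d" and pos: "0 < sqarea a b d"
    and opt: "\<And>a' b' c' d'. rect_in region a' b' c' d' \<Longrightarrow> sqarea a' b' d' \<le> sqarea a b d"
  shows "covered (sqarea a b d)"
proof (rule ccontr)
  assume nc: "\<not> ?thesis"
  define A where "A = sqarea a b d"
  \<comment> \<open>Invariance of \<open>R\<close> under cyclic renaming lets every fact about one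
    corner be used for all four.\<close>
  define R where "R a b c d \<longleftrightarrow> rect_in region a b c d \<and> sqarea a b d = A" for a b c d
  have A: "0 < A" "\<not> covered A" using nc pos by (auto simp: A_def)
  have opt: "\<not> A < sqarea a b d" if "rect_in region a b c d" for a b c d using opt that by (force simp: A_def)
  have R: "R a b c d" using rect by (simp add: R_def A_def)
  have cyc: "R b c d a" if "R a b c d" for a b c d using that rect_in_rotate by (auto simp: R_def)
  have nv: "a \<notin> range V" if "R a b c d" for a b c d
    using covered_if_vertex A that by (auto simp: R_def)
  have nf: "\<not> (g m a = 0 \<and> g m b = 0)" if "R a b c d" "m < n" for a b c d m
    using covered_if_flush A that by (auto simp: R_def)
  have only: "0 < g j x" if "x \<in> region" "x \<notin> range V" "i < n" "j < n" "g i x = 0" "j \<noteq> i" for x i j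
    using that vertex_if_two_zeros[of x i j] region_g[of x j] by force
  \<comment> \<open>If \<open>c\<close> is interior, optimality forces \<open>b\<close> and
    \<open>d\<close> onto edges, as otherwise a side could be moved outwards. With \<open>b\<close>
    and \<open>d\<close> each on a single edge, rotation about \<open>a\<close> enlarges the
    rectangle, a contradiction.\<close>
  have edge: "\<exists>i<n. g i c = 0" if R: "R a b c d" for a b c d
  proof (rule ccontr)
    assume "\<not> ?thesis"
    then have c: "\<forall>j<n. 0 < g j c" using R region_g unfolding R_def rect_in_def
      by (metis less_eq_real_def)
    have in_region: "a \<in> region" "b \<in> region" "d \<in> region" using R by (auto simp: R_def rect_in_def)
    have "\<exists>i<n. g i b = 0"
    proof (rule ccontr)
      assume "\<not> ?thesis"
      then have "\<forall>j<n. 0 < g j b" using in_region region_g by (metis less_eq_real_def)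
      then show False using extend_rect[of a b c d] c R opt A by (auto simp: R_def)
    qed
    then obtain jb where jb: "jb < n" "g jb b = 0" by blast
    have "\<exists>i<n. g i d = 0"
    proof (rule ccontr)
      assume "\<not> ?thesis"
      then have "\<forall>j<n. 0 < g j d" using in_region region_g by (metis less_eq_real_def)
      then show False using extend_rect[of a d c b] c R opt A rect_in_reflect[of region a b c d]
        by (auto simp: R_def sqarea_reflect)
    qed
    then obtain jd where jd: "jd < n" "g jd d = 0" by blast
    have "g jb a \<noteq> 0" using nf[OF R] jb by blast
    moreover have "g jd a \<noteq> 0" using nf[of d a b c jd] cyc R jd by blast
    ultimately have "0 < g jb a" "0 < g jd a" using in_region region_g by (metis less_eq_real_def)+
    moreover have "b \<notin> range V" "d \<notin> range V" using nv cyc R by blast+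
    ultimately show False
      using rotate_rect[of a b c d jb jd] only[OF in_region(2) _ jb(1) _ jb(2)]
        only[OF in_region(3) _ jd(1) _ jd(2)] c R jb jd A opt
      by (auto simp: R_def)
  qed
  obtain ja jb jc jd where j: "ja < n" "g ja a = 0" "jb < n" "g jb b = 0" "jc < n" "g jc c = 0" "jd < n" "g jd d = 0"
    using edge R cyc by metis
  have R': "R b c d a" "R c d a b" "R d a b c" using R cyc by blast+
  have "ja \<noteq> jb" using nf[OF R] j by blast
  moreover have "ja \<noteq> jd" using nf[OF R'(3)] j by blast
  ultimately interpret E: rect_on_edges V n orient ja jb jc jd a b c d
    using j R by unfold_locales (auto simp: R_def)
  have "E.p \<noteq> 0" "E.q \<noteq> 0" using pos by (auto simp: E.p_def E.q_def sqarea_def)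
  then obtain a' b' c' d' where r: "rect_in region a' b' c' d'"
      and g: "g ja a' = 0" "g jb b' = 0" "g jc c' = 0" "g jd d' = 0"
      and v: "a' \<in> range V \<or> b' \<in> range V \<or> c' \<in> range V \<or> d' \<in> range V"
    using E.vertex_reached by blast
  have r': "rect_in region b' c' d' a'" "rect_in region c' d' a' b'" "rect_in region d' a' b' c'"
    using r rect_in_rotate by blast+
  \<comment> \<open>Whichever corner has reached a vertex is renamed to the first one.\<close>
  show False
    using v covered_if_deformable[of a b c d ja jb jd a' b' c' d'] covered_if_deformable[of b c d a jb jc ja b' c' d' a']
      covered_if_deformable[of c d a b jc jd jb c' d' a' b'] covered_if_deformable[of d a b c jd ja jc d' a' b' c']
      R R' r r' g j A unfolding R_def by metis
qed

end

section \<open>Polygons as point sets, and areas\<close>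

lemma inner_cross2:
  "(x \<bullet> x) * (a \<bullet> y) = (a \<bullet> x) * (x \<bullet> y) + cross2 x a * cross2 x y"
  by (simp add: inner_real2 cross2_def algebra_simps)

text \<open>An edge of a polytope is exposed, so a supporting functional \<open>a\<close> is
  constant on it and smaller at all other vertices. As \<open>a\<close> is orthogonal to the
  direction \<open>D\<close> of the edge, \<open>inner_cross2\<close> converts its values into cross
  products with \<open>D\<close> of constant sign.\<close>

lemma exposed_edge_side:
  fixes P :: "(real^2) set"
  assumes "polytope P" "closed_segment u v edge_of P" "u \<noteq> v" "aff_dim P = 2"
  shows "\<exists>\<sigma>. (\<sigma> = 1 \<or> \<sigma> = - 1) \<and>
    (\<forall>x. x extreme_point_of P \<longrightarrow> x \<noteq> u \<longrightarrow> x \<noteq> v \<longrightarrow> 0 < \<sigma> * cross2 (v - u) (x - u))"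
proof -
  let ?F = "closed_segment u v"
  have "?F face_of P" using assms(2) by (simp add: edge_of_def)
  then have "?F exposed_face_of P"
    using exposed_face_of_polyhedron polytope_imp_polyhedron assms(1) by blast
  then obtain a b where ab: "P \<subseteq> {x. a \<bullet> x \<le> b}" "?F = P \<inter> {x. a \<bullet> x = b}"
    unfolding exposed_face_of_def by blast
  have uvF: "u \<in> ?F" "v \<in> ?F" by auto
  then have uv: "u \<in> P" "v \<in> P" "a \<bullet> u = b" "a \<bullet> v = b" using ab by blast+
  define D where "D = v - u"
  have "D \<noteq> 0" using assms(3) by (simp add: D_def)
  then have D: "0 < D \<bullet> D" "a \<bullet> D = 0" using uv by (simp, simp add: D_def inner_diff)
  define \<sigma> :: real where "\<sigma> = (if 0 < cross2 D a then - 1 else 1)"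
  have "0 < \<sigma> * cross2 D (x - u)" if "x extreme_point_of P" "x \<noteq> u" "x \<noteq> v" for x
  proof -
    have "x \<in> P" "x \<notin> ?F"
      using that uv unfolding extreme_point_of_def by (auto simp: open_segment_def)
    then have "a \<bullet> x < b" using ab by force
    then have "(D \<bullet> D) * (a \<bullet> (x - u)) < 0" using D uv by (simp add: inner_diff mult_less_0_iff)
    then have "cross2 D a * cross2 D (x - u) < 0" using inner_cross2[of D a "x - u"] D by simp
    then show ?thesis by (auto simp: \<sigma>_def mult_less_0_iff simp del: cross2_diff)
  qed
  then show ?thesis unfolding D_def by (intro exI[of _ \<sigma>]) (auto simp: \<sigma>_def)
qed

lemma mod_add_inj:
  fixes i k l n :: nat
  assumes "(i + k) mod n = (i + l) mod n" "k < n" "l < n"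
  shows "k = l"
proof -
  have *: "k = l" if "(i + k) mod n = (i + l) mod n" "k \<le> l" "l < n" for k l
  proof -
    have "n dvd (i + l) - (i + k)"
      using that by (metis add_le_cancel_left mod_eq_dvd_iff_nat)
    then have "n dvd l - k" by simp
    then have "l - k = 0" using that by (metis dvd_imp_le gr0I leD less_imp_diff_less)
    then show ?thesis using that by simp
  qed
  show ?thesis using *[of k l] *[of l k] assms by (metis nat_le_linear)
qed

lemma sum_Basis_vec: "(\<Sum>Basis :: real^'n) = 1"
proof -
  have "(\<Sum>Basis :: real^'n) $ i = 1" for i
    unfolding cart_eq_inner_axis by (rule inner_sum_Basis) (simp add: axis_in_Basis_iff)
  then show ?thesis by (simp add: vec_eq_iff)
qed

lemma polygon_oriented:
  assumes poly: "convex_polygon P vs"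
  obtains s where "oriented_polygon (\<lambda>i. vs ! (i mod length vs)) (length vs) s"
    "oriented_polygon.region (\<lambda>i. vs ! (i mod length vs)) (length vs) s = P"
proof -
  define n where "n = length vs"
  define V where "V i = vs ! (i mod n)" for i
  have P: "polytope P" "aff_dim P = 2" "distinct vs" "set vs = {x. x extreme_point_of P}"
    and edges: "\<And>i. i < n \<Longrightarrow> closed_segment (vs ! i) (vs ! (Suc i mod n)) edge_of P"
    using poly by (auto simp: convex_polygon_def n_def)
  have hull: "P = convex hull (set vs)"
    using Krein_Milman_Minkowski[of P] P polytope_imp_compact polytope_imp_convex by auto
  have "2 \<le> int (card (set vs)) - 1"
    using aff_dim_le_card[of "set vs"] P hull by (metis List.finite_set aff_dim_convex_hull)
  then have n3: "3 \<le> n" using distinct_card[OF P(3)] unfolding n_def by linarith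
  have lt: "i mod length vs < length vs" for i using n3 by (intro mod_less_divisor) (auto simp: n_def)
  have V_set: "V i \<in> set vs" for i unfolding V_def n_def using lt by (rule nth_mem)
  have V_eq: "V i = V j \<longleftrightarrow> i mod n = j mod n" for i j
    unfolding V_def using P(3) n3 by (intro nth_eq_iff_index_eq) (auto simp: n_def lt)
  have shift: "V (i + k) \<noteq> V (i + l)" if "k < n" "l < n" "k \<noteq> l" for i k l
    using mod_add_inj that unfolding V_eq by blast
  have Suc_neq: "V (Suc i) \<noteq> V i" for i using shift[of 1 0 i] n3 by simp
  have "\<exists>\<sigma>. (\<sigma> = 1 \<or> \<sigma> = - 1) \<and>
    (\<forall>k. V k \<noteq> V i \<longrightarrow> V k \<noteq> V (Suc i) \<longrightarrow> 0 < \<sigma> * cross2 (V (Suc i) - V i) (V k - V i))" for i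
  proof -
    have "closed_segment (V i) (V (Suc i)) edge_of P"
      using edges[of "i mod n"] n3 by (simp add: V_def mod_Suc_eq)
    then show ?thesis
      using exposed_edge_side[of P "V i" "V (Suc i)"] P Suc_neq V_set by (metis mem_Collect_eq)
  qed
  then obtain \<sigma> :: "nat \<Rightarrow> real" where \<sigma>: "\<And>i. \<sigma> i = 1 \<or> \<sigma> i = - 1"
    "\<And>i k. V k \<noteq> V i \<Longrightarrow> V k \<noteq> V (Suc i) \<Longrightarrow> 0 < \<sigma> i * cross2 (V (Suc i) - V i) (V k - V i)"
    by metis
  \<comment> \<open>Consecutive edges are compared on their common triangle: its signed area is
    tested once from each edge, so both carry the same sign.\<close>
  have "\<sigma> (Suc i) = \<sigma> i" for i
  proof -
    have "0 < \<sigma> i * cross2 (V (Suc i) - V i) (V (Suc (Suc i)) - V i)"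
      using shift[of 2 0 i] Suc_neq[of "Suc i"] n3 by (intro \<sigma>) auto
    moreover have "0 < \<sigma> (Suc i) * cross2 (V (Suc (Suc i)) - V (Suc i)) (V i - V (Suc i))"
      using shift[of 0 2 i] shift[of 0 1 i] n3 by (intro \<sigma>) auto
    then have "0 < \<sigma> (Suc i) * cross2 (V (Suc i) - V i) (V (Suc (Suc i)) - V i)"
      by (simp only: cross2_rotate)
    ultimately show ?thesis using \<sigma>(1)[of i] \<sigma>(1)[of "Suc i"] by (auto simp del: cross2_diff)
  qed
  then have const: "\<sigma> i = \<sigma> 0" for i by (induction i) auto
  have or: "oriented_polygon V n (\<sigma> 0)"
  proof
    show "V (i + n) = V i" for i by (simp add: V_def)
    show "0 < \<sigma> 0 * cross2 (V (Suc i) - V i) (V (i + m) - V i)" if "2 \<le> m" "m < n" for i m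
      using \<sigma>(2)[of "i + m" i] shift[of m 0 i] shift[of m 1 i] that n3 const[of i] by auto
  qed (rule n3)
  have "V ` {..<n} = set vs" by (auto simp: V_def n_def set_conv_nth image_iff) 
  then have "oriented_polygon.region V n (\<sigma> 0) = P"
    using oriented_polygon.region_eq_hull[OF or] hull by simp
  with or show thesis using that[of "\<sigma> 0"] unfolding V_def n_def by blast
qed

lemma Basis_real2: "(Basis :: (real^2) set) = {axis 1 1, axis 2 1}"
  by (auto simp: Basis_vec_def UNIV_2)

text \<open>The unit square is the hull of its four corners, and affine maps commute with hulls. The
  area then comes from the determinant of the linear part, which is the cross product of the
  sides.\<close>

lemma parallelogram_hull:
  fixes a p q :: "real^2"
  shows "convex hull {a, a + p, a + p + q, a + q} = (+) a ` (\<lambda>y :: real^2. y $ 1 *\<^sub>R p + y $ 2 *\<^sub>R q) ` cbox 0 1"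
proof -
  let ?f = "\<lambda>y :: real^2. y $ 1 *\<^sub>R p + y $ 2 *\<^sub>R q"
  have lin: "linear ?f" by (intro linearI) (auto simp: algebra_simps)
  have verts: "{x :: real^2. \<forall>i\<in>Basis. x \<bullet> i = 0 \<or> x \<bullet> i = 1} = {0, axis 1 1, 1, axis 2 1}"
  proof -
    have "{x :: real^2. \<forall>i\<in>Basis. x \<bullet> i = 0 \<or> x \<bullet> i = 1} =
        {x. (x $ 1 = 0 \<or> x $ 1 = 1) \<and> (x $ 2 = 0 \<or> x $ 2 = 1)}"
      by (simp add: Basis_real2 cart_eq_inner_axis[symmetric])
    also have "\<dots> = {0, axis 1 1, 1, axis 2 1}"
      by (auto simp: vec2_eq_iff axis_def)
    finally show ?thesis .
  qed
  have "cbox 0 1 = convex hull {0, axis 1 1, 1, axis 2 1 :: real^2}"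
    using unit_interval_convex_hull[where 'a = "real^2"] unfolding verts sum_Basis_vec .
  then have "?f ` cbox 0 1 = convex hull (?f ` {0, axis 1 1, 1, axis 2 1 :: real^2})"
    using convex_hull_linear_image[OF lin] by simp
  also have "?f ` {0, axis 1 1, 1, axis 2 1 :: real^2} = {0, p, p + q, q}"
    by (simp add: axis_def)
  finally have "(+) a ` ?f ` cbox 0 1 = convex hull ((+) a ` {0, p, p + q, q})"
    by (simp only: convex_hull_translation)
  then show ?thesis by (simp add: add.assoc)
qed

lemma area_parallelogram:
  assumes "c - d = b - a"
  shows "area (convex hull {a, b, c, d}) = \<bar>cross2 (b - a) (d - a)\<bar>"
proof -
  define p q where "p = b - a" and "q = d - a"
  let ?f = "\<lambda>y :: real^2. y $ 1 *\<^sub>R p + y $ 2 *\<^sub>R q"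
  have "b = a + p" "d = a + q" "c = a + p + q"
    using assms by (simp_all add: p_def q_def algebra_simps)
  then have hull: "convex hull {a, b, c, d} = (+) a ` ?f ` cbox 0 1"
    by (simp only: parallelogram_hull)
  have lin: "linear ?f" by (intro linearI) (auto simp: algebra_simps)
  moreover have "\<bar>det (matrix ?f)\<bar> = \<bar>cross2 p q\<bar>"
    by (simp add: det_2 matrix_def cross2_def axis_def algebra_simps)
  moreover have "measure lebesgue (cbox 0 1 :: (real^2) set) = 1"
    using content_unit[where 'a = "real^2"] unfolding sum_Basis_vec by simp
  ultimately show ?thesis
    unfolding area_def p_def[symmetric] q_def[symmetric] hull measure_translation
    by (simp add: measure_linear_image[OF lin])
qed

lemma optimal_rect_exists:
  assumes "compact P" "convex P" "aff_dim P = 2"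
  obtains a b c d where "rect_in P a b c d" "0 < sqarea a b d"
    "\<And>a' b' c' d'. rect_in P a' b' c' d' \<Longrightarrow> sqarea a' b' d' \<le> sqarea a b d"
proof -
  let ?K = "{(a, b, c, d). rect_in P a b c d}" and ?f = "\<lambda>(a, b, c, d). sqarea a b d"
  have "interior P \<noteq> {}"
    using interior_rel_interior_gen[of P] rel_interior_eq_empty[OF assms(2)] assms(3) by auto
  then obtain x e where "0 < e" "ball x e \<subseteq> P" using mem_interior by blast
  then have e: "0 < e" and ball: "\<And>y. norm y < e \<Longrightarrow> x + y \<in> P"
    by (auto simp: dist_norm)
  \<comment> \<open>A square with side \<open>e / 3\<close> and corner \<open>x\<close> fits into
    the ball of radius \<open>e\<close>, its diagonal being at most \<open>2 * e / 3\<close>. It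
    shows that the maximum is positive.\<close>
  define u v :: "real^2" where "u = (e / 3) *\<^sub>R axis 1 1" and "v = (e / 3) *\<^sub>R axis 2 1"
  have norms: "norm u = e / 3" "norm v = e / 3" using e by (simp_all add: u_def v_def norm_Basis axis_in_Basis_iff)
  have "norm (u + v) \<le> norm u + norm v" by (rule norm_triangle_ineq)
  then have norm_uv: "norm (u + v) < e" using norms e by simp
  have rect: "rect_in P x (x + u) (x + (u + v)) (x + v)"
    unfolding rect_in_def using ball[of 0] ball[of u] ball[of v] ball[OF norm_uv] norms e
    by (simp add: u_def v_def inner_axis_axis)
  have pos: "0 < sqarea x (x + u) (x + v)"
    using e by (simp add: sqarea_def cross2_def u_def v_def axis_def del: cross2_diff)
  have eq: "?K = (P \<times> P \<times> P \<times> P) \<inter>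
      ({y. fst (snd (snd y)) - snd (snd (snd y)) = fst (snd y) - fst y} \<inter>
       {y. (fst (snd y) - fst y) \<bullet> (snd (snd (snd y)) - fst y) = 0})"
    by (auto simp: rect_in_def)
  have "compact ?K"
    unfolding eq
    by (intro compact_Int_closed compact_Times assms closed_Int closed_Collect_eq continuous_intros)
  moreover have "?K \<noteq> {}" using rect by blast
  moreover have "continuous_on ?K ?f"
    unfolding sqarea_def case_prod_unfold by (intro continuous_intros)
  ultimately have "\<exists>y\<in>?K. \<forall>z\<in>?K. ?f z \<le> ?f y" by (rule continuous_attains_sup)
  then obtain a b c d where "rect_in P a b c d"
      "\<And>a' b' c' d'. rect_in P a' b' c' d' \<Longrightarrow> sqarea a' b' d' \<le> sqarea a b d"
    by fastforce
  moreover from this rect pos have "0 < sqarea a b d" by (meson less_le_trans)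
  ultimately show thesis using that by blast
qed

lemma max_area_rectangleI:
  assumes "convex P" "rect_in P a b c d" "0 < sqarea a b d"
    and max: "\<And>a' b' c' d'. rect_in P a' b' c' d' \<Longrightarrow> sqarea a' b' d' \<le> sqarea a b d"
  shows "rect_corners a b c d \<and> max_area_rectangle_in P (convex hull {a, b, c, d})"
proof
  have "a \<noteq> b" "a \<noteq> d" using assms(3) by (auto simp: sqarea_def)
  then show rc: "rect_corners a b c d"
    using assms(2) by (simp add: rect_corners_def rect_in_def orthogonal_def)
  have "convex hull {a, b, c, d} \<subseteq> P"
    using assms by (intro hull_minimal) (auto simp: rect_in_def)
  moreover have "area R' \<le> area (convex hull {a, b, c, d})" if rR: "rectangle R'" "R' \<subseteq> P" for R'
  proof -
    obtain a' b' c' d' where R': "rect_corners a' b' c' d'" "R' = convex hull {a', b', c', d'}"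
      using rR(1) unfolding rectangle_def by blast
    have "{a', b', c', d'} \<subseteq> P" using rR(2) unfolding R'(2) by (rule order.trans[OF hull_subset])
    then have "rect_in P a' b' c' d'"
      using R' by (auto simp: rect_in_def rect_corners_def orthogonal_def)
    then have "(cross2 (b' - a') (d' - a'))\<^sup>2 \<le> (cross2 (b - a) (d - a))\<^sup>2"
      using max unfolding sqarea_def by blast
    then have "\<bar>cross2 (b' - a') (d' - a')\<bar> \<le> \<bar>cross2 (b - a) (d - a)\<bar>"
      by (simp only: abs_le_square_iff)
    moreover have "c' - d' = b' - a'" "c - d = b - a"
      using R' assms(2) by (auto simp: rect_corners_def rect_in_def)
    ultimately show ?thesis unfolding R'(2) by (simp only: area_parallelogram)
  qed
  ultimately show "max_area_rectangle_in P (convex hull {a, b, c, d})"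
    using rc unfolding max_area_rectangle_in_def rectangle_def by blast
qed

section \<open>Cost and effect of programs\<close>

text \<open>A total-correctness triple with a time bound; nesting it in the postcondition composes
  programs.\<close>

definition runs :: "solver \<Rightarrow> com \<Rightarrow> store \<Rightarrow> nat \<Rightarrow> (store \<Rightarrow> bool) \<Rightarrow> bool" where
  "runs \<sigma> c s T Q \<longleftrightarrow> (\<exists>t s'. exec \<sigma> c s t s' \<and> t \<le> T \<and> Q s')"

lemma runs_mono:
  assumes "runs \<sigma> c s T Q" "T \<le> T'" "\<And>s'. Q s' \<Longrightarrow> Q' s'"
  shows "runs \<sigma> c s T' Q'"
  using assms unfolding runs_def by (meson order.trans)

lemma runs_Seq:
  assumes "runs \<sigma> c s T (\<lambda>s'. runs \<sigma> d s' T' Q)"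
  shows "runs \<sigma> (Seq c d) s (T + T') Q"
  using assms unfolding runs_def by (meson add_mono exec.Seq)

lemma runs_Cond:
  assumes "bval b s \<Longrightarrow> runs \<sigma> c s T Q" "\<not> bval b s \<Longrightarrow> runs \<sigma> d s T Q"
  shows "runs \<sigma> (Cond b c d) s (1 + bcost b + T) Q"
proof (cases "bval b s")
  case True
  then show ?thesis using assms(1) unfolding runs_def by (meson add_left_mono exec.CondTrue)
next
  case False
  then show ?thesis using assms(2) unfolding runs_def by (meson add_left_mono exec.CondFalse)
qed

primrec straight :: "com \<Rightarrow> bool" where
  "straight Skip \<longleftrightarrow> True"
| "straight (NWrite a e) \<longleftrightarrow> True"
| "straight (RWrite a e) \<longleftrightarrow> True"
| "straight (Maximize f a k obj cs) \<longleftrightarrow> True"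
| "straight (Seq c d) \<longleftrightarrow> straight c \<and> straight d"
| "straight (Cond b c d) \<longleftrightarrow> straight c \<and> straight d"
| "straight (While b c) \<longleftrightarrow> False"

text \<open>An upper bound independent of the store: a conditional pays for both branches. The value
  at \<open>While\<close> is a dummy, as \<open>straight\<close> excludes loops.\<close>

primrec cost :: "com \<Rightarrow> nat" where
  "cost Skip = 1"
| "cost (NWrite a e) = 1 + ncost a + ncost e"
| "cost (RWrite a e) = 1 + ncost a + rcost e"
| "cost (Maximize f a k obj cs) = 1 + ncost f + ncost a + k + pcost obj + sum_list (map pcost cs)"
| "cost (Seq c d) = cost c + cost d"
| "cost (Cond b c d) = 1 + bcost b + (cost c + cost d)"
| "cost (While b c) = 0"

primrec effect :: "solver \<Rightarrow> com \<Rightarrow> store \<Rightarrow> store" where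
  "effect \<sigma> Skip s = s"
| "effect \<sigma> (NWrite a e) s = s\<lparr>nmem := (nmem s)(nval a s := nval e s)\<rparr>"
| "effect \<sigma> (RWrite a e) s = s\<lparr>rmem := (rmem s)(nval a s := rval e s)\<rparr>"
| "effect \<sigma> (Maximize f a k obj cs) s = maximize \<sigma> (nval f s) (nval a s) k obj cs s"
| "effect \<sigma> (Seq c d) s = effect \<sigma> d (effect \<sigma> c s)"
| "effect \<sigma> (Cond b c d) s = (if bval b s then effect \<sigma> c s else effect \<sigma> d s)"
| "effect \<sigma> (While b c) s = s"

lemma exec_straight:
  "straight c \<Longrightarrow> \<exists>t \<le> cost c. exec \<sigma> c s t (effect \<sigma> c s)"
proof (induction c arbitrary: s)
  case (Seq c d)
  then obtain t t' where "t \<le> cost c" "exec \<sigma> c s t (effect \<sigma> c s)"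
      "t' \<le> cost d" "exec \<sigma> d (effect \<sigma> c s) t' (effect \<sigma> d (effect \<sigma> c s))"
    by (metis straight.simps(5))
  then show ?case by (auto intro!: exI[of _ "t + t'"] exec.Seq)
next
  case (Cond b c d)
  obtain t where "t \<le> cost c" "exec \<sigma> c s t (effect \<sigma> c s)" using Cond by auto
  moreover obtain t' where "t' \<le> cost d" "exec \<sigma> d s t' (effect \<sigma> d s)" using Cond by auto
  ultimately show ?case
  proof (cases "bval b s")
    case True
    then have "exec \<sigma> (Cond b c d) s (1 + bcost b + t) (effect \<sigma> (Cond b c d) s)"
      using exec.CondTrue \<open>exec \<sigma> c s t _\<close> by simp
    then show ?thesis using \<open>t \<le> cost c\<close> by (intro exI[of _ "1 + bcost b + t"]) simp
  next
    case False
    then have "exec \<sigma> (Cond b c d) s (1 + bcost b + t') (effect \<sigma> (Cond b c d) s)"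
      using exec.CondFalse \<open>exec \<sigma> d s t' _\<close> by simp
    then show ?thesis using \<open>t' \<le> cost d\<close> by (intro exI[of _ "1 + bcost b + t'"]) simp
  qed
next
  case Skip
  show ?case using exec.Skip[of \<sigma> s] by auto
next
  case (NWrite a e)
  show ?case using exec.NWrite[of \<sigma> a e s] by auto
next
  case (RWrite a e)
  show ?case using exec.RWrite[of \<sigma> a e s] by auto
next
  case (Maximize f a k obj cs)
  show ?case using exec.Maximize[of \<sigma> f a k obj cs s] by auto
qed simp

lemma runs_straight: "straight c \<Longrightarrow> Q (effect \<sigma> c s) \<Longrightarrow> runs \<sigma> c s (cost c) Q"
  unfolding runs_def using exec_straight by blast

definition For :: "nat \<Rightarrow> com \<Rightarrow> com" where
  "For c body = Seq (NWrite (NConst c) (NConst 0))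
     (While (NLess (NRead (NConst c)) (NRead (NConst 0)))
       (Seq body (NWrite (NConst c) (NAdd (NRead (NConst c)) (NConst 1)))))"

text \<open>\<open>J\<close> is the invariant. \<open>D\<close> is a goal that persists once reached
  and is reached by any iteration \<open>m\<close> with \<open>hit m\<close>, so one successful
  iteration suffices. The 9 consists of 3 for initialization and 6 for the last test; each iteration
  pays 6 for its test and 6 for the increment.\<close>

lemma runs_For:
  assumes body: "\<And>m s. m < n \<Longrightarrow> J s \<Longrightarrow> nmem s c = m \<Longrightarrow>
      runs \<sigma> body s (B m) (\<lambda>s'. J s' \<and> nmem s' c = m \<and> (D s \<or> hit m \<longrightarrow> D s'))"
    and J: "\<And>s v. J s \<Longrightarrow> J (s\<lparr>nmem := (nmem s)(c := v)\<rparr>)"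
    and D: "\<And>s v. D (s\<lparr>nmem := (nmem s)(c := v)\<rparr>) \<longleftrightarrow> D s"
    and n: "\<And>s. J s \<Longrightarrow> nmem s 0 = n"
    and start: "J s"
  shows "runs \<sigma> (For c body) s (9 + (\<Sum>m<n. B m + 12))
           (\<lambda>s'. J s' \<and> (D s \<or> (\<exists>m<n. hit m) \<longrightarrow> D s'))"
proof -
  let ?inc = "NWrite (NConst c) (NAdd (NRead (NConst c)) (NConst 1))"
  let ?b = "NLess (NRead (NConst c)) (NRead (NConst 0))"
  have loop: "runs \<sigma> (While ?b (Seq body ?inc)) s (6 + (\<Sum>m\<in>{k..<n}. B m + 12))
      (\<lambda>s'. J s' \<and> (D s \<or> (\<exists>m\<in>{k..<n}. hit m) \<longrightarrow> D s'))"
    if "J s" "nmem s c = k" "k \<le> n" for s k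
    using that
  proof (induction "n - k" arbitrary: s k)
    case 0
    then have "\<not> bval ?b s" using n[OF 0(2)] by simp
    then have "exec \<sigma> (While ?b (Seq body ?inc)) s (1 + bcost ?b) s" by (rule exec.WhileFalse)
    then show ?case unfolding runs_def using 0 by (intro exI[of _ "1 + bcost ?b"] exI[of _ s]) auto
  next
    case (Suc l)
    then have k: "k < n" and b: "bval ?b s" using n[OF Suc(3)] by simp_all
    obtain t1 s1 where 1: "exec \<sigma> body s t1 s1" "t1 \<le> B k" "J s1" "nmem s1 c = k" "D s \<or> hit k \<longrightarrow> D s1"
      using body[OF k Suc(3,4)] unfolding runs_def by blast
    define s2 where "s2 = s1\<lparr>nmem := (nmem s1)(c := Suc k)\<rparr>"
    have "exec \<sigma> ?inc s1 6 s2" using exec.NWrite[of \<sigma> "NConst c" "NAdd (NRead (NConst c)) (NConst 1)" s1] 1(4)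
      by (simp add: s2_def numeral_eq_Suc)
    with 1(1) have step: "exec \<sigma> (Seq body ?inc) s (t1 + 6) s2" by (rule exec.Seq)
    have J2: "J s2" unfolding s2_def by (rule J) (rule 1(3))
    have D2: "D s2 \<longleftrightarrow> D s1" unfolding s2_def by (rule D)
    have "runs \<sigma> (While ?b (Seq body ?inc)) s2 (6 + (\<Sum>m\<in>{Suc k..<n}. B m + 12))
        (\<lambda>s'. J s' \<and> (D s2 \<or> (\<exists>m\<in>{Suc k..<n}. hit m) \<longrightarrow> D s'))"
      using Suc(2) k J2 by (intro Suc(1)) (auto simp: s2_def)
    then obtain t3 s3 where 3: "exec \<sigma> (While ?b (Seq body ?inc)) s2 t3 s3" "t3 \<le> 6 + (\<Sum>m\<in>{Suc k..<n}. B m + 12)"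
        "J s3" "D s2 \<or> (\<exists>m\<in>{Suc k..<n}. hit m) \<longrightarrow> D s3"
      unfolding runs_def by blast
    have "exec \<sigma> (While ?b (Seq body ?inc)) s (1 + bcost ?b + (t1 + 6) + t3) s3"
      by (rule exec.WhileTrue[OF b step 3(1)])
    moreover have "1 + bcost ?b + (t1 + 6) + t3 \<le> 6 + (\<Sum>m\<in>{k..<n}. B m + 12)"
      using 1(2) 3(2) k by (simp add: sum.atLeast_Suc_lessThan)
    moreover have "D s \<or> (\<exists>m\<in>{k..<n}. hit m) \<longrightarrow> D s3"
      using 1(5) 3(4) D2 by (metis Suc_leI atLeastLessThan_iff le_neq_implies_less)
    ultimately show ?case unfolding runs_def using 3(3) by blast
  qed
  define s0 where "s0 = s\<lparr>nmem := (nmem s)(c := 0)\<rparr>"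
  have "runs \<sigma> (For c body) s (3 + (6 + (\<Sum>m\<in>{0..<n}. B m + 12)))
      (\<lambda>s'. J s' \<and> (D s0 \<or> (\<exists>m\<in>{0..<n}. hit m) \<longrightarrow> D s'))"
    unfolding For_def
  proof (rule runs_Seq)
    have "runs \<sigma> (While ?b (Seq body ?inc)) s0 (6 + (\<Sum>m\<in>{0..<n}. B m + 12))
        (\<lambda>s'. J s' \<and> (D s0 \<or> (\<exists>m\<in>{0..<n}. hit m) \<longrightarrow> D s'))"
      using J[OF start] by (intro loop) (auto simp: s0_def)
    then show "runs \<sigma> (NWrite (NConst c) (NConst 0)) s 3 (\<lambda>s'. runs \<sigma> (While ?b (Seq body ?inc)) s'
        (6 + (\<Sum>m\<in>{0..<n}. B m + 12)) (\<lambda>s'. J s' \<and> (D s0 \<or> (\<exists>m\<in>{0..<n}. hit m) \<longrightarrow> D s')))"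
      using runs_straight[of "NWrite (NConst c) (NConst 0)" _ \<sigma> s] by (simp add: s0_def numeral_3_eq_3)
  qed
  then show ?thesis
    by (rule runs_mono) (auto simp: s0_def D atLeast0LessThan lessThan_def)
qed


section \<open>The algorithm\<close>

text \<open>
  The loop counters \<open>p\<close>, \<open>i\<close>, \<open>j\<close>, \<open>k\<close> are the natural cells 1 to 4, cell 5 is the flag of \<open>Maximize\<close>.
  In the real memory, the first two vertices are repeated in \<open>cell 0\<close> to \<open>cell 3\<close>, so that indices need
  not be reduced modulo \<open>n\<close>; \<open>cell 4\<close> is the best squared area so far, \<open>cell 5\<close> to \<open>cell 12\<close> are the
  corners that attain it, and \<open>cell 13\<close> to \<open>cell 20\<close> are those of the current candidate.
\<close>

definition cell :: "nat \<Rightarrow> nexp" where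
  "cell m = NAdd (NAdd (NRead (NConst 0)) (NRead (NConst 0))) (NConst m)"

definition vtx :: "nat \<Rightarrow> nat \<Rightarrow> rexp" where
  "vtx r m = RRead (NAdd (NAdd (NRead (NConst r)) (NRead (NConst r))) (NConst m))"

fun seqs :: "com list \<Rightarrow> com" where
  "seqs [] = Skip"
| "seqs (c # cs) = Seq c (seqs cs)"

lemma straight_seqs [simp]: "straight (seqs cs) \<longleftrightarrow> (\<forall>c\<in>set cs. straight c)"
  by (induction cs) simp_all

text \<open>Targets avoid all sources and are pairwise distinct, so a sequential copy acts like a
  simultaneous one.\<close>

lemma effect_copy:
  fixes \<sigma> :: solver and s :: store
  assumes "\<And>m t. nmem t = nmem s \<Longrightarrow> nval (dst m) t = D m" "\<And>m t. nmem t = nmem s \<Longrightarrow> nval (src m) t = E m"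
    and "\<And>m m'. m \<in> set xs \<Longrightarrow> m' \<in> set xs \<Longrightarrow> D m \<noteq> E m'" "inj_on D (set xs)" "distinct xs"
  defines "s' \<equiv> effect \<sigma> (seqs (map (\<lambda>m. RWrite (dst m) (RRead (src m))) xs)) s"
  shows "nmem s' = nmem s" "m \<in> set xs \<Longrightarrow> rmem s' (D m) = rmem s (E m)"
    "a \<notin> D ` set xs \<Longrightarrow> rmem s' a = rmem s a"
proof -
  have "nmem s' = nmem s \<and> (\<forall>m\<in>set xs. rmem s' (D m) = rmem s (E m)) \<and> (\<forall>a. a \<notin> D ` set xs \<longrightarrow> rmem s' a = rmem s a)"
    using assms(1-5) unfolding s'_def
  proof (induction xs arbitrary: s)
    case (Cons x xs)
    let ?t = "s\<lparr>rmem := (rmem s)(D x := rmem s (E x))\<rparr>"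
    let ?u = "effect \<sigma> (seqs (map (\<lambda>m. RWrite (dst m) (RRead (src m))) xs)) ?t"
    have u: "nmem ?u = nmem ?t \<and> (\<forall>m\<in>set xs. rmem ?u (D m) = rmem ?t (E m)) \<and>
        (\<forall>a. a \<notin> D ` set xs \<longrightarrow> rmem ?u a = rmem ?t a)"
      using Cons.prems by (intro Cons.IH) auto
    have "E m \<noteq> D x" if "m \<in> set xs" for m using Cons.prems(3)[of x m] that by auto
    moreover have "D x \<notin> D ` set xs" using Cons.prems(4,5) by auto
    moreover have "effect \<sigma> (seqs (map (\<lambda>m. RWrite (dst m) (RRead (src m))) (x # xs))) s = ?u"
      using Cons.prems(1,2)[of s] by simp
    ultimately show ?case using u by auto
  qed simp
  then show "nmem s' = nmem s" "m \<in> set xs \<Longrightarrow> rmem s' (D m) = rmem s (E m)"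
    "a \<notin> D ` set xs \<Longrightarrow> rmem s' a = rmem s a" by auto
qed

definition psub :: "pexp \<Rightarrow> pexp \<Rightarrow> pexp" where
  "psub p q = PAdd p (PMul (PCoeff (RConst (- 1))) q)"

definition peq :: "pexp \<Rightarrow> pexp \<Rightarrow> pexp list" where
  "peq p q = [psub p q, psub q p]"

lemma pval_psub [simp]: "pval (psub p q) s x = pval p s x - pval q s x"
  by (simp add: psub_def)

text \<open>
  Point \<open>l\<close> of the optimization problem has the coordinates \<open>PVar (2 * l)\<close> and \<open>PVar (2 * l + 1)\<close>;
  \<open>PVar (2 * l + 8)\<close> and \<open>PVar (2 * l + 9)\<close> are its coefficients with respect to the sides of a
  triangle at vertex \<open>p + 1\<close>, where \<open>p\<close> is in cell 1.
\<close>

definition coord_in_triangle :: "nat \<Rightarrow> nat \<Rightarrow> rexp \<Rightarrow> rexp \<Rightarrow> pexp list" where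
  "coord_in_triangle l e q r =
     (let z = vtx 1 (2 + e); u = PVar (2 * l + 8); v = PVar (2 * l + 9)
      in peq (PVar (2 * l + e))
           (PAdd (PCoeff z) (PAdd (PMul u (PCoeff (RSub q z))) (PMul v (PCoeff (RSub r z))))))"

text \<open>\<open>c\<close> is the cell of a loop counter, and \<open>m\<close>, \<open>m'\<close>
  are offsets in real cells, two per vertex: 0, 2 and 4 mean the vertex of the counter, its
  successor and the next one. Explicit coefficients make membership in a triangle
  polynomial.\<close>

definition in_triangle :: "nat \<Rightarrow> nat \<Rightarrow> nat \<Rightarrow> nat \<Rightarrow> pexp list" where
  "in_triangle l c m m' =
     [PVar (2 * l + 8), PVar (2 * l + 9),
      psub (PCoeff (RConst 1)) (PAdd (PVar (2 * l + 8)) (PVar (2 * l + 9)))] @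
     coord_in_triangle l 0 (vtx c m) (vtx c m') @ coord_in_triangle l 1 (vtx c (m + 1)) (vtx c (m' + 1))"

definition dotp :: "nat \<Rightarrow> nat \<Rightarrow> nat \<Rightarrow> nat \<Rightarrow> pexp" where
  "dotp i j k l = PAdd (PMul (psub (PVar (2 * i)) (PVar (2 * j))) (psub (PVar (2 * k)) (PVar (2 * l))))
     (PMul (psub (PVar (2 * i + 1)) (PVar (2 * j + 1))) (psub (PVar (2 * k + 1)) (PVar (2 * l + 1))))"

definition crossp :: pexp where
  "crossp = psub (PMul (psub (PVar 2) (PVar 0)) (psub (PVar 7) (PVar 1)))
     (PMul (psub (PVar 3) (PVar 1)) (psub (PVar 6) (PVar 0)))"

text \<open>Points 0 to 3 are the corners a, b, c, d. Their triangles use the counters in cells 1,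
  2, 4, 3: the opposite corner c belongs to the innermost counter k, so that i and j can be tested
  before it starts.\<close>

definition constraints :: "pexp list" where
  "constraints = in_triangle 0 1 0 4 @ in_triangle 1 2 0 2 @ in_triangle 2 4 0 2 @ in_triangle 3 3 0 2 @
     peq (psub (PVar 4) (PVar 6)) (psub (PVar 2) (PVar 0)) @
     peq (psub (PVar 5) (PVar 7)) (psub (PVar 3) (PVar 1)) @
     peq (dotp 1 0 3 0) (PCoeff (RConst 0))"

definition cand :: "nat \<Rightarrow> rexp" where
  "cand m = RRead (cell (13 + m))"

definition cand_cross :: rexp where
  "cand_cross = RSub (RMul (RSub (cand 2) (cand 0)) (RSub (cand 7) (cand 1)))
     (RMul (RSub (cand 3) (cand 1)) (RSub (cand 6) (cand 0)))"

definition save :: com where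
  "save = seqs (RWrite (cell 4) (RMul cand_cross cand_cross) #
     map (\<lambda>m. RWrite (cell (5 + m)) (cand m)) [0..<8])"

definition solve_and_save :: com where
  "solve_and_save = Seq (Maximize (NConst 5) (cell 13) 8 (PMul crossp crossp) constraints)
     (Cond (BAnd (NLess (NConst 0) (NRead (NConst 5))) (RLess (RRead (cell 4)) (RMul cand_cross cand_cross)))
       save Skip)"

definition dot_test :: "nat \<Rightarrow> nat \<Rightarrow> rexp" where
  "dot_test a b = RAdd (RMul (RSub (vtx 2 a) (vtx 1 2)) (RSub (vtx 3 b) (vtx 1 2)))
     (RMul (RSub (vtx 2 (a + 1)) (vtx 1 3)) (RSub (vtx 3 (b + 1)) (vtx 1 3)))"

definition all4 :: "(rexp \<Rightarrow> bexp) \<Rightarrow> bexp" where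
  "all4 f = BAnd (BAnd (f (dot_test 0 0)) (f (dot_test 0 2))) (BAnd (f (dot_test 2 0)) (f (dot_test 2 2)))"

definition pass_test :: bexp where
  "pass_test = BAnd (BNot (all4 (\<lambda>e. RLess (RConst 0) e))) (BNot (all4 (\<lambda>e. RLess e (RConst 0))))"

definition prologue :: com where
  "prologue = seqs (map (\<lambda>m. RWrite (cell m) (RRead (NConst m))) [0, 1, 2, 3])"

definition epilogue :: com where
  "epilogue = seqs (map (\<lambda>m. RWrite (NConst m) (RRead (cell (5 + m)))) [0..<8])"

definition search :: com where
  "search = For 1 (For 2 (For 3 (Cond pass_test (For 4 solve_and_save) Skip)))"

definition program :: com where
  "program = Seq prologue (Seq search epilogue)"

text \<open>The coefficients come from \<open>search_cost\<close>: 51 = 9 + 21 + 21 collects the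
  lower-order loop costs, 14 the overhead around a test, 13 is the bound of
  \<open>card_pass\<close>, and 21 = 9 + 12 is the overhead of the innermost loop.\<close>

definition run_time :: "nat \<Rightarrow> nat" where
  "run_time m = (cost prologue + cost epilogue + 51 + (bcost pass_test + 14) + 13 * (cost solve_and_save + 21)) * m ^ 3"


section \<open>Meaning of the memory contents, the test and the constraints\<close>

context oriented_polygon
begin

text \<open>Indices up to \<open>Suc n\<close> are required because vertex \<open>p + 2\<close> is
  read for every \<open>p < n\<close>.\<close>

definition vertices_ok :: "store \<Rightarrow> bool" where
  "vertices_ok s \<longleftrightarrow> nmem s 0 = n \<and> (\<forall>m\<le>Suc n. rmem s (m + m) = V m $ 1 \<and> rmem s (m + m + 1) = V m $ 2)"

definition point :: "(nat \<Rightarrow> real) \<Rightarrow> nat \<Rightarrow> real^2" where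
  "point x l = vector [x (2 * l), x (2 * l + 1)]"

lemma point_nth [simp]: "point x l $ 1 = x (2 * l)" "point x l $ 2 = x (2 * l + 1)"
  by (simp_all add: point_def)

lemma rval_vtx:
  assumes "vertices_ok s" "nmem s r = m"
  shows "m \<le> Suc n \<Longrightarrow> rval (vtx r 0) s = V m $ 1" "m \<le> Suc n \<Longrightarrow> rval (vtx r (Suc 0)) s = V m $ 2"
    "m \<le> n \<Longrightarrow> rval (vtx r 2) s = V (Suc m) $ 1" "m \<le> n \<Longrightarrow> rval (vtx r 3) s = V (Suc m) $ 2"
    "m < n \<Longrightarrow> rval (vtx r 4) s = V (Suc (Suc m)) $ 1" "m < n \<Longrightarrow> rval (vtx r 5) s = V (Suc (Suc m)) $ 2"
proof -
  have *: "rmem s (k + k) = V k $ 1" "rmem s (k + k + 1) = V k $ 2" if "k \<le> Suc n" for k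
    using assms(1) that by (auto simp: vertices_ok_def)
  show "m \<le> Suc n \<Longrightarrow> rval (vtx r 0) s = V m $ 1" "m \<le> Suc n \<Longrightarrow> rval (vtx r (Suc 0)) s = V m $ 2"
    using *[of m] assms(2) by (simp_all add: vtx_def)
  show "m \<le> n \<Longrightarrow> rval (vtx r 2) s = V (Suc m) $ 1" "m \<le> n \<Longrightarrow> rval (vtx r 3) s = V (Suc m) $ 2"
    using *[of "Suc m"] assms(2) by (simp_all add: vtx_def numeral_eq_Suc)
  show "m < n \<Longrightarrow> rval (vtx r 4) s = V (Suc (Suc m)) $ 1" "m < n \<Longrightarrow> rval (vtx r 5) s = V (Suc (Suc m)) $ 2"
    using *[of "Suc (Suc m)"] assms(2) by (simp_all add: vtx_def numeral_eq_Suc)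
qed

lemma bval_pass_test:
  assumes "vertices_ok s" "nmem s 1 = p" "nmem s 2 = i" "nmem s 3 = j" "p < n" "i < n" "j < n"
  shows "bval pass_test s \<longleftrightarrow> pass (Suc p) i j"
  using assms rval_vtx[OF assms(1,2)] rval_vtx[OF assms(1,3)] rval_vtx[OF assms(1,4)]
  by (simp add: pass_test_def all4_def dot_test_def pass_def inner_real2)

definition triangle_coeffs :: "(nat \<Rightarrow> real) \<Rightarrow> nat \<Rightarrow> real^2 \<Rightarrow> real^2 \<Rightarrow> real^2 \<Rightarrow> bool" where
  "triangle_coeffs x l z q r \<longleftrightarrow> 0 \<le> x (2 * l + 8) \<and> 0 \<le> x (2 * l + 9) \<and> x (2 * l + 8) + x (2 * l + 9) \<le> 1 \<and>
     point x l = z + x (2 * l + 8) *\<^sub>R (q - z) + x (2 * l + 9) *\<^sub>R (r - z)"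

lemma in_triangle_iff:
  assumes "rval (vtx 1 2) s = z $ 1" "rval (vtx 1 3) s = z $ 2"
    and "rval (vtx c m) s = q $ 1" "rval (vtx c (m + 1)) s = q $ 2"
    and "rval (vtx c m') s = r $ 1" "rval (vtx c (m' + 1)) s = r $ 2"
  shows "(\<forall>h\<in>set (in_triangle l c m m'). 0 \<le> pval h s x) \<longleftrightarrow> triangle_coeffs x l z q r"
  using assms
  by (auto simp: in_triangle_def coord_in_triangle_def Let_def peq_def triangle_coeffs_def vec2_eq_iff)

lemma in_triangle_vtx:
  assumes "vertices_ok s" "nmem s 1 = p" "nmem s c = m" "p < n" "m < n"
  shows "(\<forall>h\<in>set (in_triangle l c 0 2). 0 \<le> pval h s x) \<longleftrightarrow> triangle_coeffs x l (V (Suc p)) (V m) (V (Suc m))"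
    and "(\<forall>h\<in>set (in_triangle l c 0 4). 0 \<le> pval h s x) \<longleftrightarrow> triangle_coeffs x l (V (Suc p)) (V m) (V (Suc (Suc m)))"
  using assms rval_vtx[OF assms(1,2)] rval_vtx[OF assms(1,3)] by (intro in_triangle_iff; simp)+

definition tuple_rect :: "nat \<Rightarrow> nat \<Rightarrow> nat \<Rightarrow> nat \<Rightarrow> real^2 \<Rightarrow> real^2 \<Rightarrow> real^2 \<Rightarrow> real^2 \<Rightarrow> bool" where
  "tuple_rect p i j k a b c d \<longleftrightarrow>
     a \<in> convex hull {V (Suc p), V p, V (Suc (Suc p))} \<and>
     b \<in> convex hull {V (Suc p), V i, V (Suc i)} \<and>
     c \<in> convex hull {V (Suc p), V k, V (Suc k)} \<and>
     d \<in> convex hull {V (Suc p), V j, V (Suc j)} \<and>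
     c - d = b - a \<and> (b - a) \<bullet> (d - a) = 0"

lemma tuple_rect_in: "tuple_rect p i j k a b c d \<Longrightarrow> rect_in region a b c d"
  unfolding tuple_rect_def rect_in_def using hull3_subset_region by blast

lemma feasible_iff:
  assumes "vertices_ok s" "nmem s 1 = p" "nmem s 2 = i" "nmem s 3 = j" "nmem s 4 = k"
    and "p < n" "i < n" "j < n" "k < n"
  shows "x \<in> feasible constraints s \<longleftrightarrow>
     triangle_coeffs x 0 (V (Suc p)) (V p) (V (Suc (Suc p))) \<and> triangle_coeffs x 1 (V (Suc p)) (V i) (V (Suc i)) \<and>
     triangle_coeffs x 2 (V (Suc p)) (V k) (V (Suc k)) \<and> triangle_coeffs x 3 (V (Suc p)) (V j) (V (Suc j)) \<and>
     point x 2 - point x 3 = point x 1 - point x 0 \<and>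
     (point x 1 - point x 0) \<bullet> (point x 3 - point x 0) = 0"
proof -
  note t = in_triangle_vtx[OF assms(1,2,2,6,6)] in_triangle_vtx[OF assms(1,2,3,6,7)]
    in_triangle_vtx[OF assms(1,2,4,6,8)] in_triangle_vtx[OF assms(1,2,5,6,9)]
  have eqs: "(\<forall>h\<in>set (peq (psub (PVar 4) (PVar 6)) (psub (PVar 2) (PVar 0))). 0 \<le> pval h s x) \<and>
      (\<forall>h\<in>set (peq (psub (PVar 5) (PVar 7)) (psub (PVar 3) (PVar 1))). 0 \<le> pval h s x) \<longleftrightarrow>
      point x 2 - point x 3 = point x 1 - point x 0"
    by (auto simp: peq_def vec2_eq_iff)
  have orth: "(\<forall>h\<in>set (peq (dotp 1 0 3 0) (PCoeff (RConst 0))). 0 \<le> pval h s x) \<longleftrightarrow>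
      (point x 1 - point x 0) \<bullet> (point x 3 - point x 0) = 0"
    by (auto simp: peq_def dotp_def inner_real2)
  show ?thesis
    unfolding feasible_def constraints_def mem_Collect_eq set_append ball_Un t orth using eqs by blast
qed

lemma pval_objective: "pval (PMul crossp crossp) s x = sqarea (point x 0) (point x 1) (point x 3)"
  by (simp add: crossp_def sqarea_def cross2_def power2_eq_square del: cross2_diff)

lemma feasible_tuple_rect:
  assumes "vertices_ok s" "nmem s 1 = p" "nmem s 2 = i" "nmem s 3 = j" "nmem s 4 = k"
    and "p < n" "i < n" "j < n" "k < n" "x \<in> feasible constraints s"
  shows "tuple_rect p i j k (point x 0) (point x 1) (point x 2) (point x 3)"
  using assms(10) unfolding feasible_iff[OF assms(1-9)] triangle_coeffs_def tuple_rect_def mem_hull3_iff by blast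

lemma tuple_rect_feasible:
  assumes "vertices_ok s" "nmem s 1 = p" "nmem s 2 = i" "nmem s 3 = j" "nmem s 4 = k"
    and "p < n" "i < n" "j < n" "k < n" "tuple_rect p i j k a b c d"
  obtains x where "x \<in> feasible constraints s" "point x 0 = a" "point x 1 = b" "point x 2 = c" "point x 3 = d"
proof -
  obtain u0 v0 where 0: "0 \<le> u0" "0 \<le> v0" "u0 + v0 \<le> 1"
      "a = V (Suc p) + u0 *\<^sub>R (V p - V (Suc p)) + v0 *\<^sub>R (V (Suc (Suc p)) - V (Suc p))"
    using assms(10) unfolding tuple_rect_def mem_hull3_iff by blast
  obtain u1 v1 where 1: "0 \<le> u1" "0 \<le> v1" "u1 + v1 \<le> 1"
      "b = V (Suc p) + u1 *\<^sub>R (V i - V (Suc p)) + v1 *\<^sub>R (V (Suc i) - V (Suc p))"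
    using assms(10) unfolding tuple_rect_def mem_hull3_iff by blast
  obtain u2 v2 where 2: "0 \<le> u2" "0 \<le> v2" "u2 + v2 \<le> 1"
      "c = V (Suc p) + u2 *\<^sub>R (V k - V (Suc p)) + v2 *\<^sub>R (V (Suc k) - V (Suc p))"
    using assms(10) unfolding tuple_rect_def mem_hull3_iff by blast
  obtain u3 v3 where 3: "0 \<le> u3" "0 \<le> v3" "u3 + v3 \<le> 1"
      "d = V (Suc p) + u3 *\<^sub>R (V j - V (Suc p)) + v3 *\<^sub>R (V (Suc j) - V (Suc p))"
    using assms(10) unfolding tuple_rect_def mem_hull3_iff by blast
  define xs where "xs = [a $ 1, a $ 2, b $ 1, b $ 2, c $ 1, c $ 2, d $ 1, d $ 2, u0, v0, u1, v1, u2, v2, u3, v3]"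
  define x where "x m = xs ! m" for m
  have pts: "point x 0 = a" "point x 1 = b" "point x 2 = c" "point x 3 = d"
    by (simp_all add: vec2_eq_iff x_def xs_def)
  have co: "x 8 = u0" "x 9 = v0" "x 10 = u1" "x 11 = v1" "x 12 = u2" "x 13 = v2" "x 14 = u3" "x 15 = v3"
    by (simp_all add: x_def xs_def)
  have "triangle_coeffs x 0 (V (Suc p)) (V p) (V (Suc (Suc p)))" "triangle_coeffs x 1 (V (Suc p)) (V i) (V (Suc i))"
     "triangle_coeffs x 2 (V (Suc p)) (V k) (V (Suc k))" "triangle_coeffs x 3 (V (Suc p)) (V j) (V (Suc j))"
    using 0 1 2 3 unfolding triangle_coeffs_def pts by (simp_all add: co)
  then have "x \<in> feasible constraints s"
    using assms(10) unfolding feasible_iff[OF assms(1-9)] pts tuple_rect_def by blast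
  then show thesis using that pts by blast
qed

text \<open>Assignments to all variables do not form a compact set, since only the first 16
  variables are constrained. The maximum is therefore taken over the compact set of quadruples of
  corners and lifted to an assignment.\<close>

lemma maximizer_exists:
  assumes "vertices_ok s" "nmem s 1 = p" "nmem s 2 = i" "nmem s 3 = j" "nmem s 4 = k"
    and "p < n" "i < n" "j < n" "k < n" "tuple_rect p i j k a b c d"
  shows "\<exists>x. is_arg_max (pval (PMul crossp crossp) s) (\<lambda>y. y \<in> feasible constraints s) x"
proof -
  let ?K = "{(a, b, c, d). tuple_rect p i j k a b c d}" and ?f = "\<lambda>(a, b, c, d). sqarea a b d"
  have eq: "?K = ((convex hull {V (Suc p), V p, V (Suc (Suc p))}) \<times> (convex hull {V (Suc p), V i, V (Suc i)}) \<times>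
       (convex hull {V (Suc p), V k, V (Suc k)}) \<times> (convex hull {V (Suc p), V j, V (Suc j)})) \<inter>
      ({y. fst (snd (snd y)) - snd (snd (snd y)) = fst (snd y) - fst y} \<inter>
       {y. (fst (snd y) - fst y) \<bullet> (snd (snd (snd y)) - fst y) = 0})"
    by (auto simp: tuple_rect_def)
  have "compact ?K"
    unfolding eq
    by (intro compact_Int_closed compact_Times compact_convex_hull finite_imp_compact closed_Int
        closed_Collect_eq continuous_intros) auto
  moreover have "?K \<noteq> {}" using assms(10) by blast
  moreover have "continuous_on ?K ?f"
    unfolding sqarea_def case_prod_unfold by (intro continuous_intros)
  ultimately have "\<exists>y\<in>?K. \<forall>z\<in>?K. ?f z \<le> ?f y" by (rule continuous_attains_sup)
  then obtain a b c d where r: "tuple_rect p i j k a b c d"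
      "\<And>a' b' c' d'. tuple_rect p i j k a' b' c' d' \<Longrightarrow> sqarea a' b' d' \<le> sqarea a b d"
    by fastforce
  obtain x where x: "x \<in> feasible constraints s" "point x 0 = a" "point x 1 = b" "point x 2 = c" "point x 3 = d"
    using tuple_rect_feasible[OF assms(1-9) r(1)] by blast
  have "\<not> sqarea a b d < sqarea (point y 0) (point y 1) (point y 3)" if "y \<in> feasible constraints s" for y
    using r(2) feasible_tuple_rect[OF assms(1-9) that] by (simp add: not_less)
  then show ?thesis
    unfolding is_arg_max_def pval_objective using x by blast
qed

section \<open>The record of the best rectangle and one round of the search\<close>

definition best :: "store \<Rightarrow> real" where
  "best s = rmem s (n + n + 4)"

definition saved :: "store \<Rightarrow> nat \<Rightarrow> real^2" where
  "saved s = point (\<lambda>m. rmem s (n + n + 5 + m))"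

definition found :: "store \<Rightarrow> nat \<Rightarrow> real^2" where
  "found s = point (\<lambda>m. rmem s (n + n + 13 + m))"

text \<open>The record starts at 0 with no rectangle stored, hence the guard. Later it changes only
  by strict improvement, so whatever is saved is nondegenerate.\<close>

definition saved_ok :: "store \<Rightarrow> bool" where
  "saved_ok s \<longleftrightarrow> (0 < best s \<longrightarrow> rect_in region (saved s 0) (saved s 1) (saved s 2) (saved s 3) \<and>
     best s = sqarea (saved s 0) (saved s 1) (saved s 3))"

definition store_ok :: "store \<Rightarrow> bool" where
  "store_ok s \<longleftrightarrow> vertices_ok s \<and> saved_ok s"

lemma vertices_ok_cong:
  assumes "vertices_ok s" "nmem s' 0 = nmem s 0" "\<And>m. m < n + n + 4 \<Longrightarrow> rmem s' m = rmem s m"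
  shows "vertices_ok s'"
  using assms by (auto simp: vertices_ok_def)

lemma saved_ok_cong:
  assumes "saved_ok s" "\<And>m. m < n + n + 13 \<Longrightarrow> rmem s' m = rmem s m"
  shows "saved_ok s'"
  using assms by (simp add: saved_ok_def best_def saved_def point_def)

lemma nval_cell [simp]: "nmem s 0 = n \<Longrightarrow> nval (cell m) s = n + n + m"
  by (simp add: cell_def)

lemma rval_cand_cross:
  assumes "nmem s 0 = n"
  shows "rval (RMul cand_cross cand_cross) s = sqarea (found s 0) (found s 1) (found s 3)"
  using assms by (simp add: cand_cross_def cand_def sqarea_def cross2_def found_def power2_eq_square add.assoc
      del: cross2_diff)

lemma effect_save:
  assumes "nmem s 0 = n"
  shows "nmem (effect \<sigma> save s) = nmem s"
    and "m < n + n + 4 \<Longrightarrow> rmem (effect \<sigma> save s) m = rmem s m"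
    and "best (effect \<sigma> save s) = sqarea (found s 0) (found s 1) (found s 3)"
    and "l < 4 \<Longrightarrow> saved (effect \<sigma> save s) l = found s l"
proof -
  define t where "t = s\<lparr>rmem := (rmem s)(n + n + 4 := rval (RMul cand_cross cand_cross) s)\<rparr>"
  have t0: "nmem t 0 = n" and nt: "nmem t = nmem s" using assms by (simp_all add: t_def)
  have save: "effect \<sigma> save s = effect \<sigma> (seqs (map (\<lambda>m. RWrite (cell (5 + m)) (RRead (cell (13 + m)))) [0..<8])) t"
    using assms by (simp add: save_def cand_def t_def del: upt_Suc rval.simps)
  note copy = effect_copy[where s = t and dst = "\<lambda>m. cell (5 + m)" and D = "\<lambda>m. n + n + (5 + m)"
      and src = "\<lambda>m. cell (13 + m)" and E = "\<lambda>m. n + n + (13 + m)" and xs = "[0..<8]" and \<sigma> = \<sigma>,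
      folded save]
  show "nmem (effect \<sigma> save s) = nmem s"
    using copy(1) t0 nt by (simp add: inj_on_def)
  have keep: "rmem (effect \<sigma> save s) m = rmem t m" if "m < n + n + 5" for m
    using that t0 by (intro copy(3)) (auto simp: inj_on_def)
  have copied: "rmem (effect \<sigma> save s) (n + n + (5 + m)) = rmem t (n + n + (13 + m))" if "m < 8" for m
    using that t0 by (intro copy(2)) (auto simp: inj_on_def)
  show "rmem (effect \<sigma> save s) m = rmem s m" if "m < n + n + 4"
    using keep that by (simp add: t_def)
  show "best (effect \<sigma> save s) = sqarea (found s 0) (found s 1) (found s 3)"
    unfolding best_def using keep rval_cand_cross[OF assms] by (simp add: t_def del: rval.simps)
  show "saved (effect \<sigma> save s) l = found s l" if "l < 4"
    using copied[of "2 * l"] copied[of "2 * l + 1"] that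
    by (simp add: saved_def found_def vec2_eq_iff t_def add.assoc)
qed

text \<open>Nothing but maximality is known of the solver's answer. This suffices: the candidate is
  a rectangle in the polygon whose squared area dominates every feasible one, and the record is the
  larger of the two values.\<close>

lemma effect_solve_and_save:
  assumes "exact_solver \<sigma>" "store_ok s" "nmem s 1 = p" "nmem s 2 = i" "nmem s 3 = j" "nmem s 4 = k"
    and "p < n" "i < n" "j < n" "k < n"
  defines "s' \<equiv> effect \<sigma> solve_and_save s"
  shows "store_ok s' \<and> nmem s' 1 = p \<and> nmem s' 2 = i \<and> nmem s' 3 = j \<and> nmem s' 4 = k \<and> best s \<le> best s' \<and>
    (\<forall>a b c d. tuple_rect p i j k a b c d \<longrightarrow> sqarea a b d \<le> best s')"
proof -
  let ?obj = "PMul crossp crossp"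
  let ?m = "is_arg_max (pval ?obj s) (\<lambda>y. y \<in> feasible constraints s)"
  have v: "vertices_ok s" and so: "saved_ok s" using assms(2) by (auto simp: store_ok_def)
  have n0: "nmem s 0 = n" using v by (simp add: vertices_ok_def)
  note idx = v assms(3-10)
  define s1 where "s1 = maximize \<sigma> 5 (n + n + 13) 8 ?obj constraints s"
  have s': "s' = (if 0 < nmem s1 5 \<and> best s1 < rval (RMul cand_cross cand_cross) s1 then effect \<sigma> save s1 else s1)"
    if "nmem s1 0 = n"
    using that n0 by (simp add: s'_def solve_and_save_def s1_def best_def)
  show ?thesis
  proof (cases "\<exists>x. ?m x")
    case False
    then have "s1 = s\<lparr>nmem := (nmem s)(5 := 0)\<rparr>" unfolding s1_def maximize_def by (rule if_not_P)
    moreover from this have "s' = s1" using s' n0 by simp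
    ultimately have s'_eq: "s' = s\<lparr>nmem := (nmem s)(5 := 0)\<rparr>" by simp
    \<comment> \<open>Failure of \<open>Maximize\<close> means that no rectangle is feasible, since
      otherwise a maximizer would exist.\<close>
    have "\<not> tuple_rect p i j k a b c d" for a b c d
      using maximizer_exists[OF idx] False by blast
    moreover have "store_ok s'"
      using v so unfolding store_ok_def by (auto simp: s'_eq intro: vertices_ok_cong saved_ok_cong)
    ultimately show ?thesis using assms(3-6) by (simp add: s'_eq best_def)
  next
    case True
    define x where "x = \<sigma> (pval ?obj s) (feasible constraints s)"
    have x: "?m x" using assms(1) True unfolding exact_solver_def x_def by blast
    have s1: "s1 = s\<lparr>nmem := (nmem s)(5 := 1), rmem := (\<lambda>l. if n + n + 13 \<le> l \<and> l < n + n + 13 + 8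
        then x (l - (n + n + 13)) else rmem s l)\<rparr>"
      using True unfolding s1_def maximize_def x_def by (rule if_P)
    have n1: "nmem s1 0 = n" using n0 by (simp add: s1)
    have old: "rmem s1 m = rmem s m" if "m < n + n + 13" for m using that by (simp add: s1)
    have inv1: "store_ok s1"
      unfolding store_ok_def using vertices_ok_cong[OF v] saved_ok_cong[OF so] old n0 n1 by simp
    have found: "found s1 l = point x l" if "l < 4" for l
      using that by (simp add: found_def vec2_eq_iff s1)
    define A where "A = sqarea (point x 0) (point x 1) (point x 3)"
    have cand: "rval (RMul cand_cross cand_cross) s1 = A"
      unfolding rval_cand_cross[OF n1] A_def by (simp add: found)
    have max: "sqarea a b d \<le> A" if "tuple_rect p i j k a b c d" for a b c d
    proof -
      obtain y where "y \<in> feasible constraints s" "point y 0 = a" "point y 1 = b" "point y 2 = c" "point y 3 = d"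
        using tuple_rect_feasible[OF idx \<open>tuple_rect p i j k a b c d\<close>] .
      then show ?thesis using x unfolding is_arg_max_def pval_objective A_def by (auto simp: not_less)
    qed
    have rect: "rect_in region (point x 0) (point x 1) (point x 2) (point x 3)"
      using x unfolding is_arg_max_def by (intro tuple_rect_in[OF feasible_tuple_rect[OF idx]]) blast
    have best1: "best s1 = best s" by (simp add: best_def old)
    show ?thesis
    proof (cases "best s < A")
      case False
      then have "s' = s1" using s' n1 cand best1 by simp
      then show ?thesis using inv1 best1 False max assms(3-6) by (fastforce simp: s1 best_def)
    next
      case True
      then have s'_eq: "s' = effect \<sigma> save s1" using s' n1 cand best1 by (simp add: s1)
      have best': "best s' = A" unfolding s'_eq effect_save(3)[OF n1] A_def by (simp add: found)
      have saved': "saved s' l = point x l" if "l < 4" for l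
        unfolding s'_eq using effect_save(4)[OF n1] found that by simp
      have "vertices_ok s1" using inv1 by (simp add: store_ok_def)
      then have "vertices_ok s'"
        unfolding s'_eq by (rule vertices_ok_cong) (simp_all add: effect_save[OF n1])
      moreover have "saved_ok s'" using rect by (simp add: saved_ok_def saved' best' A_def)
      moreover have "nmem s' = nmem s1" unfolding s'_eq by (rule effect_save(1)[OF n1])
      ultimately show ?thesis using best' True max assms(3-6) by (auto simp: store_ok_def s1)
    qed
  qed
qed

section \<open>Correctness and cost of the nested loops\<close>

lemma store_ok_nmem_upd: "c \<noteq> 0 \<Longrightarrow> store_ok s \<Longrightarrow> store_ok (s\<lparr>nmem := (nmem s)(c := v)\<rparr>)"
  unfolding store_ok_def by (auto intro: vertices_ok_cong saved_ok_cong)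

lemma store_ok_nmem_0: "store_ok s \<Longrightarrow> nmem s 0 = n"
  by (simp add: store_ok_def vertices_ok_def)

lemma straight_solve_and_save: "straight solve_and_save"
  by (simp add: solve_and_save_def save_def)

text \<open>The branch taken depends on the polygon and the counters only, so these costs can be
  summed over all iterations in advance.\<close>

definition cost_test :: "nat \<Rightarrow> nat \<Rightarrow> nat \<Rightarrow> nat" where
  "cost_test p i j = 1 + bcost pass_test + (if pass (Suc p) i j then 9 + (\<Sum>k<n. cost solve_and_save + 12) else 1)"

text \<open>For a fixed value \<open>A\<close> the goal is \<open>A \<le> best s\<close>. It is
  never lost, and it is reached in any round in which a rectangle of squared area \<open>A\<close>
  is feasible.\<close>

lemma runs_search:
  assumes "exact_solver \<sigma>" "store_ok s"
  shows "runs \<sigma> search s (9 + (\<Sum>p<n. (9 + (\<Sum>i<n. (9 + (\<Sum>j<n. cost_test p i j + 12)) + 12)) + 12))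
    (\<lambda>s'. store_ok s' \<and> (covered A \<longrightarrow> A \<le> best s'))"
proof -
  define hit where "hit p i j k \<longleftrightarrow> (\<exists>a b c d. tuple_rect p i j k a b c d \<and> sqarea a b d = A)" for p i j k
  have body: "runs \<sigma> solve_and_save s (cost solve_and_save)
      (\<lambda>s'. (store_ok s' \<and> nmem s' 1 = p \<and> nmem s' 2 = i \<and> nmem s' 3 = j) \<and> nmem s' 4 = k \<and>
        (A \<le> best s \<or> hit p i j k \<longrightarrow> A \<le> best s'))"
    if "store_ok s \<and> nmem s 1 = p \<and> nmem s 2 = i \<and> nmem s 3 = j" "nmem s 4 = k" "p < n" "i < n" "j < n" "k < n" for s p i j k
    using effect_solve_and_save[OF assms(1), of s p i j k] that
    by (intro runs_straight[OF straight_solve_and_save]) (auto simp: hit_def)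
  have loop4: "runs \<sigma> (For 4 solve_and_save) s (9 + (\<Sum>k<n. cost solve_and_save + 12))
      (\<lambda>s'. (store_ok s' \<and> nmem s' 1 = p \<and> nmem s' 2 = i \<and> nmem s' 3 = j) \<and>
        (A \<le> best s \<or> (\<exists>k<n. hit p i j k) \<longrightarrow> A \<le> best s'))"
    if "store_ok s \<and> nmem s 1 = p \<and> nmem s 2 = i \<and> nmem s 3 = j" "p < n" "i < n" "j < n" for s p i j
  proof (rule runs_For[where J = "\<lambda>s. store_ok s \<and> nmem s 1 = p \<and> nmem s 2 = i \<and> nmem s 3 = j" and D = "\<lambda>s. A \<le> best s"])
  qed (use body that in \<open>auto intro: store_ok_nmem_upd store_ok_nmem_0 simp: best_def\<close>)
  have test: "runs \<sigma> (Cond pass_test (For 4 solve_and_save) Skip) s (cost_test p i j)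
      (\<lambda>s'. (store_ok s' \<and> nmem s' 1 = p \<and> nmem s' 2 = i) \<and> nmem s' 3 = j \<and>
        (A \<le> best s \<or> (pass (Suc p) i j \<and> (\<exists>k<n. hit p i j k)) \<longrightarrow> A \<le> best s'))"
    if *: "store_ok s \<and> nmem s 1 = p \<and> nmem s 2 = i" "nmem s 3 = j" "p < n" "i < n" "j < n" for s p i j
    unfolding cost_test_def
  proof (rule runs_Cond)
    have b: "bval pass_test s \<longleftrightarrow> pass (Suc p) i j"
      using * by (intro bval_pass_test) (auto simp: store_ok_def)
    {
      assume "bval pass_test s"
      then show "runs \<sigma> (For 4 solve_and_save) s (if pass (Suc p) i j then 9 + (\<Sum>k<n. cost solve_and_save + 12) else 1)
        (\<lambda>s'. (store_ok s' \<and> nmem s' 1 = p \<and> nmem s' 2 = i) \<and> nmem s' 3 = j \<and>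
          (A \<le> best s \<or> (pass (Suc p) i j \<and> (\<exists>k<n. hit p i j k)) \<longrightarrow> A \<le> best s'))"
        using b * by (intro runs_mono[OF loop4[of s p i j]]) auto
    next
      assume "\<not> bval pass_test s"
      then show "runs \<sigma> Skip s (if pass (Suc p) i j then 9 + (\<Sum>k<n. cost solve_and_save + 12) else 1)
        (\<lambda>s'. (store_ok s' \<and> nmem s' 1 = p \<and> nmem s' 2 = i) \<and> nmem s' 3 = j \<and>
          (A \<le> best s \<or> (pass (Suc p) i j \<and> (\<exists>k<n. hit p i j k)) \<longrightarrow> A \<le> best s'))"
        using b * runs_straight[of Skip _ \<sigma> s] by simp
    }
  qed
  have loop3: "runs \<sigma> (For 3 (Cond pass_test (For 4 solve_and_save) Skip)) s (9 + (\<Sum>j<n. cost_test p i j + 12))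
      (\<lambda>s'. (store_ok s' \<and> nmem s' 1 = p \<and> nmem s' 2 = i) \<and>
        (A \<le> best s \<or> (\<exists>j<n. pass (Suc p) i j \<and> (\<exists>k<n. hit p i j k)) \<longrightarrow> A \<le> best s'))"
    if "store_ok s \<and> nmem s 1 = p \<and> nmem s 2 = i" "p < n" "i < n" for s p i
  proof (rule runs_For[where J = "\<lambda>s. store_ok s \<and> nmem s 1 = p \<and> nmem s 2 = i" and D = "\<lambda>s. A \<le> best s"])
  qed (use test that in \<open>auto intro: store_ok_nmem_upd store_ok_nmem_0 simp: best_def\<close>)
  have loop2: "runs \<sigma> (For 2 (For 3 (Cond pass_test (For 4 solve_and_save) Skip))) s
      (9 + (\<Sum>i<n. (9 + (\<Sum>j<n. cost_test p i j + 12)) + 12))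
      (\<lambda>s'. (store_ok s' \<and> nmem s' 1 = p) \<and>
        (A \<le> best s \<or> (\<exists>i<n. \<exists>j<n. pass (Suc p) i j \<and> (\<exists>k<n. hit p i j k)) \<longrightarrow> A \<le> best s'))"
    if "store_ok s \<and> nmem s 1 = p" "p < n" for s p
  proof (rule runs_For[where J = "\<lambda>s. store_ok s \<and> nmem s 1 = p" and D = "\<lambda>s. A \<le> best s"])
    fix i s assume "i < n" "store_ok s \<and> nmem s 1 = p" "nmem s 2 = i"
    then show "runs \<sigma> (For 3 (Cond pass_test (For 4 solve_and_save) Skip)) s (9 + (\<Sum>j<n. cost_test p i j + 12))
      (\<lambda>s'. (store_ok s' \<and> nmem s' 1 = p) \<and> nmem s' 2 = i \<and>
        (A \<le> best s \<or> (\<exists>j<n. pass (Suc p) i j \<and> (\<exists>k<n. hit p i j k)) \<longrightarrow> A \<le> best s'))"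
      using that by (intro runs_mono[OF loop3[of s p i]]) auto
  qed (use that in \<open>auto intro: store_ok_nmem_upd store_ok_nmem_0 simp: best_def\<close>)
  have run: "runs \<sigma> search s (9 + (\<Sum>p<n. (9 + (\<Sum>i<n. (9 + (\<Sum>j<n. cost_test p i j + 12)) + 12)) + 12))
    (\<lambda>s'. store_ok s' \<and> (A \<le> best s \<or> (\<exists>p<n. \<exists>i<n. \<exists>j<n. pass (Suc p) i j \<and> (\<exists>k<n. hit p i j k)) \<longrightarrow> A \<le> best s'))"
    unfolding search_def
  proof (rule runs_For[where J = store_ok and D = "\<lambda>s. A \<le> best s"])
    fix p s assume "p < n" "store_ok s" "nmem s 1 = p"
    then show "runs \<sigma> (For 2 (For 3 (Cond pass_test (For 4 solve_and_save) Skip))) s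
      (9 + (\<Sum>i<n. (9 + (\<Sum>j<n. cost_test p i j + 12)) + 12))
      (\<lambda>s'. store_ok s' \<and> nmem s' 1 = p \<and>
        (A \<le> best s \<or> (\<exists>i<n. \<exists>j<n. pass (Suc p) i j \<and> (\<exists>k<n. hit p i j k)) \<longrightarrow> A \<le> best s'))"
      by (intro runs_mono[OF loop2[of s p]]) auto
  qed (use assms in \<open>auto intro: store_ok_nmem_upd store_ok_nmem_0 simp: best_def\<close>)
  have cov: "covered A \<Longrightarrow> \<exists>p<n. \<exists>i<n. \<exists>j<n. pass (Suc p) i j \<and> (\<exists>k<n. hit p i j k)"
    unfolding covered_def hit_def tuple_rect_def by blast
  show ?thesis by (rule runs_mono[OF run order.refl]) (use cov in blast)
qed

text \<open>All n^3 triples pay for a test, but the innermost loop, of length n, runs only for the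
  at most 13n passing pairs of each vertex.\<close>

lemma search_cost:
  "9 + (\<Sum>p<n. (9 + (\<Sum>i<n. (9 + (\<Sum>j<n. cost_test p i j + 12)) + 12)) + 12)
     \<le> (51 + (bcost pass_test + 14) + 13 * (cost solve_and_save + 21)) * n ^ 3"
proof -
  define X Y where "X = 9 + n * (cost solve_and_save + 12)" and "Y = bcost pass_test + 14"
  have inner: "(\<Sum>i<n. (9 + (\<Sum>j<n. cost_test p i j + 12)) + 12) \<le> 21 * n + Y * n ^ 2 + 13 * n * X" for p
  proof -
    have ct: "cost_test p i j + 12 \<le> Y + (if pass (Suc p) i j then X else 0)" for i j
      by (simp add: cost_test_def X_def Y_def algebra_simps)
    have "(\<Sum>i<n. (9 + (\<Sum>j<n. cost_test p i j + 12)) + 12)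
        \<le> (\<Sum>i<n. (9 + (\<Sum>j<n. Y + (if pass (Suc p) i j then X else 0))) + 12)"
      by (intro sum_mono add_right_mono add_left_mono ct)
    also have "\<dots> = 21 * n + Y * n ^ 2 + (\<Sum>i<n. \<Sum>j<n. if pass (Suc p) i j then X else 0)"
      by (simp add: sum.distrib power2_eq_square algebra_simps)
    also have "(\<Sum>i<n. \<Sum>j<n. if pass (Suc p) i j then X else 0) =
        (\<Sum>x\<in>{..<n} \<times> {..<n}. if pass (Suc p) (fst x) (snd x) then X else 0)"
      by (simp add: sum.cartesian_product case_prod_unfold)
    also have "\<dots> = (\<Sum>x\<in>{x \<in> {..<n} \<times> {..<n}. pass (Suc p) (fst x) (snd x)}. X)"
      by (rule sum.inter_filter[symmetric]) simp
    also have "{x \<in> {..<n} \<times> {..<n}. pass (Suc p) (fst x) (snd x)} = {(i, j). i < n \<and> j < n \<and> pass (Suc p) i j}"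
      by auto
    also have "(\<Sum>x\<in>{(i, j). i < n \<and> j < n \<and> pass (Suc p) i j}. X) \<le> 13 * n * X"
      using card_pass[of "Suc p"] by simp
    finally show ?thesis by simp
  qed
  have n1: "1 \<le> n" using n_ge_3 by simp
  have "(\<Sum>p<n. (9 + (\<Sum>i<n. (9 + (\<Sum>j<n. cost_test p i j + 12)) + 12)) + 12)
      \<le> (\<Sum>p<n. 9 + (21 * n + Y * n ^ 2 + 13 * n * X) + 12)"
    using inner by (intro sum_mono add_mono order.refl)
  also have "\<dots> = 21 * n + 21 * n ^ 2 + Y * n ^ 3 + 13 * n ^ 2 * X"
    by (simp add: power2_eq_square power3_eq_cube algebra_simps)
  also have "X \<le> n * (cost solve_and_save + 21)"
    unfolding X_def using n1 by (simp add: algebra_simps)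
  then have "13 * n ^ 2 * X \<le> 13 * n ^ 2 * (n * (cost solve_and_save + 21))" by simp
  also have "13 * n ^ 2 * (n * (cost solve_and_save + 21)) = 13 * (cost solve_and_save + 21) * n ^ 3"
    by (simp add: power2_eq_square power3_eq_cube algebra_simps)
  finally have "9 + (\<Sum>p<n. (9 + (\<Sum>i<n. (9 + (\<Sum>j<n. cost_test p i j + 12)) + 12)) + 12)
     \<le> 9 + (21 * n + 21 * n ^ 2 + Y * n ^ 3 + 13 * (cost solve_and_save + 21) * n ^ 3)" by simp
  moreover have "n \<le> n ^ 3" "n ^ 2 \<le> n ^ 3" "1 \<le> n ^ 3"
    using n1 power_increasing[of 1 3 n] power_increasing[of 2 3 n] by simp_all
  ultimately show ?thesis unfolding Y_def[symmetric] by (simp add: distrib_right)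
qed

section \<open>The complete program\<close>

lemma effect_prologue:
  fixes \<sigma> :: solver and vs :: "(real^2) list"
  assumes "\<And>i. V i = vs ! (i mod n)" "n = length vs"
  defines "s \<equiv> effect \<sigma> prologue (input_store vs)"
  shows "store_ok s"
proof -
  have n0: "nmem (input_store vs) 0 = n" by (simp add: input_store_def assms(2))
  have nm: "nmem s = nmem (input_store vs)" by (simp add: s_def prologue_def)
  have low: "rmem s m = rmem (input_store vs) m" if "m < n + n" for m
    using that n0 n_ge_3 by (simp add: s_def prologue_def)
  have high: "rmem s (n + n + m) = rmem (input_store vs) m" if "m < 4" for m
  proof -
    have "m = 0 \<or> m = 1 \<or> m = 2 \<or> m = 3" using that by linarith
    then show ?thesis using n0 n_ge_3 by (auto simp: s_def prologue_def)
  qed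
  have input: "rmem (input_store vs) (m + m) = vs ! m $ 1" "rmem (input_store vs) (m + m + 1) = vs ! m $ 2"
    if "m < n" for m
  proof -
    have "m + m < 2 * length vs" "m + m + 1 < 2 * length vs" "(m + m) div 2 = m" "(m + m + 1) div 2 = m"
      using that by (auto simp: assms(2))
    then show "rmem (input_store vs) (m + m) = vs ! m $ 1" "rmem (input_store vs) (m + m + 1) = vs ! m $ 2"
      by (simp_all add: input_store_def)
  qed
  have "rmem s (m + m) = V m $ 1 \<and> rmem s (m + m + 1) = V m $ 2" if "m \<le> Suc n" for m
  proof -
    have "m < n \<or> m = n \<or> m = Suc n" using that by linarith
    then consider "m < n" | "m = n" | "m = Suc n" by blast
    then show ?thesis
    proof cases
      case 1
      then show ?thesis using low[of "m + m"] low[of "m + m + 1"] input[of m] by (simp add: assms(1))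
    next
      case 2
      then show ?thesis using high[of 0] high[of 1] input[of 0] n_ge_3 by (simp add: assms(1))
    next
      case 3
      have "m + m = n + n + 2" "m + m + 1 = n + n + 3" using 3 by simp_all
      then show ?thesis using high[of 2] high[of 3] input[of 1] n_ge_3 3
        by (simp add: assms(1) mod_Suc numeral_eq_Suc)
    qed
  qed
  then have "vertices_ok s" using n0 by (simp add: vertices_ok_def nm)
  \<comment> \<open>The prologue fills only the cells \<open>n + n\<close> to
    \<open>n + n + 3\<close>; the record in the next cell keeps the 0 of the input store.\<close>
  moreover have "best s = 0"
    using n0 by (simp add: best_def s_def prologue_def) (simp add: input_store_def assms(2))
  then have "saved_ok s" by (simp add: saved_ok_def)
  ultimately show ?thesis by (simp add: store_ok_def)
qed

lemma effect_epilogue: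
  assumes "nmem s 0 = n" "l < 4"
  shows "out_point (effect \<sigma> epilogue s) l = saved s l"
proof -
  have "rmem (effect \<sigma> epilogue s) m = rmem s (n + n + (5 + m))" if "m < 8" for m
    unfolding epilogue_def
    using effect_copy(2)[of s NConst "\<lambda>m. m" "\<lambda>m. cell (5 + m)" "\<lambda>m. n + n + (5 + m)" "[0..<8]" m \<sigma>]
      assms(1) that n_ge_3 by simp
  from this[of "2 * l"] this[of "2 * l + 1"] show ?thesis
    using assms(2) by (simp add: out_point_def saved_def vec2_eq_iff add.assoc)
qed

lemma runs_program:
  assumes "exact_solver \<sigma>" "\<And>i. V i = vs ! (i mod n)" "n = length vs" "covered A" "0 < A"
  shows "runs \<sigma> program (input_store vs) (run_time n)
    (\<lambda>s. rect_in region (out_point s 0) (out_point s 1) (out_point s 2) (out_point s 3) \<and>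
      A \<le> sqarea (out_point s 0) (out_point s 1) (out_point s 3))"
    (is "runs _ _ _ _ ?Q")
proof -
  let ?T = "9 + (\<Sum>p<n. (9 + (\<Sum>i<n. (9 + (\<Sum>j<n. cost_test p i j + 12)) + 12)) + 12)"
  have "runs \<sigma> epilogue s (cost epilogue) ?Q" if "store_ok s \<and> (covered A \<longrightarrow> A \<le> best s)" for s
  proof (rule runs_straight)
    have "0 < best s" "A \<le> best s" using that assms(4,5) by auto
    then show "?Q (effect \<sigma> epilogue s)"
      using that by (simp add: effect_epilogue store_ok_nmem_0) (simp add: store_ok_def saved_ok_def)
  qed (simp add: epilogue_def)
  then have "runs \<sigma> search (effect \<sigma> prologue (input_store vs)) ?T (\<lambda>s. runs \<sigma> epilogue s (cost epilogue) ?Q)"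
    by (rule runs_mono[OF runs_search[OF assms(1) effect_prologue[OF assms(2,3)]] order.refl])
  then have "runs \<sigma> (Seq search epilogue) (effect \<sigma> prologue (input_store vs)) (?T + cost epilogue) ?Q"
    by (rule runs_Seq)
  then have "runs \<sigma> prologue (input_store vs) (cost prologue)
      (\<lambda>s. runs \<sigma> (Seq search epilogue) s (?T + cost epilogue) ?Q)"
    by (intro runs_straight) (simp_all add: prologue_def)
  then have "runs \<sigma> program (input_store vs) (cost prologue + (?T + cost epilogue)) ?Q"
    unfolding program_def by (rule runs_Seq)
  moreover have "cost prologue + (?T + cost epilogue) \<le> run_time n"
  proof -
    have "1 \<le> n ^ 3" using n_ge_3 by simp
    then have "cost prologue + cost epilogue \<le> (cost prologue + cost epilogue) * n ^ 3" by simp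
    then show ?thesis using search_cost unfolding run_time_def by (simp only: distrib_right)
  qed
  ultimately show ?thesis by (rule runs_mono)
qed

end

theorem theorem4:
  "\<exists>(prog :: com) (T :: nat \<Rightarrow> nat).
     (\<lambda>n. real (T n)) \<in> O(\<lambda>n. real n ^ 3) \<and>
     (\<forall>\<sigma> P vs. exact_solver \<sigma> \<longrightarrow> convex_polygon P vs \<longrightarrow>
        finds_max_rectangle \<sigma> prog P vs (T (length vs)))"
proof (intro exI conjI allI impI)
  show "(\<lambda>n. real (run_time n)) \<in> O(\<lambda>n. real n ^ 3)"
    unfolding run_time_def by (simp del: of_nat_add of_nat_numeral)
  fix \<sigma> P vs assume \<sigma>: "exact_solver \<sigma>" and poly: "convex_polygon P vs"
  obtain orient where or: "oriented_polygon (\<lambda>i. vs ! (i mod length vs)) (length vs) orient"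
    and region: "oriented_polygon.region (\<lambda>i. vs ! (i mod length vs)) (length vs) orient = P"
    using polygon_oriented[OF poly] .
  interpret oriented_polygon "\<lambda>i. vs ! (i mod length vs)" "length vs" orient by (rule or)
  have P: "compact P" "convex P" "aff_dim P = 2"
    using compact_region convex_region poly by (simp_all add: region convex_polygon_def)
  obtain a b c d where opt: "rect_in P a b c d" "0 < sqarea a b d"
      "\<And>a' b' c' d'. rect_in P a' b' c' d' \<Longrightarrow> sqarea a' b' d' \<le> sqarea a b d"
    using optimal_rect_exists[OF P] by blast
  have "covered (sqarea a b d)"
    using opt by (intro optimal_covered) (simp_all add: region)
  then have "runs \<sigma> program (input_store vs) (run_time (length vs))
    (\<lambda>s. rect_in P (out_point s 0) (out_point s 1) (out_point s 2) (out_point s 3) \<and>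
      sqarea a b d \<le> sqarea (out_point s 0) (out_point s 1) (out_point s 3))"
    using runs_program[OF \<sigma> refl refl _ opt(2)] by (simp add: region)
  then obtain t s where run: "exec \<sigma> program (input_store vs) t s" "t \<le> run_time (length vs)"
      and rect: "rect_in P (out_point s 0) (out_point s 1) (out_point s 2) (out_point s 3)"
      and ge: "sqarea a b d \<le> sqarea (out_point s 0) (out_point s 1) (out_point s 3)"
    unfolding runs_def by blast
  \<comment> \<open>The output need not be the rectangle \<open>a\<close>, \<open>b\<close>,
    \<open>c\<close>, \<open>d\<close>; being at least as large as an optimal one, it is optimal
    itself.\<close>
  have "sqarea a' b' d' \<le> sqarea (out_point s 0) (out_point s 1) (out_point s 3)"
    if "rect_in P a' b' c' d'" for a' b' c' d'
    using opt(3)[OF that] ge by simp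
  then show "finds_max_rectangle \<sigma> program P vs (run_time (length vs))"
    using run max_area_rectangleI[OF P(2) rect] opt(2) ge
    unfolding finds_max_rectangle_def Let_def by fastforce
qed

end
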